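(* Let $\Omega\subset D_m$ be generic, $\Lambda=\{(t,x_t):t\in\mathbb{R}_+,x\in\Omega\}$, $x\in\Omega\cap Q^\pi_m$ and $T\ge0$. For any $F\in C^{1,2}(\Lambda)$, $$F(T,x_T)=F(0,x_0)+\int_0^T\mathcal{D}F(t,x_t)\,dt+\int_0^T\nabla_xF(t,x_{t-})\,dx+\frac12\int_0^T\nabla_x^2F(t,x_{t-})\,d[x]^c+\sum_{t\le T}\big(\Delta F(t,x_t)-\nabla_xF(t,x_{t-})\cdot\Delta x(t)\big),$$ where the series is absolutely convergent and the pointwise limit $$\int_0^T\nabla_xF(t,x_{t-})\,dx:=\lim_{n\to\infty}\sum_{\pi_n\ni t_i\le T}\nabla_xF(t_i,x^n_{t_i-})\cdot(x(t_{i+1})-x(t_i))$$ exists.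
   Context: Partitions: $\pi=(\pi_n)_{n\ge1}$ is a fixed sequence of partitions $\pi_n=(0=t^n_0<\dots<t^n_{k_n}<\infty)$ of $[0,\infty)$ with $t^n_{k_n}\to\infty$ and mesh vanishing on compacts; the superscript $n$ is dropped and sums involving $t_{i+1}$ run over $i<k_n$. Paths: $D_m$ is the space of càdlàg functions $[0,\infty)\to\mathbb{R}^m$, $x(0-):=x(0)$, $\Delta x(t):=x(t)-x(t-)$; $x_t(s):=x(s\wedge t)$, $x_{t-}(s):=x(s)1_{s<t}+x(t-)1_{s\ge t}$. $x^n:=\sum_{t_i\in\pi_n}x(t_{i+1})1_{[t_i,t_{i+1})}$, and $x^n_t,x^n_{t-}$ are the stopped versions of $x^n$. $Q^\pi_m$ is the set of $x\in D_m$ for which $q_n(t):=\sum_{\pi_n\ni t_i\le t}(x(t_{i+1})-x(t_i))(x(t_{i+1})-x(t_i))'$ converges in the Skorokhod $J_1$ topology; the limit is $[x]=([x_i,x_j])_{i,j}$, whose entries have locally bounded variation and satisfy $[x_i,x_j](t)=[x_i,x_j]^c(t)+\sum_{s\le t}\Delta x_i(s)\Delta x_j(s)$ with $[x_i,x_j]^c$ continuous. For matrix-valued $A$, $\int_0^TA\,d[x]^c:=\sum_{i,j}\int_0^TA_{ij}\,d[x_i,x_j]^c$. Generic sets: a nonempty $\Omega\subset D_m$ is generic if (i) for every $x\in\Omega$, $T>0$ there is $N=N_T(x)$ with $x^n_T\in\Omega$ for all $n\ge N$; (ii) for every $x\in\Omega$, $t\ge0$ there is a convex neighbourhood $\mathcal{U}$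 of $0$ in $\mathbb{R}^m$ with $-\Delta x(t)\in\mathcal{U}$ and $x_t+e1_{[t,\infty)}\in\Omega$ for all $e\in\mathcal{U}$. Consequently, at each $(t,x)$ one fixes a convex neighbourhood $\mathcal{U}_{t-}(x)$ of $0$ containing $\Delta x(t)$ with $x_{t-}+e1_{[t,\infty)}\in\Omega$ for all $e\in\mathcal{U}_{t-}(x)$. Continuity of functionals $F$ on $\Lambda$: let $t'_n:=\max\{t_i<t:t_i\in\pi_n\}$ (and $0$ if there is no such $t_i$). $F$ is left-continuous if for all $(t,x_t)\in\Lambda$ ($x\in\Omega$): 1(a) $\lim_{s\uparrow t,\,s\le t}F(s,x_{s-})=F(t,x_{t-})$; 1(b) $\lim_{s\uparrow t,\,s<t}F(s,x_s)=F(t,x_{t-})$; 1(c) $t_n\to t$, $t_n\le t'_n$ implies $F(t_n,x^n_{t_n-})\to F(t,x_{t-})$; 1(d) $t_n\to t$, $t_n<t'_n$ implies $F(t_n,x^n_{t_n})\to F(t,x_{t-})$. $F$ is right-continuous if for all such $(t,x_t)$: 2(a) $\lim_{s\downarrow t,\,s\ge t}F(s,x_s)=F(t,x_t)$; 2(b) $\lim_{s\downarrow t,\,s>t}F(s,x_{s-})=F(t,x_t)$; 2(c) $t_n\to t$, $t_n\ge t'_n$ implies $F(t_n,x^n_{t_n})\to F(t,x_t)$; 2(d) $t_n\to t$, $t_n>t'_n$ implies $F(t_n,x^n_{t_n-})\to F(t,x_t)$. $F$ is continuous if it is both left- and right-continuous. Vector- and matrix-valued functionals: componentwise. Notation: $F_-(t,x_t):=F(t,x_{t-})$,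 $\Delta F(t,x_t):=F(t,x_t)-F(t,x_{t-})$. Derivatives: $\mathcal{D}F(t,x_t):=\lim_{h\downarrow0}\frac{F(t+h,x_t)-F(t,x_t)}{h}$; $\nabla_xF(t,x_t)$ is the gradient at $e=0$ of $e\mapsto F(t,x_t+e1_{[t,\infty)})$; $\nabla_x^2F$ is the vertical derivative of $\nabla_xF$. $F$ is locally bounded if for every $x\in\Omega$, $T\ge0$ there is $n_0\ge N_T(x)$ such that the family $(t\mapsto F(t,x^n_t))_{n\ge n_0}$ is bounded on $[0,T]$ uniformly in $n\ge n_0$. $F$ admits a modulus of vertical continuity if for every $x\in\Omega$, $T\ge0$, $r>0$ there is an increasing $\omega:\mathbb{R}_+\to\mathbb{R}_+$ with $\omega(0+)=0$ and $|F(t,x^n_{t-}+a1_{[t,\infty)})-F(t,x^n_{t-}+b1_{[t,\infty)})|\le\omega(|a-b|)$ for all $a,b\in\mathcal{U}_{t-}(x^n)\cap\overline{B}_r(0)$, $t\le T$ and all sufficiently large $n$. $C^{1,2}(\Lambda)$: continuous $F:\Lambda\to\mathbb{R}$ such that $\mathcal{D}F,\nabla_xF,\nabla_x^2F$ exist on $\Lambda$; $\mathcal{D}F$ is right-continuous and locally bounded; $(\nabla_xF)_-$ is left-continuous; $(\nabla^2_xF)_-$ is left-continuous and locally bounded, and $\nabla_x^2F$ admits a modulus of vertical continuity. *)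

theory Defs
  imports "HOL-Analysis.Analysis"
begin

section \<open>Cadlag paths\<close>

text \<open>
  A path on the half-line is represented by a function on the whole real line which is constant to
  the left of 0. Two paths that agree on the half-line are then equal as functions, and the
  convention that the left limit at 0 is the value at 0 holds automatically. Every construction of
  paths below respects this normalization, which is why some of them evaluate at \<open>max s 0\<close>.
\<close>

definition cadlag_paths :: "(real \<Rightarrow> 'a::real_normed_vector) set" where
  "cadlag_paths = {x. (\<forall>s<0. x s = x 0) \<and>
     (\<forall>t\<ge>0. continuous (at_right t) x \<and> (\<exists>l. (x \<longlongrightarrow> l) (at_left t)))}"

definition left_lim :: "(real \<Rightarrow> 'a::real_normed_vector) \<Rightarrow> real \<Rightarrow> 'a" where
  "left_lim x t = Lim (at_left t) x"

definition jump :: "(real \<Rightarrow> 'a::real_normed_vector) \<Rightarrow> real \<Rightarrow> 'a" where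
  "jump x t = x t - left_lim x t"

definition stop :: "(real \<Rightarrow> 'a) \<Rightarrow> real \<Rightarrow> (real \<Rightarrow> 'a)" where
  "stop x t = (\<lambda>s. x (min s t))"

definition stop_left :: "(real \<Rightarrow> 'a::real_normed_vector) \<Rightarrow> real \<Rightarrow> (real \<Rightarrow> 'a)" where
  "stop_left x t = (\<lambda>s. if s < t then x s else left_lim x t)"

text \<open>The path \<open>x + e 1\<^bsub>[t,\<infinity>)\<^esub>\<close>, for \<open>t \<ge> 0\<close>.\<close>

definition bump :: "(real \<Rightarrow> 'a::real_normed_vector) \<Rightarrow> real \<Rightarrow> 'a \<Rightarrow> (real \<Rightarrow> 'a)" where
  "bump x t e = (\<lambda>s. x s + (if t \<le> max s 0 then e else 0))"


section \<open>Sequences of partitions\<close>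

text \<open>
  The partition \<open>0 = t\<^sub>0 < \<dots> < t\<^sub>k\<close> is the list of its points; sums involving \<open>t\<^bsub>i+1\<^esub>\<close> run over
  \<open>i < k = length (\<pi> n) - 1\<close>.
\<close>

definition partition_seq :: "(nat \<Rightarrow> real list) \<Rightarrow> bool" where
  "partition_seq \<pi> \<longleftrightarrow>
     (\<forall>n. \<pi> n \<noteq> [] \<and> hd (\<pi> n) = 0 \<and> sorted_wrt (<) (\<pi> n)) \<and>
     filterlim (\<lambda>n. last (\<pi> n)) at_top sequentially \<and>
     (\<forall>T\<ge>0. \<forall>\<epsilon>>0. \<forall>\<^sub>F n in sequentially. \<forall>i<length (\<pi> n) - 1.
        min (\<pi> n ! Suc i) T - min (\<pi> n ! i) T < \<epsilon>)"

text \<open>The piecewise constant path \<open>x\<^sup>n\<close>. It vanishes from the last partition point on.\<close>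

definition pc_path ::
  "(nat \<Rightarrow> real list) \<Rightarrow> (real \<Rightarrow> 'a::real_normed_vector) \<Rightarrow> nat \<Rightarrow> (real \<Rightarrow> 'a)" where
  "pc_path \<pi> x n = (\<lambda>s. \<Sum>i<length (\<pi> n) - 1.
     indicat_real {\<pi> n ! i ..< \<pi> n ! Suc i} (max s 0) *\<^sub>R x (\<pi> n ! Suc i))"

text \<open>The last point of \<open>\<pi>\<^sub>n\<close> strictly before \<open>t\<close> (the time \<open>t'\<^sub>n\<close>).\<close>

definition prev_point :: "(nat \<Rightarrow> real list) \<Rightarrow> real \<Rightarrow> nat \<Rightarrow> real" where
  "prev_point \<pi> t n =
     (if \<exists>s\<in>set (\<pi> n). s < t then Max {s \<in> set (\<pi> n). s < t} else 0)"


section \<open>Quadratic variation along a sequence of partitions\<close>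

text \<open>
  Convergence of a sequence of paths in the Skorokhod \<open>J\<^sub>1\<close> topology on the half-line
  (Jacod and Shiryaev, Limit Theorems for Stochastic Processes, Theorem VI.1.14). An increasing
  bijection of the half-line is automatically a homeomorphism fixing 0.
\<close>

definition tendsto_J1 ::
  "(nat \<Rightarrow> real \<Rightarrow> 'a::real_normed_vector) \<Rightarrow> (real \<Rightarrow> 'a) \<Rightarrow> bool" where
  "tendsto_J1 X x \<longleftrightarrow> (\<exists>\<rho>::nat \<Rightarrow> real \<Rightarrow> real.
     (\<forall>n. strict_mono_on {0..} (\<rho> n) \<and> \<rho> n ` {0..} = {0..}) \<and>
     uniform_limit {0..} \<rho> (\<lambda>s. s) sequentially \<and>
     (\<forall>T\<ge>0. uniform_limit {0..T} (\<lambda>n s. X n (\<rho> n s)) x sequentially))"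

definition qv_approx ::
  "(nat \<Rightarrow> real list) \<Rightarrow> (real \<Rightarrow> real^'m) \<Rightarrow> nat \<Rightarrow> real \<Rightarrow> real^'m^'m" where
  "qv_approx \<pi> x n t =
     (\<Sum>k | k < length (\<pi> n) - 1 \<and> \<pi> n ! k \<le> max t 0.
        \<chi> i j. (x (\<pi> n ! Suc k) - x (\<pi> n ! k)) $ i * (x (\<pi> n ! Suc k) - x (\<pi> n ! k)) $ j)"

definition qv_paths :: "(nat \<Rightarrow> real list) \<Rightarrow> (real \<Rightarrow> real^'m) set" where
  "qv_paths \<pi> = {x \<in> cadlag_paths. \<exists>q\<in>cadlag_paths. tendsto_J1 (qv_approx \<pi> x) q}"

definition qv :: "(nat \<Rightarrow> real list) \<Rightarrow> (real \<Rightarrow> real^'m) \<Rightarrow> real \<Rightarrow> real^'m^'m" where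
  "qv \<pi> x = (THE q. q \<in> cadlag_paths \<and> tendsto_J1 (qv_approx \<pi> x) q)"

text \<open>The continuous part \<open>[x\<^sub>i, x\<^sub>j]\<^sup>c\<close>.\<close>

definition qv_cont ::
  "(nat \<Rightarrow> real list) \<Rightarrow> (real \<Rightarrow> real^'m) \<Rightarrow> 'm \<Rightarrow> 'm \<Rightarrow> real \<Rightarrow> real" where
  "qv_cont \<pi> x i j t = qv \<pi> x t $ i $ j - (\<Sum>\<^sub>\<infinity>s\<in>{0..t}. jump x s $ i * jump x s $ j)"


section \<open>Lebesgue-Stieltjes integral against a function of bounded variation\<close>

text \<open>
  The integral over \<open>(0,T]\<close> against \<open>g = u - v\<close>, with \<open>u\<close> and \<open>v\<close> nondecreasing and
  right-continuous; the value does not depend on the choice of \<open>u\<close> and \<open>v\<close>.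
\<close>

definition has_stieltjes_integral ::
  "(real \<Rightarrow> real) \<Rightarrow> (real \<Rightarrow> real) \<Rightarrow> real \<Rightarrow> real \<Rightarrow> bool" where
  "has_stieltjes_integral f g T I \<longleftrightarrow> (\<exists>u v :: real \<Rightarrow> real.
     mono u \<and> mono v \<and> (\<forall>s. continuous (at_right s) u) \<and> (\<forall>s. continuous (at_right s) v) \<and>
     (\<forall>s\<in>{0..T}. g s = u s - v s) \<and>
     set_integrable (interval_measure u) {0<..T} f \<and>
     set_integrable (interval_measure v) {0<..T} f \<and>
     I = (LINT s:{0<..T}|interval_measure u. f s) - (LINT s:{0<..T}|interval_measure v. f s))"

definition stieltjes_integrable ::
  "(real \<Rightarrow> real) \<Rightarrow> (real \<Rightarrow> real) \<Rightarrow> real \<Rightarrow> bool" where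
  "stieltjes_integrable f g T \<longleftrightarrow> (\<exists>I. has_stieltjes_integral f g T I)"

definition stieltjes_integral ::
  "(real \<Rightarrow> real) \<Rightarrow> (real \<Rightarrow> real) \<Rightarrow> real \<Rightarrow> real" where
  "stieltjes_integral f g T = (THE I. has_stieltjes_integral f g T I)"


section \<open>Generic sets of paths\<close>

definition generic :: "(nat \<Rightarrow> real list) \<Rightarrow> (real \<Rightarrow> real^'m) set \<Rightarrow> bool" where
  "generic \<pi> \<Omega> \<longleftrightarrow> \<Omega> \<noteq> {} \<and> \<Omega> \<subseteq> cadlag_paths \<and>
     (\<forall>x\<in>\<Omega>. \<forall>T>0. \<exists>N. \<forall>n\<ge>N. stop (pc_path \<pi> x n) T \<in> \<Omega>) \<and>
     (\<forall>x\<in>\<Omega>. \<forall>t\<ge>0. \<exists>U. convex U \<and> 0 \<in> interior U \<and> - jump x t \<in> U \<and>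
        (\<forall>e\<in>U. bump (stop x t) t e \<in> \<Omega>))"

text \<open>\<open>U t x\<close> is the neighbourhood fixed at \<open>(t, x)\<close>.\<close>

definition admissible_nhds ::
  "(real \<Rightarrow> real^'m) set \<Rightarrow> (real \<Rightarrow> (real \<Rightarrow> real^'m) \<Rightarrow> (real^'m) set) \<Rightarrow> bool" where
  "admissible_nhds \<Omega> U \<longleftrightarrow> (\<forall>x\<in>\<Omega>. \<forall>t\<ge>0.
     convex (U t x) \<and> 0 \<in> interior (U t x) \<and> jump x t \<in> U t x \<and>
     (\<forall>e\<in>U t x. bump (stop_left x t) t e \<in> \<Omega>))"

definition stopped_domain :: "(real \<Rightarrow> 'a) set \<Rightarrow> (real \<times> (real \<Rightarrow> 'a)) set" where
  "stopped_domain \<Omega> = {(t, stop x t) | t x. 0 \<le> t \<and> x \<in> \<Omega>}"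


section \<open>Functionals\<close>

text \<open>
  A functional on \<open>stopped_domain \<Omega>\<close> is a total function of time and path; its values elsewhere
  are irrelevant. In the conditions on sequences below, the arguments lie in \<open>stopped_domain \<Omega>\<close>
  for all large \<open>n\<close> when \<open>\<Omega>\<close> is generic.
\<close>

type_synonym ('m, 'b) functional = "real \<Rightarrow> (real \<Rightarrow> real^'m) \<Rightarrow> 'b"

definition minus_functional ::
  "('m::finite, 'b) functional \<Rightarrow> ('m, 'b) functional" where
  "minus_functional F = (\<lambda>t y. F t (stop_left y t))"

definition left_continuous_functional ::
  "(nat \<Rightarrow> real list) \<Rightarrow> (real \<Rightarrow> real^'m) set \<Rightarrow> ('m::finite, 'b::real_normed_vector) functional \<Rightarrow> bool"
  where
  "left_continuous_functional \<pi> \<Omega> F \<longleftrightarrow> (\<forall>x\<in>\<Omega>. \<forall>t\<ge>0.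
     ((\<lambda>s. F s (stop_left x s)) \<longlongrightarrow> F t (stop_left x t)) (at t within {0..t}) \<and>
     ((\<lambda>s. F s (stop x s)) \<longlongrightarrow> F t (stop_left x t)) (at t within {0..<t}) \<and>
     (\<forall>\<tau>. (\<forall>n. 0 \<le> \<tau> n \<and> \<tau> n \<le> prev_point \<pi> t n) \<and> \<tau> \<longlonglongrightarrow> t \<longrightarrow>
        (\<lambda>n. F (\<tau> n) (stop_left (pc_path \<pi> x n) (\<tau> n))) \<longlonglongrightarrow> F t (stop_left x t)) \<and>
     (\<forall>\<tau>. (\<forall>n. 0 \<le> \<tau> n \<and> \<tau> n < prev_point \<pi> t n) \<and> \<tau> \<longlonglongrightarrow> t \<longrightarrow>
        (\<lambda>n. F (\<tau> n) (stop (pc_path \<pi> x n) (\<tau> n))) \<longlonglongrightarrow> F t (stop_left x t)))"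

definition right_continuous_functional ::
  "(nat \<Rightarrow> real list) \<Rightarrow> (real \<Rightarrow> real^'m) set \<Rightarrow> ('m::finite, 'b::real_normed_vector) functional \<Rightarrow> bool"
  where
  "right_continuous_functional \<pi> \<Omega> F \<longleftrightarrow> (\<forall>x\<in>\<Omega>. \<forall>t\<ge>0.
     ((\<lambda>s. F s (stop x s)) \<longlongrightarrow> F t (stop x t)) (at t within {t..}) \<and>
     ((\<lambda>s. F s (stop_left x s)) \<longlongrightarrow> F t (stop x t)) (at t within {t<..}) \<and>
     (\<forall>\<tau>. (\<forall>n. 0 \<le> \<tau> n \<and> prev_point \<pi> t n \<le> \<tau> n) \<and> \<tau> \<longlonglongrightarrow> t \<longrightarrow>
        (\<lambda>n. F (\<tau> n) (stop (pc_path \<pi> x n) (\<tau> n))) \<longlonglongrightarrow> F t (stop x t)) \<and>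
     (\<forall>\<tau>. (\<forall>n. 0 \<le> \<tau> n \<and> prev_point \<pi> t n < \<tau> n) \<and> \<tau> \<longlonglongrightarrow> t \<longrightarrow>
        (\<lambda>n. F (\<tau> n) (stop_left (pc_path \<pi> x n) (\<tau> n))) \<longlonglongrightarrow> F t (stop x t)))"

definition locally_bounded_functional ::
  "(nat \<Rightarrow> real list) \<Rightarrow> (real \<Rightarrow> real^'m) set \<Rightarrow> ('m::finite, 'b::real_normed_vector) functional \<Rightarrow> bool"
  where
  "locally_bounded_functional \<pi> \<Omega> F \<longleftrightarrow> (\<forall>x\<in>\<Omega>. \<forall>T\<ge>0. \<exists>n0.
     (\<forall>n\<ge>n0. stop (pc_path \<pi> x n) T \<in> \<Omega>) \<and>
     (\<exists>K. \<forall>n\<ge>n0. \<forall>t\<in>{0..T}. norm (F t (stop (pc_path \<pi> x n) t)) \<le> K))"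

text \<open>
  \<open>x\<^sup>n\<close> itself need not belong to \<open>\<Omega>\<close>, but \<open>x\<^sup>n\<close> stopped at \<open>t\<close> does for large \<open>n\<close>, so the
  neighbourhood at time \<open>t\<close> is taken at the stopped path.
\<close>

definition vertical_modulus ::
  "(nat \<Rightarrow> real list) \<Rightarrow> (real \<Rightarrow> real^'m) set \<Rightarrow> (real \<Rightarrow> (real \<Rightarrow> real^'m) \<Rightarrow> (real^'m) set) \<Rightarrow>
    ('m::finite, 'b::real_normed_vector) functional \<Rightarrow> bool" where
  "vertical_modulus \<pi> \<Omega> U F \<longleftrightarrow> (\<forall>x\<in>\<Omega>. \<forall>T\<ge>0. \<forall>r>0. \<exists>\<omega>::real \<Rightarrow> real.
     mono_on {0..} \<omega> \<and> (\<forall>u\<ge>0. 0 \<le> \<omega> u) \<and> (\<omega> \<longlongrightarrow> 0) (at_right 0) \<and>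
     (\<forall>\<^sub>F n in sequentially. \<forall>t\<in>{0..T}.
        \<forall>a \<in> U t (stop (pc_path \<pi> x n) t) \<inter> cball 0 r.
        \<forall>b \<in> U t (stop (pc_path \<pi> x n) t) \<inter> cball 0 r.
          norm (F t (bump (stop_left (pc_path \<pi> x n) t) t a) -
                F t (bump (stop_left (pc_path \<pi> x n) t) t b)) \<le> \<omega> (norm (a - b))))"


section \<open>Horizontal and vertical derivatives\<close>

definition horizontal_differentiable ::
  "('m::finite, real) functional \<Rightarrow> real \<Rightarrow> (real \<Rightarrow> real^'m) \<Rightarrow> bool" where
  "horizontal_differentiable F t y \<longleftrightarrow>
     (\<exists>l. ((\<lambda>h. (F (t + h) y - F t y) / h) \<longlongrightarrow> l) (at_right 0))"

definition horizontal_deriv :: "('m::finite, real) functional \<Rightarrow> ('m, real) functional" where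
  "horizontal_deriv F t y = Lim (at_right 0) (\<lambda>h. (F (t + h) y - F t y) / h)"

definition vertical_differentiable ::
  "('m::finite, real) functional \<Rightarrow> real \<Rightarrow> (real \<Rightarrow> real^'m) \<Rightarrow> bool" where
  "vertical_differentiable F t y \<longleftrightarrow> (\<exists>g. GDERIV (\<lambda>e. F t (bump y t e)) 0 :> g)"

definition vertical_grad :: "('m::finite, real) functional \<Rightarrow> ('m, real^'m) functional" where
  "vertical_grad F t y = (THE g. GDERIV (\<lambda>e. F t (bump y t e)) 0 :> g)"

definition vertical_twice_differentiable ::
  "('m::finite, real) functional \<Rightarrow> real \<Rightarrow> (real \<Rightarrow> real^'m) \<Rightarrow> bool" where
  "vertical_twice_differentiable F t y \<longleftrightarrow>
     (\<exists>H. ((\<lambda>e. vertical_grad F t (bump y t e)) has_derivative (\<lambda>e. H *v e)) (at 0))"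

definition vertical_hess :: "('m::finite, real) functional \<Rightarrow> ('m, real^'m^'m) functional" where
  "vertical_hess F t y =
     (THE H. ((\<lambda>e. vertical_grad F t (bump y t e)) has_derivative (\<lambda>e. H *v e)) (at 0))"

definition C12 ::
  "(nat \<Rightarrow> real list) \<Rightarrow> (real \<Rightarrow> real^'m) set \<Rightarrow> (real \<Rightarrow> (real \<Rightarrow> real^'m) \<Rightarrow> (real^'m) set) \<Rightarrow>
    ('m::finite, real) functional set" where
  "C12 \<pi> \<Omega> U = {F.
     left_continuous_functional \<pi> \<Omega> F \<and> right_continuous_functional \<pi> \<Omega> F \<and>
     (\<forall>(t, y)\<in>stopped_domain \<Omega>.
        horizontal_differentiable F t y \<and> vertical_differentiable F t y \<and>
        vertical_twice_differentiable F t y) \<and>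
     right_continuous_functional \<pi> \<Omega> (horizontal_deriv F) \<and>
     locally_bounded_functional \<pi> \<Omega> (horizontal_deriv F) \<and>
     left_continuous_functional \<pi> \<Omega> (minus_functional (vertical_grad F)) \<and>
     left_continuous_functional \<pi> \<Omega> (minus_functional (vertical_hess F)) \<and>
     locally_bounded_functional \<pi> \<Omega> (minus_functional (vertical_hess F)) \<and>
     vertical_modulus \<pi> \<Omega> U (vertical_hess F)}"


section \<open>The pathwise integral\<close>

definition pathwise_sums ::
  "(nat \<Rightarrow> real list) \<Rightarrow> ('m::finite, real) functional \<Rightarrow> (real \<Rightarrow> real^'m) \<Rightarrow> real \<Rightarrow> nat \<Rightarrow> real"
  where
  "pathwise_sums \<pi> F x T n =
     (\<Sum>i | i < length (\<pi> n) - 1 \<and> \<pi> n ! i \<le> T.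
        vertical_grad F (\<pi> n ! i) (stop_left (pc_path \<pi> x n) (\<pi> n ! i)) \<bullet>
          (x (\<pi> n ! Suc i) - x (\<pi> n ! i)))"

definition pathwise_integral ::
  "(nat \<Rightarrow> real list) \<Rightarrow> ('m::finite, real) functional \<Rightarrow> (real \<Rightarrow> real^'m) \<Rightarrow> real \<Rightarrow> real"
  where
  "pathwise_integral \<pi> F x T = lim (pathwise_sums \<pi> F x T)"

end

theory Submission
  imports Defs "HOL-Probability.Weak_Convergence"
begin

text \<open>
  Along \<open>x\<^sup>n\<close> the map \<open>t \<mapsto> F(t, x\<^sup>n\<^sub>t)\<close> has right derivative \<open>\<D>F\<close> between partition points and jumps only
  at them. Taylor expansion turns the jump at \<open>t\<^sub>k\<close> into \<open>\<nabla>F \<bullet> d\<^sub>k + (d\<^sub>k \<bullet> \<nabla>\<^sup>2F d\<^sub>k)/2 + R\<^sub>k\<close> with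
  \<open>d\<^sub>k = x(t\<^bsub>k+1\<^esub>) - x(t\<^sub>k)\<close> and \<open>R\<^sub>k = O(\<omega>(|d\<^sub>k|) |d\<^sub>k|\<^sup>2)\<close>, so that only sums of the form
  \<open>\<Sum> \<psi>\<^sub>k (v \<bullet> d\<^sub>k)\<^sup>2\<close> have to converge. Such a sum is a Lebesgue integral in the variable
  \<open>u = \<Sum>\<^bsub>j\<le>k\<^esub> (v \<bullet> d\<^sub>j)\<^sup>2\<close>. For almost every \<open>u\<close> the index \<open>k\<close> of the cell that contains \<open>u\<close> either is
  eventually the cell carrying a fixed jump of \<open>[v \<bullet> x]\<close>, or \<open>t\<^sub>k\<close> tends to a continuity point outside
  any given countable set, and dominated convergence applies. A functional that is only
  left-continuous along the partitions has full limits off a countable set, which is enough for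
  \<open>\<nabla>\<^sup>2F\<close>; and \<open>R\<^sub>k/|d\<^sub>k|\<^sup>2\<close> tends to 0 off the jumps of \<open>x\<close>.
\<close>

section \<open>One-sided continuity\<close>

text \<open>Skorokhod convergence controls the mass carried by the cells only up to a change of
  time, while the weights are attached to the cells themselves. Ordering the cells by accumulated
  mass removes the time change: all sums become integrals against Lebesgue measure on one line, and
  only pointwise convergence of step functions has to be checked. The obstacle is that an atom of
  the limit must be carried asymptotically by a single cell. This amounts to the identity between
  the jumps of [z] and the squared jumps of z, and it is here that locally uniform convergence after
  the time change enters. Off-diagonal entries have no sign, so everything is proved for the scalar
  paths \<open>v \<bullet> x\<close> and recovered by polarization. This also exhibits [x_i, x_j]^c
  as a difference of two distribution functions, and the jump contributions as the atomic part of an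
  integrable function, which is why the series converges absolutely. The sums of the gradient are
  never treated directly: every other term of the telescoped identity converges, hence so do
  they.\<close>

lemma countable_left_isolated:
  fixes S :: "real set"
  assumes "\<And>t. t \<in> S \<Longrightarrow> \<exists>\<eta>>0. {t - \<eta><..<t} \<inter> S = {}"
  shows "countable S"
proof -
  obtain \<eta> where \<eta>: "\<And>t. t \<in> S \<Longrightarrow> \<eta> t > 0" "\<And>t. t \<in> S \<Longrightarrow> {t - \<eta> t<..<t} \<inter> S = {}"
    using assms by metis
  \<comment> \<open>The gaps to the left of distinct points of S are disjoint nonempty open
    intervals, and the line holds only countably many of those.\<close>
  define I where "I t = {t - \<eta> t<..<t}" for t
  have ne: "I t \<noteq> {}" if "t \<in> S" for t
    using \<eta>(1)[OF that] by (simp add: I_def)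
  have less: "I s \<inter> I t = {}" if "s \<in> S" "t \<in> S" "s < t" for s t
  proof -
    have "s \<notin> I t"
      using that \<eta>(2)[of t] by (auto simp: I_def)
    then show ?thesis
      using that by (auto simp: I_def)
  qed
  have dis: "I s \<inter> I t = {}" if "s \<in> S" "t \<in> S" "s \<noteq> t" for s t
    using that less[of s t] less[of t s] by (metis inf_commute less_linear)
  have "inj_on I S"
    using dis ne by (metis inf.idem inj_onI)
  moreover have "countable (I ` S)"
    by (rule countable_disjoint_open_subsets) (auto simp: I_def pairwise_def disjnt_def dest: dis)
  ultimately show ?thesis
    using countable_image_inj_on by blast
qed

section \<open>Measurability from one-sided continuity\<close>

text \<open>f is a pointwise limit of step functions, sampled at the grid point just before the
  argument. The indicator discards the arguments where nothing is assumed.\<close>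

lemma borel_measurable_left_continuous:
  fixes f :: "real \<Rightarrow> real"
  assumes "\<And>t. t > 0 \<Longrightarrow> (f \<longlongrightarrow> f t) (at_left t)"
  shows "(\<lambda>t. indicator {0<..} t * f t) \<in> borel_measurable borel"
proof (rule borel_measurable_LIMSEQ_real)
  fix t :: real
  define s where "s n = real_of_int (\<lceil>real (Suc n) * t\<rceil> - 1) / real (Suc n)" for n
  have lt: "s n < t" for n
    unfolding s_def by (simp add: field_simps) linarith
  have gt: "t - 1 / real (Suc n) \<le> s n" for n
  proof -
    have "(real (Suc n) * t - 1) / real (Suc n) \<le> s n"
      unfolding s_def by (intro divide_right_mono) linarith+
    then show ?thesis by (simp add: diff_divide_distrib)
  qed
  have "(\<lambda>n. t - 1 / real (Suc n)) \<longlonglongrightarrow> t - 0"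
    by (intro tendsto_intros LIMSEQ_Suc[OF lim_1_over_n])
  then have "s \<longlonglongrightarrow> t"
    by (intro tendsto_sandwich[OF _ _ _ tendsto_const[of t], of _ s])
      (auto intro!: always_eventually gt less_imp_le[OF lt] simp del: of_nat_Suc)
  then have "filterlim s (at_left t) sequentially"
    using lt by (auto simp: filterlim_at intro!: always_eventually less_imp_neq)
  then have "(\<lambda>n. f (s n)) \<longlonglongrightarrow> f t" if "t > 0"
    using assms[OF that] filterlim_compose by blast
  then show "(\<lambda>n. indicator {0<..} t * f (real_of_int (\<lceil>real (Suc n) * t\<rceil> - 1) / real (Suc n)))
      \<longlonglongrightarrow> indicator {0<..} t * f t"
    unfolding s_def by (cases "t > 0") (auto intro!: tendsto_intros)
next
  fix n
  have "(\<lambda>t. f (real_of_int (\<lceil>real (Suc n) * t\<rceil> - 1) / real (Suc n))) \<in> borel_measurable borel"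
    by (rule measurable_compose[where f = "\<lambda>t. \<lceil>real (Suc n) * t\<rceil>" and N = "count_space UNIV"]) measurable
  then show "(\<lambda>t. indicator {0<..} t * f (real_of_int (\<lceil>real (Suc n) * t\<rceil> - 1) / real (Suc n)))
      \<in> borel_measurable borel"
    by measurable
qed

lemma borel_measurable_right_continuous:
  fixes f :: "real \<Rightarrow> real"
  assumes "\<And>t. t \<ge> 0 \<Longrightarrow> (f \<longlongrightarrow> f t) (at_right t)"
  shows "(\<lambda>t. indicator {0..} t * f t) \<in> borel_measurable borel"
proof (rule borel_measurable_LIMSEQ_real)
  fix t :: real
  define s where "s n = real_of_int (\<lfloor>real (Suc n) * t\<rfloor> + 1) / real (Suc n)" for n
  have gt: "t < s n" for n
    unfolding s_def by (simp add: field_simps) linarith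
  have le: "s n \<le> t + 1 / real (Suc n)" for n
  proof -
    have "s n \<le> (real (Suc n) * t + 1) / real (Suc n)"
      unfolding s_def by (intro divide_right_mono) linarith+
    then show ?thesis by (simp add: add_divide_distrib)
  qed
  have "(\<lambda>n. t + 1 / real (Suc n)) \<longlonglongrightarrow> t + 0"
    by (intro tendsto_intros LIMSEQ_Suc[OF lim_1_over_n])
  then have "s \<longlonglongrightarrow> t"
    by (intro tendsto_sandwich[OF _ _ tendsto_const[of t], of s])
      (auto intro!: always_eventually le less_imp_le[OF gt] simp del: of_nat_Suc)
  then have "filterlim s (at_right t) sequentially"
    using gt by (auto simp: filterlim_at intro!: always_eventually less_imp_neq[symmetric])
  then have "(\<lambda>n. f (s n)) \<longlonglongrightarrow> f t" if "t \<ge> 0"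
    using assms[OF that] filterlim_compose by blast
  then show "(\<lambda>n. indicator {0..} t * f (real_of_int (\<lfloor>real (Suc n) * t\<rfloor> + 1) / real (Suc n)))
      \<longlonglongrightarrow> indicator {0..} t * f t"
    unfolding s_def by (cases "t \<ge> 0") (auto intro!: tendsto_intros)
next
  fix n
  have "(\<lambda>t. f (real_of_int (\<lfloor>real (Suc n) * t\<rfloor> + 1) / real (Suc n))) \<in> borel_measurable borel"
    by (rule measurable_compose[where f = "\<lambda>t. \<lfloor>real (Suc n) * t\<rfloor>" and N = "count_space UNIV"]) measurable
  then show "(\<lambda>t. indicator {0..} t * f (real_of_int (\<lfloor>real (Suc n) * t\<rfloor> + 1) / real (Suc n)))
      \<in> borel_measurable borel"
    by measurable
qed

section \<open>Calculus with right derivatives\<close>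

text \<open>Continuous induction: for every \<epsilon> > 0 the initial segment on which f moves at
  rate at most \<epsilon> is closed by continuity and can be prolonged to the right by the
  derivative, so it is all of [a,b].\<close>

lemma right_derivative_zero_constant:
  fixes f :: "real \<Rightarrow> real"
  assumes ab: "a \<le> b" and cont: "continuous_on {a..b} f"
    and der: "\<And>t. a \<le> t \<Longrightarrow> t < b \<Longrightarrow> ((\<lambda>h. (f (t + h) - f t) / h) \<longlongrightarrow> 0) (at_right 0)"
  shows "f b = f a"
proof -
  have bound: "\<bar>f b - f a\<bar> \<le> \<epsilon> * (b - a)" if "\<epsilon> > 0" for \<epsilon>
  proof -
    define S where "S = {t \<in> {a..b}. \<forall>s\<in>{a..t}. \<bar>f s - f a\<bar> \<le> \<epsilon> * (s - a)}"
    define c where "c = Sup S"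
    have aS: "a \<in> S"
      using ab by (auto simp: S_def)
    have bdd: "bdd_above S"
      by (auto simp: S_def bdd_above_def)
    have ac: "a \<le> c"
      unfolding c_def using aS bdd by (rule cSup_upper)
    have cb: "c \<le> b"
      unfolding c_def using aS by (intro cSup_least) (auto simp: S_def)
    have below: "\<bar>f s - f a\<bar> \<le> \<epsilon> * (s - a)" if s: "a \<le> s" "s < c" for s
    proof -
      obtain t where "t \<in> S" "s < t"
        using less_cSupD[of S s] s aS unfolding c_def by auto
      then show ?thesis
        using s by (auto simp: S_def)
    qed
    have atc: "\<bar>f c - f a\<bar> \<le> \<epsilon> * (c - a)"
    proof (cases "a < c")
      case True
      have "continuous_on {a..c} f"
        using cont cb by (auto intro: continuous_on_subset)
      then have "(f \<longlongrightarrow> f c) (at_left c)"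
        using True continuous_on_Icc_at_leftD by blast
      then have "((\<lambda>s. \<epsilon> * (s - a) - \<bar>f s - f a\<bar>) \<longlongrightarrow> \<epsilon> * (c - a) - \<bar>f c - f a\<bar>) (at_left c)"
        by (intro tendsto_intros)
      moreover have "\<forall>\<^sub>F s in at_left c. 0 \<le> \<epsilon> * (s - a) - \<bar>f s - f a\<bar>"
        using eventually_at_left_real[OF True] by eventually_elim (use below in auto)
      ultimately have "0 \<le> \<epsilon> * (c - a) - \<bar>f c - f a\<bar>"
        by (intro tendsto_lowerbound[of _ _ "at_left c"]) auto
      then show ?thesis by simp
    next
      case False
      then show ?thesis using ac by simp
    qed
    have cS: "\<bar>f s - f a\<bar> \<le> \<epsilon> * (s - a)" if "a \<le> s" "s \<le> c" for s
      using below atc that by (cases "s = c") auto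
    have "c = b"
    proof (rule ccontr)
      assume "c \<noteq> b"
      then have "c < b" using cb by simp
      from der[OF ac this] have "\<forall>\<^sub>F h in at_right 0. \<bar>(f (c + h) - f c) / h\<bar> < \<epsilon>"
        using \<open>\<epsilon> > 0\<close> by (auto simp: tendsto_iff dist_norm)
      then obtain d where d: "d > 0" "\<And>h. 0 < h \<Longrightarrow> h < d \<Longrightarrow> \<bar>(f (c + h) - f c) / h\<bar> < \<epsilon>"
        by (auto simp: eventually_at_right_field)
      define t where "t = min b (c + d / 2)"
      have "c < t" using \<open>c < b\<close> d(1) by (auto simp: t_def)
      have "\<bar>f s - f a\<bar> \<le> \<epsilon> * (s - a)" if "a \<le> s" "s \<le> t" for s
      proof (cases "s \<le> c")
        case True
        then show ?thesis using cS that by blast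
      next
        case False
        then have "\<bar>(f (c + (s - c)) - f c) / (s - c)\<bar> < \<epsilon>"
          using that d(1) by (intro d(2)) (auto simp: t_def)
        then have "\<bar>f s - f c\<bar> \<le> \<epsilon> * (s - c)"
          using False by (simp add: abs_divide field_simps)
        with atc show ?thesis
          by (simp add: algebra_simps)
      qed
      then have "t \<in> S"
        using \<open>c < t\<close> ac by (auto simp: S_def t_def)
      then have "t \<le> c"
        unfolding c_def using bdd by (rule cSup_upper)
      with \<open>c < t\<close> show False by simp
    qed
    then show ?thesis using atc by simp
  qed
  have "((\<lambda>\<epsilon>. \<epsilon> * (b - a)) \<longlongrightarrow> 0 * (b - a)) (at_right 0)"
    by (intro tendsto_intros)
  then have "\<bar>f b - f a\<bar> \<le> 0 * (b - a)"
    by (rule tendsto_lowerbound) (auto simp: eventually_at_right_field intro!: exI[of _ 1] bound)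
  then show ?thesis by simp
qed

text \<open>Right-continuity makes g the right derivative of its own integral at every point, not
  just almost everywhere, so f minus that integral falls under
  \<open>right_derivative_zero_constant\<close>.\<close>

lemma ftc_right_derivative:
  fixes f g :: "real \<Rightarrow> real"
  assumes ab: "a \<le> b" and cont: "continuous_on {a..b} f"
    and der: "\<And>t. a \<le> t \<Longrightarrow> t < b \<Longrightarrow> ((\<lambda>h. (f (t + h) - f t) / h) \<longlongrightarrow> g t) (at_right 0)"
    and right: "\<And>t. a \<le> t \<Longrightarrow> t < b \<Longrightarrow> (g \<longlongrightarrow> g t) (at_right t)"
    and int: "set_integrable lborel {a..b} g"
  shows "f b - f a = (LINT t:{a..b}|lborel. g t)"
proof -
  have gi: "g integrable_on {a..b}"
    using int set_borel_integral_eq_integral(1) by blast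
  define G where "G t = integral {a..t} g" for t
  have "f b - G b = f a - G a"
  proof (rule right_derivative_zero_constant[OF ab])
    show "continuous_on {a..b} (\<lambda>t. f t - G t)"
      unfolding G_def by (intro continuous_intros cont indefinite_integral_continuous_1 gi)
    fix t assume t: "a \<le> t" "t < b"
    have "((\<lambda>u. integral {t..u} g) has_vector_derivative g t) (at t within {t..b} - {})"
    proof (rule integral_has_vector_derivative_continuous_at)
      show "g integrable_on {t..b}"
        using gi t by (rule_tac integrable_on_subinterval) auto
      show "continuous (at t within {t..b} - {}) g"
        using right[OF t] t at_within_Icc_at_right[of t b] by (simp add: continuous_within)
    qed (use t in auto)
    then have "((\<lambda>y. integral {t..y} g / (y - t)) \<longlongrightarrow> g t) (at_right t)"
      using t at_within_Icc_at_right[of t b]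
      by (simp add: has_real_derivative_iff_has_vector_derivative[symmetric] has_field_derivative_iff)
    then have "((\<lambda>h. integral {t..t + h} g / h) \<longlongrightarrow> g t) (at_right 0)"
      unfolding at_right_to_0[of t] filterlim_filtermap by (simp add: add.commute)
    then have "((\<lambda>h. (f (t + h) - f t) / h - integral {t..t + h} g / h) \<longlongrightarrow> g t - g t) (at_right 0)"
      by (intro tendsto_intros der t)
    then have lim: "((\<lambda>h. (f (t + h) - f t) / h - integral {t..t + h} g / h) \<longlongrightarrow> 0) (at_right 0)"
      by simp
    show "((\<lambda>h. (f (t + h) - G (t + h) - (f t - G t)) / h) \<longlongrightarrow> 0) (at_right 0)"
    proof (rule Lim_transform_eventually[OF lim])
      have "\<forall>\<^sub>F h in at_right 0. h \<in> {0<..<b - t}"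
        using t by (intro eventually_at_right_real) auto
      then show "\<forall>\<^sub>F h in at_right 0. (f (t + h) - f t) / h - integral {t..t + h} g / h
          = (f (t + h) - G (t + h) - (f t - G t)) / h"
      proof eventually_elim
        case (elim h)
        have "G t + integral {t..t + h} g = G (t + h)"
          unfolding G_def using elim t
          by (intro Henstock_Kurzweil_Integration.integral_combine integrable_on_subinterval[OF gi]) auto
        then show ?case by (simp add: diff_divide_distrib[symmetric] algebra_simps)
      qed
    qed
  qed
  then show ?thesis
    using set_borel_integral_eq_integral(2)[OF int] by (simp add: G_def)
qed

text \<open>Here l is the function of left limits of f. The intended f is the functional along a
  piecewise constant path, with P the partition points.\<close>

lemma ftc_right_derivative_jumps:
  fixes f l g :: "real \<Rightarrow> real"
  assumes T: "0 \<le> T" and P: "finite P"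
    and right: "\<And>t. 0 \<le> t \<Longrightarrow> t < T \<Longrightarrow> (f \<longlongrightarrow> f t) (at_right t)"
    and left: "\<And>t. 0 < t \<Longrightarrow> t \<le> T \<Longrightarrow> (f \<longlongrightarrow> l t) (at_left t)"
    and nojump: "\<And>t. 0 < t \<Longrightarrow> t \<le> T \<Longrightarrow> t \<notin> P \<Longrightarrow> l t = f t"
    and der: "\<And>t. 0 \<le> t \<Longrightarrow> t < T \<Longrightarrow> ((\<lambda>h. (f (t + h) - f t) / h) \<longlongrightarrow> g t) (at_right 0)"
    and rightg: "\<And>t. 0 \<le> t \<Longrightarrow> t < T \<Longrightarrow> (g \<longlongrightarrow> g t) (at_right t)"
    and int: "set_integrable lborel {0..T} g"
  shows "f T - f 0 = (LINT t:{0..T}|lborel. g t) + (\<Sum>p\<in>P \<inter> {0<..T}. f p - l p)"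
proof -
  \<comment> \<open>A right-continuous step function with the jumps of f. Subtracting it makes f
    continuous and leaves right derivatives alone, since J is constant immediately to the right of
    every point.\<close>
  define J where "J t = (\<Sum>p\<in>P \<inter> {0<..t}. f p - l p)" for t
  have gap: "\<exists>d>0. P \<inter> {t - d<..<t + d} \<subseteq> {t}" for t
  proof -
    obtain d where "d > 0" "\<And>p. p \<in> P \<Longrightarrow> p \<noteq> t \<Longrightarrow> d \<le> dist t p"
      using finite_set_avoid[OF P] by metis
    then show ?thesis
      by (intro exI[of _ d]) (force simp: dist_real_def)
  qed
  have J_right: "\<forall>\<^sub>F s in at_right t. J s = J t" for t
  proof -
    obtain d where d: "d > 0" "P \<inter> {t - d<..<t + d} \<subseteq> {t}"
      using gap by blast
    have "\<forall>\<^sub>F s in at_right t. s \<in> {t<..<t + d}"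
      using d(1) by (intro eventually_at_right_real) auto
    then show ?thesis
    proof eventually_elim
      case (elim s)
      have "P \<inter> {0<..s} = P \<inter> {0<..t}"
        using elim d(2) by (force simp: subset_iff)
      then show ?case by (simp add: J_def)
    qed
  qed
  have J_left: "\<forall>\<^sub>F s in at_left t. J s = J t - (f t - l t)" if "0 < t" "t \<le> T" for t
  proof -
    obtain d where d: "d > 0" "P \<inter> {t - d<..<t + d} \<subseteq> {t}"
      using gap by blast
    have eq: "J t = (\<Sum>p\<in>P \<inter> {0<..<t}. f p - l p) + (f t - l t)"
    proof (cases "t \<in> P")
      case True
      then have "P \<inter> {0<..t} = insert t (P \<inter> {0<..<t})"
        using that by auto
      then show ?thesis using P by (simp add: J_def)
    next
      case False
      then have "P \<inter> {0<..t} = P \<inter> {0<..<t}"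
        by (auto simp: less_le)
      then show ?thesis using nojump[OF that False] by (simp add: J_def)
    qed
    have "\<forall>\<^sub>F s in at_left t. s \<in> {t - d<..<t}"
      using d(1) by (intro eventually_at_left_real) auto
    then show ?thesis
    proof eventually_elim
      case (elim s)
      have "P \<inter> {0<..s} = P \<inter> {0<..<t}"
        using elim d(2) by (force simp: subset_iff)
      then show ?case using eq by (simp add: J_def)
    qed
  qed
  have J0: "J 0 = 0"
    by (simp add: J_def)
  have "(f T - J T) - (f 0 - J 0) = (LINT t:{0..T}|lborel. g t)"
  proof (rule ftc_right_derivative[OF T _ _ rightg int])
    have "continuous (at t within {0..T}) (\<lambda>t. f t - J t)" if t: "t \<in> {0..T}" for t
    proof -
      have r: "((\<lambda>t. f t - J t) \<longlongrightarrow> f t - J t) (at_right t)" if "t < T"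
      proof -
        have "((\<lambda>s. f s - J t) \<longlongrightarrow> f t - J t) (at_right t)"
          using t that by (intro tendsto_intros right) auto
        then show ?thesis
          by (rule Lim_transform_eventually) (use J_right[of t] in eventually_elim, simp)
      qed
      have l: "((\<lambda>t. f t - J t) \<longlongrightarrow> f t - J t) (at_left t)" if "0 < t"
      proof -
        have "((\<lambda>s. f s - (J t - (f t - l t))) \<longlongrightarrow> l t - (J t - (f t - l t))) (at_left t)"
          using t that by (intro tendsto_intros left) auto
        then have "((\<lambda>s. f s - (J t - (f t - l t))) \<longlongrightarrow> f t - J t) (at_left t)"
          by simp
        then show ?thesis
          by (rule Lim_transform_eventually)
            (use J_left[of t] that t in \<open>auto elim: eventually_mono\<close>)
      qed
      consider "t = 0" "T = 0" | "t = 0" "0 < T" | "t = T" "0 < T" | "0 < t" "t < T"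
        using t by fastforce
      then show ?thesis
      proof cases
        case 1
        then have "at t within {0..T} = bot"
          by (simp add: at_within_eq_bot_iff)
        then show ?thesis by (simp add: continuous_within)
      next
        case 2
        then show ?thesis using r at_within_Icc_at_right[of 0 T] by (simp add: continuous_within)
      next
        case 3
        then show ?thesis using l at_within_Icc_at_left[of 0 T] by (simp add: continuous_within)
      next
        case 4
        then show ?thesis
          using l r by (simp add: at_within_Icc_at continuous_within filterlim_split_at)
      qed
    qed
    then show "continuous_on {0..T} (\<lambda>t. f t - J t)"
      by (simp add: continuous_on_eq_continuous_within)
    fix t assume t: "0 \<le> t" "t < T"
    have "\<forall>\<^sub>F h in at_right 0. J (t + h) = J t"
      using J_right[of t] unfolding at_right_to_0[of t] eventually_filtermap by (simp add: add.commute)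
    then show "((\<lambda>h. (f (t + h) - J (t + h) - (f t - J t)) / h) \<longlongrightarrow> g t) (at_right 0)"
      by (intro Lim_transform_eventually[OF der[OF t]]) (auto elim!: eventually_mono)
  qed
  then show ?thesis
    using J0 by (simp add: J_def)
qed

section \<open>Cadlag paths\<close>

lemma cadlag_left_lim:
  assumes "x \<in> cadlag_paths"
  shows "(x \<longlongrightarrow> left_lim x t) (at_left t)"
proof -
  have "\<exists>l. (x \<longlongrightarrow> l) (at_left t)"
  proof (cases "t \<ge> 0")
    case True
    then show ?thesis using assms by (simp add: cadlag_paths_def)
  next
    case False
    have "\<forall>\<^sub>F s in at_left t. x s = x 0"
      using assms False by (auto simp: cadlag_paths_def eventually_at_left_field intro!: exI[of _ "t - 1"])
    then show ?thesis using tendsto_eventually by blast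
  qed
  then show ?thesis
    unfolding left_lim_def by (metis tendsto_Lim trivial_limit_at_left_real)
qed

lemma left_lim_eqI: "(x \<longlongrightarrow> l) (at_left t) \<Longrightarrow> left_lim x t = l"
  unfolding left_lim_def by (simp add: tendsto_Lim)

lemma left_lim_cong:
  assumes "\<And>s. s < t \<Longrightarrow> x s = y s"
  shows "left_lim x t = left_lim y t"
proof -
  have "\<forall>\<^sub>F s in at_left t. x s = y s"
    using assms by (auto simp: eventually_at_left_field intro!: exI[of _ "t - 1"])
  then have "(\<lambda>l. (x \<longlongrightarrow> l) (at_left t)) = (\<lambda>l. (y \<longlongrightarrow> l) (at_left t))"
    by (intro ext tendsto_cong)
  then show ?thesis
    by (simp only: left_lim_def Topological_Spaces.Lim_def)
qed

lemma cadlag_right: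
  assumes "x \<in> cadlag_paths"
  shows "(x \<longlongrightarrow> x t) (at_right t)"
proof (cases "t \<ge> 0")
  case True
  then show ?thesis using assms by (simp add: cadlag_paths_def continuous_within)
next
  case False
  have "\<forall>\<^sub>F s in at_right t. x s = x t"
    using assms False by (auto simp: cadlag_paths_def eventually_at_right_field intro!: exI[of _ 0])
  then show ?thesis using tendsto_eventually by blast
qed

lemma left_lim_nonpos:
  assumes "x \<in> cadlag_paths" "t \<le> 0"
  shows "left_lim x t = x t"
proof -
  have eq: "x s = x t" if "s < t" for s
    using assms that by (cases "t = 0") (auto simp: cadlag_paths_def)
  have "left_lim x t = left_lim (\<lambda>_. x t) t"
    using eq by (intro left_lim_cong)
  then show ?thesis by (simp add: left_lim_eqI)
qed

lemma jump_nonpos: "x \<in> cadlag_paths \<Longrightarrow> t \<le> 0 \<Longrightarrow> jump x t = 0"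
  by (simp add: jump_def left_lim_nonpos)

lemma cadlag_bounded_linear:
  assumes h: "bounded_linear h" and x: "x \<in> cadlag_paths"
  shows "(\<lambda>t. h (x t)) \<in> cadlag_paths"
    and "left_lim (\<lambda>t. h (x t)) t = h (left_lim x t)"
    and "jump (\<lambda>t. h (x t)) t = h (jump x t)"
proof -
  note lim = bounded_linear.tendsto[OF h]
  show *: "left_lim (\<lambda>t. h (x t)) t = h (left_lim x t)"
    by (intro left_lim_eqI lim cadlag_left_lim x)
  show "(\<lambda>t. h (x t)) \<in> cadlag_paths"
    using x lim[OF cadlag_left_lim[OF x]] lim[OF cadlag_right[OF x]]
    by (auto simp: cadlag_paths_def continuous_within)
  show "jump (\<lambda>t. h (x t)) t = h (jump x t)"
    using h by (simp add: jump_def * linear_diff bounded_linear.linear)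
qed

text \<open>The two one-sided limits bound x near each point, and the bisection principle
  \<open>Bolzano\<close> glues the local bounds together. To the left of 0 the path is
  constant.\<close>

lemma cadlag_bounded:
  assumes x: "x \<in> cadlag_paths"
  shows "\<exists>B. \<forall>s\<le>T. norm (x s) \<le> B"
proof (cases "T \<ge> 0")
  case True
  have "\<exists>B. \<forall>s\<in>{0..T}. norm (x s) \<le> B"
    using True
  proof (rule Bolzano[where P = "\<lambda>a b. \<exists>B. \<forall>s\<in>{a..b}. norm (x s) \<le> B"])
    fix a b c
    assume "\<exists>B. \<forall>s\<in>{a..b}. norm (x s) \<le> B" "\<exists>B. \<forall>s\<in>{b..c}. norm (x s) \<le> B"
    then obtain B C where "\<forall>s\<in>{a..b}. norm (x s) \<le> B" "\<forall>s\<in>{b..c}. norm (x s) \<le> C"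
      by blast
    then show "\<exists>B. \<forall>s\<in>{a..c}. norm (x s) \<le> B"
      by (intro exI[of _ "max B C"]) (metis atLeastAtMost_iff le_max_iff_disj linear)
  next
    fix t
    have "\<forall>\<^sub>F s in at_left t. dist (x s) (left_lim x t) < 1"
      using cadlag_left_lim[OF x, of t] by (simp add: tendsto_iff)
    then obtain a where a: "a < t" "\<And>s. a < s \<Longrightarrow> s < t \<Longrightarrow> dist (x s) (left_lim x t) < 1"
      unfolding eventually_at_left_field by blast
    have "\<forall>\<^sub>F s in at_right t. dist (x s) (x t) < 1"
      using cadlag_right[OF x, of t] by (simp add: tendsto_iff)
    then obtain b where b: "t < b" "\<And>s. t < s \<Longrightarrow> s < b \<Longrightarrow> dist (x s) (x t) < 1"
      unfolding eventually_at_right_field by blast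
    define B where "B = norm (left_lim x t) + norm (x t) + 1"
    have *: "norm (x s) \<le> B" if s: "a < s" "s < b" for s
    proof -
      consider "s < t" | "s = t" | "t < s" by linarith
      then show ?thesis
      proof cases
        case 1
        then show ?thesis
          using a(2)[of s] s norm_triangle_ineq2[of "x s" "left_lim x t"] norm_ge_zero[of "x t"]
          unfolding B_def dist_norm by linarith
      next
        case 3
        then show ?thesis
          using b(2)[of s] s norm_triangle_ineq2[of "x s" "x t"] norm_ge_zero[of "left_lim x t"]
          unfolding B_def dist_norm by linarith
      qed (simp add: B_def)
    qed
    have "\<forall>c d. c \<le> t \<and> t \<le> d \<and> d - c < min (t - a) (b - t) \<longrightarrow>
        (\<forall>s\<in>{c..d}. norm (x s) \<le> B)"
      by (auto intro!: *)
    then show "\<exists>d>0. \<forall>c d'. c \<le> t \<and> t \<le> d' \<and> d' - c < d \<longrightarrow> (\<exists>B. \<forall>s\<in>{c..d'}. norm (x s) \<le> B)"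
      using a(1) b(1) by (intro exI[of _ "min (t - a) (b - t)"]) auto
  qed
  then obtain B where "\<forall>s\<in>{0..T}. norm (x s) \<le> B" by blast
  moreover have "x s = x 0" if "s < 0" for s
    using x that by (simp add: cadlag_paths_def)
  ultimately show ?thesis
    using True by (intro exI[of _ B]) (metis atLeastAtMost_iff not_le order_refl)
next
  case False
  then have "\<forall>s\<le>T. norm (x s) \<le> norm (x 0)"
    using x by (simp add: cadlag_paths_def)
  then show ?thesis by blast
qed

text \<open>Just to the left of t all values lie within \<epsilon>/2 of the left limit, so no jump
  there exceeds \<epsilon>. The times of jumps above a fixed size are therefore isolated from the
  left.\<close>

lemma countable_jumps:
  assumes x: "x \<in> cadlag_paths"
  shows "countable {t. jump x t \<noteq> 0}"
proof -
  have "countable {t. norm (jump x t) > 1 / real (Suc k)}" for k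
  proof (rule countable_left_isolated)
    fix t
    define \<epsilon> where "\<epsilon> = 1 / real (Suc k)"
    have "\<epsilon> > 0" by (simp add: \<epsilon>_def)
    then have "\<forall>\<^sub>F s in at_left t. dist (x s) (left_lim x t) < \<epsilon> / 2"
      using cadlag_left_lim[OF x, of t] half_gt_zero unfolding tendsto_iff by blast
    then obtain a where a: "a < t" "\<And>s. a < s \<Longrightarrow> s < t \<Longrightarrow> dist (x s) (left_lim x t) < \<epsilon> / 2"
      unfolding eventually_at_left_field by blast
    have "norm (jump x s) \<le> \<epsilon>" if s: "a < s" "s < t" for s
    proof -
      have "\<forall>\<^sub>F r in at_left s. r \<in> {a<..<s}"
        using s(1) by (rule eventually_at_left_real)
      then have "\<forall>\<^sub>F r in at_left s. norm (x s - x r) \<le> \<epsilon>"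
      proof eventually_elim
        case (elim r)
        then have "dist (x r) (left_lim x t) < \<epsilon> / 2" "dist (x s) (left_lim x t) < \<epsilon> / 2"
          using a(2) s by auto
        then have "dist (x s) (x r) < \<epsilon>"
          using dist_triangle_half_r[of "left_lim x t" "x s" \<epsilon> "x r"] by (simp add: dist_commute)
        then show ?case by (simp add: dist_norm)
      qed
      moreover have "((\<lambda>r. norm (x s - x r)) \<longlongrightarrow> norm (jump x s)) (at_left s)"
        unfolding jump_def by (intro tendsto_intros cadlag_left_lim x)
      ultimately show ?thesis
        by (intro tendsto_upperbound[of _ _ "at_left s"]) auto
    qed
    then show "\<exists>\<eta>>0. {t - \<eta><..<t} \<inter> {t. norm (jump x t) > 1 / real (Suc k)} = {}"
      using a(1) by (intro exI[of _ "t - a"]) (force simp: \<epsilon>_def simp del: of_nat_Suc dest: leD)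
  qed
  then have "countable (\<Union>k. {t. norm (jump x t) > 1 / real (Suc k)})"
    by blast
  moreover have "{t. jump x t \<noteq> 0} \<subseteq> (\<Union>k. {t. norm (jump x t) > 1 / real (Suc k)})"
    using reals_Archimedean[of "norm (jump x t)" for t]
    by (auto simp: inverse_eq_divide simp del: of_nat_Suc)
  ultimately show ?thesis
    by (rule countable_subset[rotated])
qed

section \<open>Algebra of stopped and bumped paths\<close>

lemma stop_left_stop: "s \<le> t \<Longrightarrow> stop_left (stop y t) s = stop_left y s"
proof -
  assume "s \<le> t"
  then have "left_lim (stop y t) s = left_lim y s"
    by (intro left_lim_cong) (auto simp: stop_def)
  then show ?thesis using \<open>s \<le> t\<close> by (auto simp: stop_left_def stop_def)
qed

lemma stop_stop: "s \<le> t \<Longrightarrow> stop (stop y t) s = stop y s"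
  by (auto simp: stop_def min_def)

lemma stop_left_stop_left [simp]: "stop_left (stop_left y t) t = stop_left y t"
proof -
  have "left_lim (stop_left y t) t = left_lim y t"
    by (intro left_lim_cong) (auto simp: stop_left_def)
  then show ?thesis by (auto simp: stop_left_def)
qed

text \<open>Bumped paths are again stopped at t, so the derivatives of a functional exist along a
  whole segment of bumps as soon as that segment stays in the generic set.\<close>

lemma stop_bump_stop_left:
  "0 \<le> t \<Longrightarrow> stop (bump (stop_left x t) t e) t = bump (stop_left x t) t e"
  by (auto simp: bump_def stop_left_def stop_def min_def fun_eq_iff max_def)

lemma bump_bump: "bump (bump y t a) t b = bump y t (a + b)"
  by (auto simp: bump_def)

lemma bump_0 [simp]: "bump y t 0 = y"
  by (auto simp: bump_def)

lemma stop_left_eq_stop: "jump x t = 0 \<Longrightarrow> stop_left x t = stop x t"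
  by (auto simp: stop_left_def stop_def jump_def min_def fun_eq_iff)

section \<open>Partitions\<close>

text \<open>The cell is open on the left: its left endpoint is then the time t'_n
  (\<open>bracket_prev\<close>), it approaches t strictly from the left, and the increment over the
  cell captures the jump at t.\<close>

definition bracket :: "(nat \<Rightarrow> real list) \<Rightarrow> real \<Rightarrow> nat \<Rightarrow> nat \<Rightarrow> bool" where
  "bracket \<pi> t n k \<longleftrightarrow> k < length (\<pi> n) - 1 \<and> \<pi> n ! k < t \<and> t \<le> \<pi> n ! Suc k"

lemma cadlag_seq_right:
  assumes x: "x \<in> cadlag_paths" and s: "s \<longlonglongrightarrow> t" "\<forall>\<^sub>F n in sequentially. t \<le> s n"
  shows "(\<lambda>n. x (s n)) \<longlonglongrightarrow> x t"
proof (rule tendstoI)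
  fix \<epsilon> :: real assume "\<epsilon> > 0"
  then have "\<forall>\<^sub>F s in at_right t. dist (x s) (x t) < \<epsilon>"
    using cadlag_right[OF x, of t] unfolding tendsto_iff by blast
  then obtain b where b: "t < b" "\<And>s. t < s \<Longrightarrow> s < b \<Longrightarrow> dist (x s) (x t) < \<epsilon>"
    unfolding eventually_at_right_field by blast
  from order_tendstoD(2)[OF s(1) b(1)] s(2)
  show "\<forall>\<^sub>F n in sequentially. dist (x (s n)) (x t) < \<epsilon>"
  proof eventually_elim
    case (elim n)
    then show ?case using b(2)[of "s n"] \<open>\<epsilon> > 0\<close> by (cases "s n = t") auto
  qed
qed

lemma cadlag_seq_left:
  assumes x: "x \<in> cadlag_paths" and s: "s \<longlonglongrightarrow> t" "\<forall>\<^sub>F n in sequentially. s n < t"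
  shows "(\<lambda>n. x (s n)) \<longlonglongrightarrow> left_lim x t"
proof (rule filterlim_compose[OF cadlag_left_lim[OF x]])
  show "filterlim s (at_left t) sequentially"
    using s by (auto simp: filterlim_at elim: eventually_mono)
qed

lemma cadlag_seq_cont:
  assumes x: "x \<in> cadlag_paths" and s: "s \<longlonglongrightarrow> t" and j: "jump x t = 0"
  shows "(\<lambda>n. x (s n)) \<longlonglongrightarrow> x t"
proof -
  have "isCont x t"
    using cadlag_right[OF x, of t] cadlag_left_lim[OF x, of t] j
    by (simp add: jump_def isCont_def filterlim_split_at)
  then show ?thesis using s by (rule isCont_tendsto_compose)
qed

locale partitions =
  fixes \<pi> :: "nat \<Rightarrow> real list"
  assumes part: "partition_seq \<pi>"
begin

abbreviation cells :: "nat \<Rightarrow> real \<Rightarrow> nat set" where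
  "cells n t \<equiv> {k. k < length (\<pi> n) - 1 \<and> \<pi> n ! k \<le> t}"

lemma point_less: "i < j \<Longrightarrow> j < length (\<pi> n) \<Longrightarrow> \<pi> n ! i < \<pi> n ! j"
  using part by (simp add: partition_seq_def sorted_wrt_nth_less)

lemma point_le: "i \<le> j \<Longrightarrow> j < length (\<pi> n) \<Longrightarrow> \<pi> n ! i \<le> \<pi> n ! j"
  using point_less[of i j n] by (cases "i = j") auto

lemma point_0: "\<pi> n ! 0 = 0"
  using part by (metis hd_conv_nth partition_seq_def)

lemma point_nonneg: "i < length (\<pi> n) \<Longrightarrow> 0 \<le> \<pi> n ! i"
  using point_le[of 0 i n] by (simp add: point_0)

lemma last_point: "\<forall>\<^sub>F n in sequentially. 1 < length (\<pi> n) \<and> T < \<pi> n ! (length (\<pi> n) - 1)"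
proof -
  have "filterlim (\<lambda>n. last (\<pi> n)) at_top sequentially"
    using part by (simp add: partition_seq_def)
  then have "\<forall>\<^sub>F n in sequentially. max T 0 < last (\<pi> n)"
    unfolding filterlim_at_top_dense by blast
  then show ?thesis
  proof eventually_elim
    case (elim n)
    have ne: "\<pi> n \<noteq> []"
      using part by (simp add: partition_seq_def)
    then have l: "max T 0 < \<pi> n ! (length (\<pi> n) - 1)"
      using elim by (simp add: last_conv_nth)
    then have "length (\<pi> n) \<noteq> 1"
      by (auto simp: point_0)
    then show ?case
      using l ne by (cases "length (\<pi> n)") auto
  qed
qed

lemma mesh:
  assumes "\<epsilon> > 0"
  shows "\<forall>\<^sub>F n in sequentially. \<forall>k<length (\<pi> n) - 1. \<pi> n ! k \<le> T \<longrightarrow> \<pi> n ! Suc k < \<pi> n ! k + \<epsilon>"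
proof -
  \<comment> \<open>The margin 1, together with \<open>min \<epsilon> 1\<close>, ensures that the
    right endpoint of a cell starting by time T is not cut off by the truncation at
    \<open>T'\<close>.\<close>
  define T' where "T' = max T 0 + 1"
  have "T' \<ge> 0" by (simp add: T'_def)
  moreover have "min \<epsilon> 1 > 0" using assms by simp
  ultimately have "\<forall>\<^sub>F n in sequentially. \<forall>k<length (\<pi> n) - 1.
      min (\<pi> n ! Suc k) T' - min (\<pi> n ! k) T' < min \<epsilon> 1"
    using part unfolding partition_seq_def by blast
  then show ?thesis
  proof eventually_elim
    case (elim n)
    show ?case
    proof (intro allI impI)
      fix k assume k: "k < length (\<pi> n) - 1" "\<pi> n ! k \<le> T"
      then have "min (\<pi> n ! Suc k) T' - min (\<pi> n ! k) T' < min \<epsilon> 1"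
        using elim by blast
      with k(2) show "\<pi> n ! Suc k < \<pi> n ! k + \<epsilon>"
        by (auto simp: T'_def min_def max_def split: if_splits)
    qed
  qed
qed

lemma next_point_tendsto:
  assumes k: "\<forall>\<^sub>F n in sequentially. k n < length (\<pi> n) - 1" and lim: "(\<lambda>n. \<pi> n ! k n) \<longlonglongrightarrow> t"
  shows "(\<lambda>n. \<pi> n ! Suc (k n)) \<longlonglongrightarrow> t"
proof -
  have "(\<lambda>n. \<pi> n ! Suc (k n) - \<pi> n ! k n) \<longlonglongrightarrow> 0"
  proof (rule tendstoI)
    fix \<epsilon> :: real assume "\<epsilon> > 0"
    have "\<forall>\<^sub>F n in sequentially. \<pi> n ! k n < t + 1"
      by (rule order_tendstoD(2)[OF lim]) simp
    with mesh[OF \<open>\<epsilon> > 0\<close>, of "t + 1"] k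
    show "\<forall>\<^sub>F n in sequentially. dist (\<pi> n ! Suc (k n) - \<pi> n ! k n) 0 < \<epsilon>"
    proof eventually_elim
      case (elim n)
      moreover have "\<pi> n ! k n < \<pi> n ! Suc (k n)"
        using elim by (intro point_less) auto
      ultimately show ?case by (auto simp: dist_real_def)
    qed
  qed
  from tendsto_add[OF this lim] show ?thesis by simp
qed

lemma bracket_ex:
  assumes "t > 0"
  shows "\<exists>k. \<forall>\<^sub>F n in sequentially. bracket \<pi> t n (k n)"
proof -
  have "\<forall>\<^sub>F n in sequentially. \<exists>k. bracket \<pi> t n k"
    using last_point[of t]
  proof eventually_elim
    case (elim n)
    define k where "k = Max {i. i < length (\<pi> n) \<and> \<pi> n ! i < t}"
    have fin: "finite {i. i < length (\<pi> n) \<and> \<pi> n ! i < t}" by simp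
    have "0 < length (\<pi> n)" using elim by linarith
    then have "0 \<in> {i. i < length (\<pi> n) \<and> \<pi> n ! i < t}"
      using assms by (simp add: point_0)
    then have k: "k < length (\<pi> n)" "\<pi> n ! k < t"
      using Max_in[OF fin] unfolding k_def by blast+
    have "k \<noteq> length (\<pi> n) - 1" using k elim by auto
    then have k1: "Suc k < length (\<pi> n)" using k by simp
    have "\<not> \<pi> n ! Suc k < t"
    proof
      assume "\<pi> n ! Suc k < t"
      then have "Suc k \<le> k"
        unfolding k_def using k1 fin by (intro Max_ge) (auto simp: k_def)
      then show False by simp
    qed
    with k k1 show ?case unfolding bracket_def by (intro exI[of _ k]) linarith
  qed
  then obtain k where "\<forall>\<^sub>F n in sequentially. bracket \<pi> t n (k n)"
    unfolding eventually_ex by blast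
  then show ?thesis by blast
qed

lemma bracket_prev:
  assumes "bracket \<pi> t n k"
  shows "prev_point \<pi> t n = \<pi> n ! k"
proof -
  have k: "k < length (\<pi> n) - 1" "\<pi> n ! k < t" "t \<le> \<pi> n ! Suc k"
    using assms by (auto simp: bracket_def)
  have "Max {s \<in> set (\<pi> n). s < t} = \<pi> n ! k"
  proof (rule Max_eqI)
    fix s assume "s \<in> {s \<in> set (\<pi> n). s < t}"
    then obtain j where j: "j < length (\<pi> n)" "s = \<pi> n ! j" "s < t"
      by (auto simp: in_set_conv_nth)
    then have "\<not> Suc k \<le> j"
      using point_le[of "Suc k" j n] k by auto
    then show "s \<le> \<pi> n ! k"
      using j k point_le[of j k n] by auto
  qed (use k in auto)
  then show ?thesis
    using k unfolding prev_point_def by (auto intro: nth_mem)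
qed

lemma bracket_tendsto:
  assumes k: "\<forall>\<^sub>F n in sequentially. bracket \<pi> t n (k n)"
  shows "(\<lambda>n. \<pi> n ! k n) \<longlonglongrightarrow> t"
proof (rule tendstoI)
  fix \<epsilon> :: real assume "\<epsilon> > 0"
  from k mesh[OF this, of t] show "\<forall>\<^sub>F n in sequentially. dist (\<pi> n ! k n) t < \<epsilon>"
    by eventually_elim (force simp: bracket_def dist_real_def)
qed

lemma prev_point_0: "prev_point \<pi> 0 n = 0"
proof -
  have "0 \<le> s" if "s \<in> set (\<pi> n)" for s
    using that point_nonneg by (auto simp: in_set_conv_nth)
  then show ?thesis
    by (force simp: prev_point_def)
qed

lemma prev_point_nonneg: "0 \<le> prev_point \<pi> t n"
proof (cases "\<exists>s\<in>set (\<pi> n). s < t")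
  case True
  then have "Max {s \<in> set (\<pi> n). s < t} \<in> {s \<in> set (\<pi> n). s < t}"
    by (intro Max_in) auto
  then have "prev_point \<pi> t n \<in> set (\<pi> n)"
    using True by (simp add: prev_point_def)
  then show ?thesis
    using point_nonneg by (metis in_set_conv_nth)
next
  case False
  then show ?thesis by (simp add: prev_point_def)
qed

lemma prev_point_le: "0 \<le> t \<Longrightarrow> prev_point \<pi> t n \<le> t"
proof (cases "\<exists>s\<in>set (\<pi> n). s < t")
  case True
  then have "Max {s \<in> set (\<pi> n). s < t} \<in> {s \<in> set (\<pi> n). s < t}"
    by (intro Max_in) auto
  then show ?thesis
    using True by (auto simp: prev_point_def)
qed (simp add: prev_point_def)

lemma prev_point_tendsto:
  assumes "t \<ge> 0"
  shows "prev_point \<pi> t \<longlonglongrightarrow> t"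
proof (cases "t = 0")
  case True
  have "prev_point \<pi> 0 = (\<lambda>n. 0)"
    by (rule ext) (rule prev_point_0)
  then show ?thesis using True by simp
next
  case False
  then obtain k where k: "\<forall>\<^sub>F n in sequentially. bracket \<pi> t n (k n)"
    using bracket_ex assms by fastforce
  have "\<forall>\<^sub>F n in sequentially. \<pi> n ! k n = prev_point \<pi> t n"
    using k by eventually_elim (simp add: bracket_prev)
  then show ?thesis
    using bracket_tendsto[OF k] Lim_transform_eventually by fastforce
qed

lemma bracket_increment:
  assumes x: "x \<in> cadlag_paths" and k: "\<forall>\<^sub>F n in sequentially. bracket \<pi> t n (k n)"
  shows "(\<lambda>n. x (\<pi> n ! Suc (k n)) - x (\<pi> n ! k n)) \<longlonglongrightarrow> jump x t"
proof -
  have ev: "\<forall>\<^sub>F n in sequentially. k n < length (\<pi> n) - 1"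
    "\<forall>\<^sub>F n in sequentially. t \<le> \<pi> n ! Suc (k n)" "\<forall>\<^sub>F n in sequentially. \<pi> n ! k n < t"
    using k by (auto simp: bracket_def elim: eventually_mono)
  note lim = bracket_tendsto[OF k]
  show ?thesis
    unfolding jump_def
    using tendsto_diff[OF cadlag_seq_right[OF x next_point_tendsto[OF ev(1) lim] ev(2)]
        cadlag_seq_left[OF x lim ev(3)]] .
qed

lemma increment_tendsto_0:
  assumes x: "x \<in> cadlag_paths" and k: "\<forall>\<^sub>F n in sequentially. k n < length (\<pi> n) - 1"
    and lim: "(\<lambda>n. \<pi> n ! k n) \<longlonglongrightarrow> t" and j: "jump x t = 0"
  shows "(\<lambda>n. x (\<pi> n ! Suc (k n)) - x (\<pi> n ! k n)) \<longlonglongrightarrow> 0"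
  using tendsto_diff[OF cadlag_seq_cont[OF x next_point_tendsto[OF k lim] j] cadlag_seq_cont[OF x lim j]]
  by simp

text \<open>A cell near t that does not bracket t lies entirely on one side of it, where x is within
  \<epsilon>/2 of its one-sided limit. So near t only the bracketing cell can carry a large
  increment.\<close>

lemma nonbracket_increment:
  assumes x: "x \<in> cadlag_paths" and k: "\<forall>\<^sub>F n in sequentially. k n < length (\<pi> n) - 1"
    and lim: "(\<lambda>n. \<pi> n ! k n) \<longlonglongrightarrow> t" and \<epsilon>: "\<epsilon> > 0"
  shows "\<forall>\<^sub>F n in sequentially. bracket \<pi> t n (k n) \<or> dist (x (\<pi> n ! Suc (k n))) (x (\<pi> n ! k n)) < \<epsilon>"
proof -
  have "\<forall>\<^sub>F s in at_left t. dist (x s) (left_lim x t) < \<epsilon> / 2"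
    using cadlag_left_lim[OF x, of t] half_gt_zero[OF \<epsilon>] unfolding tendsto_iff by blast
  then obtain a where a: "a < t" "\<And>s. a < s \<Longrightarrow> s < t \<Longrightarrow> dist (x s) (left_lim x t) < \<epsilon> / 2"
    unfolding eventually_at_left_field by blast
  have "\<forall>\<^sub>F s in at_right t. dist (x s) (x t) < \<epsilon> / 2"
    using cadlag_right[OF x, of t] half_gt_zero[OF \<epsilon>] unfolding tendsto_iff by blast
  then obtain b where b: "t < b" "\<And>s. t < s \<Longrightarrow> s < b \<Longrightarrow> dist (x s) (x t) < \<epsilon> / 2"
    unfolding eventually_at_right_field by blast
  have b': "dist (x s) (x t) < \<epsilon> / 2" if "t \<le> s" "s < b" for s
    using b(2)[of s] that \<epsilon> by (cases "s = t") auto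
  have "\<forall>\<^sub>F n in sequentially. a < \<pi> n ! k n"
    using lim a(1) by (rule order_tendstoD)
  moreover have "\<forall>\<^sub>F n in sequentially. \<pi> n ! Suc (k n) < b"
    using next_point_tendsto[OF k lim] b(1) by (rule order_tendstoD)
  ultimately show ?thesis
    using k
  proof eventually_elim
    case (elim n)
    have less: "\<pi> n ! k n < \<pi> n ! Suc (k n)"
      using elim by (intro point_less) auto
    consider "bracket \<pi> t n (k n)" | "t \<le> \<pi> n ! k n" | "\<pi> n ! Suc (k n) < t"
      using elim unfolding bracket_def by linarith
    then show ?case
    proof cases
      case 2
      then have "dist (x (\<pi> n ! k n)) (x t) < \<epsilon> / 2" "dist (x (\<pi> n ! Suc (k n))) (x t) < \<epsilon> / 2"
        using elim less b'[of "\<pi> n ! k n"] b'[of "\<pi> n ! Suc (k n)"] by linarith+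
      then show ?thesis by (metis dist_triangle_half_l)
    next
      case 3
      then have "dist (x (\<pi> n ! k n)) (left_lim x t) < \<epsilon> / 2"
        "dist (x (\<pi> n ! Suc (k n))) (left_lim x t) < \<epsilon> / 2"
        using elim less a(2)[of "\<pi> n ! k n"] a(2)[of "\<pi> n ! Suc (k n)"] by linarith+
      then show ?thesis by (metis dist_triangle_half_l)
    qed simp
  qed
qed

end

section \<open>Quadratic variation of a real-valued path\<close>

locale scalar_qv = partitions \<pi> for \<pi> :: "nat \<Rightarrow> real list" +
  fixes z A :: "real \<Rightarrow> real"
  assumes z: "z \<in> cadlag_paths" and A: "A \<in> cadlag_paths"
    and J1: "tendsto_J1 (\<lambda>n t. \<Sum>k\<in>cells n (max t 0).
               (z (\<pi> n ! Suc k) - z (\<pi> n ! k))\<^sup>2) A"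
begin

definition w :: "nat \<Rightarrow> nat \<Rightarrow> real" where
  "w n k = (z (\<pi> n ! Suc k) - z (\<pi> n ! k))\<^sup>2"

definition A_approx :: "nat \<Rightarrow> real \<Rightarrow> real" where
  "A_approx n t = (\<Sum>k\<in>cells n (max t 0). w n k)"

text \<open>Positions in the variable u: cell k occupies \<open>{S n k<..S n (Suc k)}\<close>, an
  interval of length \<open>w n k\<close>.\<close>

definition S :: "nat \<Rightarrow> nat \<Rightarrow> real" where
  "S n k = (\<Sum>j<k. w n j)"

lemma w_nonneg [simp]: "0 \<le> w n k"
  by (simp add: w_def)

lemma S_mono: "j \<le> k \<Longrightarrow> S n j \<le> S n k"
  unfolding S_def by (intro sum_mono2) auto

lemma S_Suc: "S n (Suc k) = S n k + w n k"
  by (simp add: S_def)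

lemma A_approx_mono: "s \<le> t \<Longrightarrow> A_approx n s \<le> A_approx n t"
  unfolding A_approx_def by (intro sum_mono2) auto

text \<open>The increment over a cell is counted in \<open>A_approx\<close> from the left endpoint
  of the cell on. Hence the strict inequality here, and the index \<open>Suc k\<close> in the
  reverse comparison \<open>S_le_A_approx\<close>.\<close>

lemma A_approx_le_S:
  assumes "k < length (\<pi> n)" "0 \<le> r" "r < \<pi> n ! k"
  shows "A_approx n r \<le> S n k"
  unfolding A_approx_def S_def
proof (rule sum_mono2)
  show "{j. j < length (\<pi> n) - 1 \<and> \<pi> n ! j \<le> max r 0} \<subseteq> {..<k}"
  proof safe
    fix j assume j: "j < length (\<pi> n) - 1" "\<pi> n ! j \<le> max r 0"
    then have "j < length (\<pi> n)" by linarith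
    then show "j < k"
      using point_le[of k j n] assms j by (cases "k \<le> j") auto
  qed
qed auto

lemma S_le_A_approx:
  assumes "k < length (\<pi> n) - 1" "\<pi> n ! k \<le> r"
  shows "S n (Suc k) \<le> A_approx n r"
  unfolding A_approx_def S_def
proof (rule sum_mono2)
  show "{..<Suc k} \<subseteq> {j. j < length (\<pi> n) - 1 \<and> \<pi> n ! j \<le> max r 0}"
  proof safe
    fix j assume j: "j < Suc k"
    then show "j < length (\<pi> n) - 1" using assms by simp
    have "k < length (\<pi> n)" using assms by linarith
    then show "\<pi> n ! j \<le> max r 0"
      using point_le[of j k n] assms j by auto
  qed
qed auto

definition \<rho> :: "nat \<Rightarrow> real \<Rightarrow> real" where
  "\<rho> = (SOME \<rho>. (\<forall>n. strict_mono_on {0..} (\<rho> n) \<and> \<rho> n ` {0..} = {0..}) \<and>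
     uniform_limit {0..} \<rho> (\<lambda>s. s) sequentially \<and>
     (\<forall>T\<ge>0. uniform_limit {0..T} (\<lambda>n s. A_approx n (\<rho> n s)) A sequentially))"

lemma \<rho>:
  shows "strict_mono_on {0..} (\<rho> n)" "\<rho> n ` {0..} = {0..}"
    "0 \<le> t \<Longrightarrow> (\<lambda>n. \<rho> n t) \<longlonglongrightarrow> t"
    "0 \<le> t \<Longrightarrow> uniform_limit {0..t} (\<lambda>n s. A_approx n (\<rho> n s)) A sequentially"
    "0 \<le> t \<Longrightarrow> (\<lambda>n. A_approx n (\<rho> n t)) \<longlonglongrightarrow> A t"
proof -
  have \<rho>: "(\<forall>n. strict_mono_on {0..} (\<rho> n) \<and> \<rho> n ` {0..} = {0..}) \<and>
     uniform_limit {0..} \<rho> (\<lambda>s. s) sequentially \<and>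
     (\<forall>T\<ge>0. uniform_limit {0..T} (\<lambda>n s. A_approx n (\<rho> n s)) A sequentially)"
    using J1 unfolding tendsto_J1_def A_approx_def[symmetric] w_def[symmetric] \<rho>_def
    by (rule someI_ex)
  then show "strict_mono_on {0..} (\<rho> n)" "\<rho> n ` {0..} = {0..}"
    "0 \<le> t \<Longrightarrow> uniform_limit {0..t} (\<lambda>n s. A_approx n (\<rho> n s)) A sequentially"
    by blast+
  show "(\<lambda>n. \<rho> n t) \<longlonglongrightarrow> t" if "0 \<le> t"
    using tendsto_uniform_limitI[where S = "{0..}" and f = \<rho> and x = t and l = "\<lambda>s. s"] \<rho> that by simp
  show "(\<lambda>n. A_approx n (\<rho> n t)) \<longlonglongrightarrow> A t" if "0 \<le> t"
    using tendsto_uniform_limitI[where S = "{0..t}" and x = t and l = A and f = "\<lambda>n s. A_approx n (\<rho> n s)"] \<rho> that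
    by simp
qed

text \<open>\<open>A_approx n 0\<close> need not vanish, because the first cell is counted at time 0
  already; its mass tends to 0 as z is right-continuous at 0. The time changes fix 0.\<close>

lemma A_0: "A 0 = 0"
proof -
  have "\<rho> n 0 = 0" for n
  proof -
    have "0 \<in> \<rho> n ` {0..}" using \<rho>(2)[of n] by simp
    then obtain s where s: "0 \<le> s" "\<rho> n s = 0" by auto
    have "0 \<le> \<rho> n 0" using \<rho>(2)[of n] by auto
    then show ?thesis
      using strict_mono_onD[OF \<rho>(1), of 0 s n] s by (cases "s = 0") auto
  qed
  then have "(\<lambda>n. A_approx n 0) \<longlonglongrightarrow> A 0"
    using \<rho>(5)[of 0] by simp
  moreover have "(\<lambda>n. A_approx n 0) \<longlonglongrightarrow> 0"
  proof -
    have len: "\<forall>\<^sub>F n in sequentially. 0 < length (\<pi> n) - 1"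
      using last_point[of 0] by eventually_elim auto
    have "(\<lambda>n. z (\<pi> n ! Suc 0) - z (\<pi> n ! 0)) \<longlonglongrightarrow> 0"
      by (rule increment_tendsto_0[OF z len, of 0]) (simp_all add: point_0 jump_nonpos[OF z])
    then have "(\<lambda>n. w n 0) \<longlonglongrightarrow> 0"
      unfolding w_def using tendsto_power[of _ 0 _ 2] by fastforce
    moreover have "\<forall>\<^sub>F n in sequentially. w n 0 = A_approx n 0"
      using len
    proof eventually_elim
      case (elim n)
      have "{k. k < length (\<pi> n) - 1 \<and> \<pi> n ! k \<le> 0} = {0}"
        using elim point_less[of 0 _ n] by (force simp: point_0)
      then show ?case by (simp add: A_approx_def)
    qed
    ultimately show ?thesis
      by (rule Lim_transform_eventually)
  qed
  ultimately show ?thesis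
    by (rule LIMSEQ_unique)
qed

lemma A_nonpos: "t \<le> 0 \<Longrightarrow> A t = 0"
  using A A_0 by (cases "t = 0") (auto simp: cadlag_paths_def)

lemma A_mono: "s \<le> t \<Longrightarrow> A s \<le> A t"
proof -
  have *: "A s \<le> A t" if "0 \<le> s" "s \<le> t" for s t
  proof (rule LIMSEQ_le[OF \<rho>(5) \<rho>(5)])
    have "\<rho> n s \<le> \<rho> n t" for n
      using strict_mono_onD[OF \<rho>(1)[of n], of s t] that by (cases "s = t") auto
    then show "\<exists>N. \<forall>n\<ge>N. A_approx n (\<rho> n s) \<le> A_approx n (\<rho> n t)"
      using A_approx_mono by blast
  qed (use that in auto)
  assume "s \<le> t"
  then show ?thesis
    using *[of s t] *[of 0 t] A_nonpos[of s] A_nonpos[of t] A_0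
    by (cases "0 \<le> s"; cases "0 \<le> t") auto
qed

lemma A_left_lim_ge:
  assumes "r < s"
  shows "A r \<le> left_lim A s"
proof (rule tendsto_lowerbound[OF cadlag_left_lim[OF A]])
  show "\<forall>\<^sub>F t in at_left s. A r \<le> A t"
    using eventually_at_left_real[OF assms] by eventually_elim (auto intro: A_mono)
qed simp

lemma A_less_left_lim:
  assumes "0 < s" "u < left_lim A s"
  obtains r where "0 \<le> r" "r < s" "u < A r"
proof -
  have "\<forall>\<^sub>F r in at_left s. u < A r \<and> r \<in> {0<..<s}"
    using order_tendstoD(1)[OF cadlag_left_lim[OF A] assms(2)] eventually_at_left_real[OF assms(1)]
    by eventually_elim auto
  then obtain r where "u < A r \<and> r \<in> {0<..<s}"
    by (auto dest: eventually_happens'[OF trivial_limit_at_left_real])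
  then show ?thesis using that[of r] by auto
qed

lemma A_greater_right:
  assumes "A s < u"
  obtains r where "s < r" "A r < u"
proof -
  have "\<forall>\<^sub>F r in at_right s. A r < u \<and> r \<in> {s<..<s + 1}"
    using order_tendstoD(2)[OF cadlag_right[OF A] assms(1)] eventually_at_right_real[OF less_add_one[of s]]
    by eventually_elim auto
  then obtain r where "A r < u \<and> r \<in> {s<..<s + 1}"
    by (auto dest: eventually_happens'[OF trivial_limit_at_right_real])
  then show ?thesis using that[of r] by auto
qed

text \<open>At a jump of A the approximants may fail to converge along \<open>s n\<close>.
  Monotonicity still gives a bound: a slightly later r is moved so little by \<open>\<rho> n\<close>
  that \<open>s n\<close> stays before \<open>\<rho> n r\<close>, where convergence is
  known.\<close>

lemma A_approx_less:
  assumes "s \<longlonglongrightarrow> t" "0 \<le> t" "A t < u"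
  shows "\<forall>\<^sub>F n in sequentially. A_approx n (s n) < u"
proof -
  obtain r where r: "t < r" "A r < u"
    using A_greater_right[OF assms(3)] .
  have "0 \<le> r" using r assms by simp
  obtain c where c: "t < c" "c < r"
    using r(1) dense by blast
  from order_tendstoD(2)[OF assms(1) c(1)] order_tendstoD(1)[OF \<rho>(3)[OF \<open>0 \<le> r\<close>] c(2)]
    order_tendstoD(2)[OF \<rho>(5)[OF \<open>0 \<le> r\<close>] r(2)]
  show ?thesis
  proof eventually_elim
    case (elim n)
    then have "A_approx n (s n) \<le> A_approx n (\<rho> n r)"
      by (intro A_approx_mono) auto
    with elim show ?case by simp
  qed
qed

lemma A_approx_greater:
  assumes "s \<longlonglongrightarrow> t" "0 \<le> r" "r < t" "u < A r"
  shows "\<forall>\<^sub>F n in sequentially. u < A_approx n (s n)"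
proof -
  obtain c where c: "r < c" "c < t"
    using assms(3) dense by blast
  from order_tendstoD(1)[OF assms(1) c(2)] order_tendstoD(2)[OF \<rho>(3)[OF \<open>0 \<le> r\<close>] c(1)]
    order_tendstoD(1)[OF \<rho>(5)[OF \<open>0 \<le> r\<close>] assms(4)]
  show ?thesis
  proof eventually_elim
    case (elim n)
    then have "A_approx n (\<rho> n r) \<le> A_approx n (s n)"
      by (intro A_approx_mono) auto
    with elim show ?case by simp
  qed
qed

context
  fixes s k
  assumes s: "0 < s" and k: "\<forall>\<^sub>F n in sequentially. bracket \<pi> s n (k n)"
begin

lemma w_bracket: "(\<lambda>n. w n (k n)) \<longlonglongrightarrow> (jump z s)\<^sup>2"
  unfolding w_def by (intro tendsto_power bracket_increment z k)

text \<open>For the ends of the bracketing interval in u, monotonicity yields only this bound and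
  \<open>S_bracket_Suc_less\<close>, both from the outside. The bounds from the inside have to wait
  for \<open>jump_A\<close>.\<close>

lemma S_bracket_greater:
  assumes "u < left_lim A s"
  shows "\<forall>\<^sub>F n in sequentially. u < S n (k n)"
proof -
  obtain r where r: "0 \<le> r" "r < s" "u < A r"
    using A_less_left_lim[OF s assms] .
  obtain c where c: "r < c" "c < s"
    using r(2) dense by blast
  from k order_tendstoD(1)[OF bracket_tendsto[OF k] c(2)] A_approx_greater[OF tendsto_const r(1) c(1) r(3)]
  show ?thesis
  proof eventually_elim
    case (elim n)
    then have "A_approx n c \<le> S n (k n)"
      using c r by (intro A_approx_le_S) (auto simp: bracket_def)
    with elim show ?case by simp
  qed
qed

lemma S_bracket_Suc_less:
  assumes "A s < u"
  shows "\<forall>\<^sub>F n in sequentially. S n (Suc (k n)) < u"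
  using k A_approx_less[OF bracket_tendsto[OF k] less_imp_le[OF s] assms]
proof eventually_elim
  case (elim n)
  then have "S n (Suc (k n)) \<le> A_approx n (\<pi> n ! k n)"
    by (intro S_le_A_approx) (auto simp: bracket_def)
  with elim show ?case by simp
qed

lemma jump_sq_le: "(jump z s)\<^sup>2 \<le> A s - left_lim A s"
proof (rule field_le_epsilon)
  fix e :: real assume "e > 0"
  then have "left_lim A s - e / 2 < left_lim A s" "A s < A s + e / 2"
    by auto
  from S_bracket_greater[OF this(1)] S_bracket_Suc_less[OF this(2)]
  have "\<forall>\<^sub>F n in sequentially. w n (k n) \<le> A s - left_lim A s + e"
    by eventually_elim (simp add: S_Suc)
  then show "(jump z s)\<^sup>2 \<le> A s - left_lim A s + e"
    by (rule tendsto_upperbound[OF w_bracket]) simp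
qed

end

text \<open>An excess e of the jump of A over the squared jump of z would, by uniform closeness
  after the time change, appear in the approximants as a jump of at least
  \<open>(jump z s)\<^sup>2 + e / 2\<close> at the single time \<open>\<rho> n s\<close>. One cell
  starting there must produce it. Its increment is too large for a cell that does not bracket s, and
  on bracketing cells the squares tend to \<open>(jump z s)\<^sup>2\<close>.\<close>

lemma jump_A:
  assumes "0 < s"
  shows "A s - left_lim A s = (jump z s)\<^sup>2"
proof (rule antisym)
  show "(jump z s)\<^sup>2 \<le> A s - left_lim A s"
  proof -
    obtain k where "\<forall>\<^sub>F n in sequentially. bracket \<pi> s n (k n)"
      using bracket_ex[OF assms] ..
    then show ?thesis by (rule jump_sq_le[OF assms])
  qed
  show "A s - left_lim A s \<le> (jump z s)\<^sup>2"
  proof (rule ccontr)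
    assume "\<not> A s - left_lim A s \<le> (jump z s)\<^sup>2"
    define e where "e = A s - left_lim A s - (jump z s)\<^sup>2"
    have "e > 0"
      using \<open>\<not> A s - left_lim A s \<le> (jump z s)\<^sup>2\<close> by (simp add: e_def)
    have "\<forall>\<^sub>F n in sequentially. \<forall>r\<in>{0..s}. dist (A_approx n (\<rho> n r)) (A r) < e / 4"
      using uniform_limitD[OF \<rho>(4)[of s], of "e / 4"] \<open>0 < s\<close> \<open>e > 0\<close> by simp
    then have "\<forall>\<^sub>F n in sequentially. \<exists>k. k < length (\<pi> n) - 1 \<and> \<pi> n ! k = \<rho> n s \<and>
        (jump z s)\<^sup>2 + e / 2 \<le> w n k"
    proof eventually_elim
      case (elim n)
      have pos: "0 \<le> \<rho> n r" if "0 \<le> r" for r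
        using \<rho>(2)[of n] that by auto
      have "0 < \<rho> n s"
        using strict_mono_onD[OF \<rho>(1)[of n], of 0 s] pos[of 0] \<open>0 < s\<close> by simp
      obtain d where d: "d > 0" "\<And>p. p \<in> set (\<pi> n) \<Longrightarrow> p \<noteq> \<rho> n s \<Longrightarrow> d \<le> dist (\<rho> n s) p"
        using finite_set_avoid[of "set (\<pi> n)" "\<rho> n s"] by blast
      \<comment> \<open>A time before \<open>\<rho> n s\<close> so close to it that no partition
        point other than possibly \<open>\<rho> n s\<close> lies in \<open>{c<..\<rho> n s}\<close>.
        Its preimage r precedes s, so A r is at most the left limit of A at s.\<close>
      define c where "c = max 0 (\<rho> n s - d / 2)"
      have c: "0 \<le> c" "c < \<rho> n s" "\<rho> n s - d < c"
        using d(1) \<open>0 < \<rho> n s\<close> by (auto simp: c_def)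
      have "c \<in> \<rho> n ` {0..}" using \<rho>(2) c(1) by simp
      then obtain r where r: "0 \<le> r" "\<rho> n r = c" by auto
      have "r < s"
      proof (rule ccontr)
        assume "\<not> r < s"
        then have "\<rho> n s \<le> \<rho> n r"
          using strict_mono_onD[OF \<rho>(1)[of n], of s r] \<open>0 < s\<close> by (cases "r = s") auto
        then show False using c r by simp
      qed
      have "dist (A_approx n (\<rho> n r)) (A r) < e / 4" "dist (A_approx n (\<rho> n s)) (A s) < e / 4"
        using elim r \<open>r < s\<close> by auto
      then have "A_approx n c < A r + e / 4" "A s - e / 4 < A_approx n (\<rho> n s)"
        unfolding dist_real_def r(2) by linarith+
      moreover have "A s - left_lim A s = (jump z s)\<^sup>2 + e"
        by (simp add: e_def)
      \<comment> \<open>Each of the two comparisons loses e/4 of the excess e.\<close>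
      ultimately have ge: "(jump z s)\<^sup>2 + e / 2 \<le> A_approx n (\<rho> n s) - A_approx n c"
        using A_left_lim_ge[OF \<open>r < s\<close>] by argo
      define K where "K t = {k. k < length (\<pi> n) - 1 \<and> \<pi> n ! k \<le> max t 0}" for t
      have fin: "finite (K t)" for t by (simp add: K_def)
      have sub: "K c \<subseteq> K (\<rho> n s)" using c by (auto simp: K_def)
      have eq: "A_approx n (\<rho> n s) - A_approx n c = sum (w n) (K (\<rho> n s) - K c)"
        unfolding A_approx_def K_def[symmetric] using sub fin by (simp add: sum_diff)
      have at: "\<pi> n ! k = \<rho> n s" if "k \<in> K (\<rho> n s) - K c" for k
      proof (rule ccontr)
        assume "\<pi> n ! k \<noteq> \<rho> n s"
        moreover have "\<pi> n ! k \<in> set (\<pi> n)"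
          using that by (auto simp: K_def)
        ultimately have "d \<le> dist (\<rho> n s) (\<pi> n ! k)"
          using d(2) by blast
        then show False
          using that c by (auto simp: K_def dist_real_def)
      qed
      have "sum (w n) (K (\<rho> n s) - K c) > 0"
        using ge eq \<open>e > 0\<close> zero_le_power2[of "jump z s"] by linarith
      then have "K (\<rho> n s) - K c \<noteq> {}" by (metis less_irrefl sum.empty)
      then obtain k where k: "k \<in> K (\<rho> n s) - K c" by blast
      have "j = k" if j: "j \<in> K (\<rho> n s) - K c" for j
      proof -
        have "j < length (\<pi> n)" "k < length (\<pi> n)"
          using j k by (auto simp: K_def)
        then show ?thesis
          using at[OF j] at[OF k] point_less[of j k n] point_less[of k j n]
          by (cases j k rule: linorder_cases) auto
      qed
      then have "K (\<rho> n s) - K c = {k}" using k by blast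
      then show ?case
        using ge eq k at[OF k] by (intro exI[of _ k]) (auto simp: K_def)
    qed
    then obtain k where k: "\<forall>\<^sub>F n in sequentially. k n < length (\<pi> n) - 1 \<and> \<pi> n ! k n = \<rho> n s \<and>
        (jump z s)\<^sup>2 + e / 2 \<le> w n (k n)"
      unfolding eventually_ex by blast
    have len: "\<forall>\<^sub>F n in sequentially. k n < length (\<pi> n) - 1"
      using k by eventually_elim auto
    have "(\<lambda>n. \<pi> n ! k n) \<longlonglongrightarrow> s"
    proof (rule Lim_transform_eventually)
      show "(\<lambda>n. \<rho> n s) \<longlonglongrightarrow> s"
        using \<rho>(3) \<open>0 < s\<close> by simp
      show "\<forall>\<^sub>F n in sequentially. \<rho> n s = \<pi> n ! k n"
        using k by eventually_elim simp
    qed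
    \<comment> \<open>The squared increments are at least e/2, so this threshold rules out the
      second alternative of \<open>nonbracket_increment\<close>.\<close>
    moreover have "sqrt (e / 2) > 0"
      using \<open>e > 0\<close> by simp
    ultimately have "\<forall>\<^sub>F n in sequentially. bracket \<pi> s n (k n) \<or>
        dist (z (\<pi> n ! Suc (k n))) (z (\<pi> n ! k n)) < sqrt (e / 2)"
      by (rule nonbracket_increment[OF z len])
    then have "\<forall>\<^sub>F n in sequentially. bracket \<pi> s n (k n)"
      using k
    proof eventually_elim
      case (elim n)
      have "\<bar>z (\<pi> n ! Suc (k n)) - z (\<pi> n ! k n)\<bar> \<ge> sqrt (e / 2)"
      proof -
        have "e / 2 \<le> w n (k n)"
          using elim zero_le_power2[of "jump z s"] by linarith
        then have "sqrt (e / 2) \<le> sqrt (w n (k n))"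
          by (rule real_sqrt_le_mono)
        then show ?thesis by (simp add: w_def)
      qed
      then show ?case using elim by (auto simp: dist_real_def)
    qed
    then have "(\<lambda>n. w n (k n)) \<longlonglongrightarrow> (jump z s)\<^sup>2"
      by (rule w_bracket[OF assms])
    then have "(jump z s)\<^sup>2 + e / 2 \<le> (jump z s)\<^sup>2"
    proof (rule tendsto_lowerbound)
      show "\<forall>\<^sub>F n in sequentially. (jump z s)\<^sup>2 + e / 2 \<le> w n (k n)"
        using k by eventually_elim simp
    qed simp
    then show False using \<open>e > 0\<close> by simp
  qed
qed

context
  fixes s k
  assumes s: "0 < s" and k: "\<forall>\<^sub>F n in sequentially. bracket \<pi> s n (k n)"
begin

text \<open>By \<open>jump_A\<close> the bracketing cell exhausts the atom at s: subtracting the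
  limit of its length from the bound at one end gives the missing bound at the other. In u its
  interval thus converges to the jump interval of A at s.\<close>

lemma S_bracket_less:
  assumes "left_lim A s < u"
  shows "\<forall>\<^sub>F n in sequentially. S n (k n) < u"
proof -
  define e where "e = (u - left_lim A s) / 2"
  have "e > 0" using assms by (simp add: e_def)
  have "\<forall>\<^sub>F n in sequentially. (jump z s)\<^sup>2 - e < w n (k n)"
    using \<open>e > 0\<close> by (intro order_tendstoD(1)[OF w_bracket[OF s k]]) simp
  moreover have "\<forall>\<^sub>F n in sequentially. S n (Suc (k n)) < A s + e"
    using \<open>e > 0\<close> by (intro S_bracket_Suc_less[OF s k]) simp
  ultimately show ?thesis
  proof eventually_elim
    case (elim n)
    then show ?case
      using jump_A[OF s] unfolding S_Suc e_def by argo
  qed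
qed

lemma S_bracket_Suc_greater:
  assumes "u < A s"
  shows "\<forall>\<^sub>F n in sequentially. u < S n (Suc (k n))"
proof -
  define e where "e = (A s - u) / 2"
  have "e > 0" using assms by (simp add: e_def)
  have "\<forall>\<^sub>F n in sequentially. (jump z s)\<^sup>2 - e < w n (k n)"
    using \<open>e > 0\<close> by (intro order_tendstoD(1)[OF w_bracket[OF s k]]) simp
  moreover have "\<forall>\<^sub>F n in sequentially. left_lim A s - e < S n (k n)"
    using \<open>e > 0\<close> by (intro S_bracket_greater[OF s k]) simp
  ultimately show ?thesis
  proof eventually_elim
    case (elim n)
    then show ?case
      using jump_A[OF s] unfolding S_Suc e_def by argo
  qed
qed

end

end

section \<open>Sums over cells as step functions of the accumulated mass\<close>

context scalar_qv
begin

lemma A_nonneg: "0 \<le> A t"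
  using A_mono[of 0 t] A_nonpos[of t] A_0 by (cases "0 \<le> t") auto

lemma sum_interval_indicators:
  assumes "k < length (\<pi> n) - 1" "\<pi> n ! k \<le> T" "S n k < u" "u \<le> S n (Suc k)"
  shows "(\<Sum>j\<in>cells n T. c j * indicator {S n j<..S n (Suc j)} u) = (c k :: real)"
proof -
  have "indicator {S n j<..S n (Suc j)} u = (0::real)" if "j \<noteq> k" for j
    using S_mono[of "Suc j" k n] S_mono[of "Suc k" j n] that assms
    by (cases j k rule: linorder_cases) (auto simp: indicator_def)
  then have "(\<Sum>j\<in>cells n T. c j * indicator {S n j<..S n (Suc j)} u) =
    (\<Sum>j\<in>cells n T. if j = k then c k else 0)"
    using assms by (intro sum.cong) (auto simp: indicator_def)
  also have "\<dots> = c k"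
    using assms by simp
  finally show ?thesis .
qed

lemma interval_index_ex:
  assumes "0 \<le> T" "0 < u" "u \<le> A_approx n T"
  shows "\<exists>k. k < length (\<pi> n) - 1 \<and> \<pi> n ! k \<le> T \<and> S n k < u \<and> u \<le> S n (Suc k)"
proof -
  define K where "K = cells n T"
  have fin: "finite K" by (simp add: K_def)
  have A: "A_approx n T = sum (w n) K"
    using assms(1) by (simp add: A_approx_def K_def)
  then have "K \<noteq> {}"
    using assms by auto
  then have m: "Max K \<in> K" using fin by (rule_tac Max_in)
  have "sum (w n) K \<le> S n (Suc (Max K))"
    unfolding S_def using fin by (intro sum_mono2) (auto simp: less_Suc_eq_le)
  then have ex: "u \<le> S n (Suc (Max K))"
    using A assms by simp
  define k where "k = (LEAST k. u \<le> S n (Suc k))"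
  have k: "u \<le> S n (Suc k)"
    unfolding k_def using ex by (rule LeastI)
  have "k \<le> Max K"
    unfolding k_def using ex by (rule Least_le)
  moreover have "Max K < length (\<pi> n)" "Max K < length (\<pi> n) - 1"
    using m by (auto simp: K_def)
  ultimately have "k < length (\<pi> n) - 1" "\<pi> n ! k \<le> T"
    using m point_le[of k "Max K" n] by (auto simp: K_def)
  moreover have "S n k < u"
  proof (cases k)
    case 0
    then show ?thesis using assms by (simp add: S_def)
  next
    case (Suc j)
    then have "\<not> u \<le> S n (Suc j)"
      unfolding k_def using not_less_Least by (metis lessI)
    then show ?thesis using Suc by simp
  qed
  ultimately show ?thesis using k by blast
qed

lemma sum_interval_indicators_0:
  assumes "0 \<le> T" "u \<le> 0 \<or> A_approx n T < u"
  shows "(\<Sum>j\<in>cells n T. c j * indicator {S n j<..S n (Suc j)} u) = (0 :: real)"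
proof (rule sum.neutral, safe)
  fix j assume j: "j < length (\<pi> n) - 1" "\<pi> n ! j \<le> T"
  have "0 \<le> S n j" by (simp add: S_def sum_nonneg)
  moreover have "S n (Suc j) \<le> A_approx n T"
    using j by (rule S_le_A_approx)
  ultimately show "c j * indicator {S n j<..S n (Suc j)} u = 0"
    using assms by auto
qed

end

section \<open>The measure of the quadratic variation up to T, and limits of weighted
  squares\<close>

locale scalar_qv_horizon = scalar_qv \<pi> z A
  for \<pi> :: "nat \<Rightarrow> real list" and z A :: "real \<Rightarrow> real" +
  fixes T :: real
  assumes T: "0 \<le> T"
begin

text \<open>Stopped at T, A is a distribution function up to normalization. The locale supplies its
  quantile function \<open>I\<close>, with \<open>u \<le> A (min t T)\<close> equivalent to
  \<open>I u \<le> t\<close> for u strictly between 0 and A T.\<close>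

sublocale right_continuous_mono "\<lambda>t. A (min t T)" 0 "A T"
proof
  show "continuous (at_right t) (\<lambda>t. A (min t T))" for t
  proof (cases "t < T")
    case True
    have "\<forall>\<^sub>F s in at_right t. A s = A (min s T)"
      using eventually_at_right_real[OF True] by eventually_elim auto
    with cadlag_right[OF A, of t] show ?thesis
      unfolding continuous_within using True by (simp add: Lim_transform_eventually)
  next
    case False
    then have "\<forall>\<^sub>F s in at_right t. A (min s T) = A T"
      by (intro eventually_mono[OF eventually_at_right_less]) simp
    then show ?thesis
      using False by (simp add: continuous_within tendsto_eventually)
  qed
  show "mono (\<lambda>t. A (min t T))"
    by (intro monoI A_mono) auto
  show "((\<lambda>t. A (min t T)) \<longlongrightarrow> 0) at_bot"
    by (rule tendsto_eventually) (auto simp: eventually_at_bot_linorder A_nonpos intro!: exI[of _ 0])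
  show "((\<lambda>t. A (min t T)) \<longlongrightarrow> A T) at_top"
    by (rule tendsto_eventually) (auto simp: eventually_at_top_linorder intro!: exI[of _ T])
qed

text \<open>\<open>I\<close> is the generalised inverse of \<open>A\<close>, so this is the measure on \<open>(0,T]\<close> with distribution
  function \<open>A\<close>.\<close>

definition qv_measure :: "real measure" where
  "qv_measure = distr (restrict_space lborel {0<..<A T}) borel I"

lemma I_range:
  assumes "0 < u" "u < A T"
  shows "0 < I u" "I u \<le> T"
proof -
  show "I u \<le> T"
    using pseudoinverse[OF assms, of T] assms by simp
  have "\<not> I u \<le> 0"
    using pseudoinverse[OF assms, of 0] assms T A_0 by simp
  then show "0 < I u" by simp
qed

lemma I_le_iff: "0 < u \<Longrightarrow> u < A T \<Longrightarrow> I u \<le> t \<longleftrightarrow> u \<le> A (min t T)"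
  using pseudoinverse by blast

lemma measurable_I [measurable]: "I \<in> borel_measurable (restrict_space lborel {0<..<A T})"
proof -
  have "I \<in> borel_measurable (restrict_space borel {0<..<A T})"
    by (intro borel_measurable_mono_on_fnc mono_I)
  then show ?thesis
    by (simp cong: measurable_cong_sets add: sets_restrict_space_cong[of borel lborel])
qed

lemma A_T_nonneg: "0 \<le> A T"
  using A_mono[OF T] A_0 by simp

lemma finite_borel_measure_qv_measure: "finite_borel_measure qv_measure"
proof -
  have "finite_measure (restrict_space lborel {0<..<A T})"
    using A_T_nonneg by (intro finite_measureI) (simp add: space_restrict_space emeasure_restrict_space)
  then have "finite_measure qv_measure"
    unfolding qv_measure_def by (rule finite_measure.finite_measure_distr) measurable
  then show ?thesis
    by (simp add: finite_borel_measure_def finite_borel_measure_axioms_def qv_measure_def)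
qed

lemma cdf_qv_measure: "cdf qv_measure t = A (min t T)"
proof -
  have le: "A (min t T) \<le> A T" and nn: "0 \<le> A (min t T)"
    by (auto intro: A_mono A_nonneg)
  have "cdf qv_measure t = measure (restrict_space lborel {0<..<A T}) {u \<in> {0<..<A T}. I u \<le> t}"
    unfolding cdf_def qv_measure_def
    by (subst measure_distr) (auto simp: space_restrict_space intro!: arg_cong2[where f = measure])
  also have "{u \<in> {0<..<A T}. I u \<le> t} = {u \<in> {0<..<A T}. u \<le> A (min t T)}"
    by (auto simp: I_le_iff)
  also have "measure (restrict_space lborel {0<..<A T}) \<dots> = measure lborel {u \<in> {0<..<A T}. u \<le> A (min t T)}"
    by (subst measure_restrict_space) auto
  \<comment> \<open>The two sets differ at most in the point \<open>A (min t T)\<close>.\<close>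
  also have "\<dots> = measure lborel {0 <..< A (min t T)}"
    using AE_lborel_singleton[of "A (min t T)"] le
    by (auto intro!: arg_cong[where f=enn2real] emeasure_eq_AE simp: measure_def)
  also have "\<dots> = A (min t T)"
    using nn by simp
  finally show ?thesis .
qed

lemma integral_qv_measure:
  fixes g :: "real \<Rightarrow> real"
  assumes g: "g \<in> borel_measurable borel"
  shows "integrable qv_measure g \<longleftrightarrow> integrable lborel (\<lambda>u. indicator {0<..<A T} u * g (I u))"
    and "(LINT t|qv_measure. g t) = (LINT u|lborel. indicator {0<..<A T} u * g (I u))"
proof -
  have m: "(\<lambda>u. g (I u)) \<in> borel_measurable (restrict_space lborel {0<..<A T})"
    using measurable_compose[OF measurable_I g] .
  show "integrable qv_measure g \<longleftrightarrow> integrable lborel (\<lambda>u. indicator {0<..<A T} u * g (I u))"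
    unfolding qv_measure_def using g
    by (subst integrable_distr_eq) (auto simp: integrable_restrict_space)
  show "(LINT t|qv_measure. g t) = (LINT u|lborel. indicator {0<..<A T} u * g (I u))"
    unfolding qv_measure_def using g
    by (subst integral_distr) (auto simp: integral_restrict_space)
qed

lemma measure_qv_singleton:
  assumes "0 < s" "s \<le> T"
  shows "measure qv_measure {s} = (jump z s)\<^sup>2"
proof -
  interpret finite_borel_measure qv_measure
    by (rule finite_borel_measure_qv_measure)
  have "\<forall>\<^sub>F t in at_left s. A t = cdf qv_measure t"
    using eventually_at_left_real[OF assms(1)] by eventually_elim (use assms in \<open>simp add: cdf_qv_measure\<close>)
  then have "(cdf qv_measure \<longlongrightarrow> left_lim A s) (at_left s)"
    using cadlag_left_lim[OF A, of s] by (rule Lim_transform_eventually[rotated])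
  then have lt: "measure qv_measure {..<s} = left_lim A s"
    using cdf_at_left[of s] tendsto_unique trivial_limit_at_left_real by blast
  have "{..s} = {..<s} \<union> {s}" by auto
  then have "cdf qv_measure s = measure qv_measure {..<s} + measure qv_measure {s}"
    unfolding cdf_def by (simp only:, subst finite_measure_Union) auto
  then show ?thesis
    using lt jump_A[OF assms(1)] assms by (simp add: cdf_qv_measure)
qed

lemma AE_qv_measure: "AE t in qv_measure. 0 < t \<and> t \<le> T"
  unfolding qv_measure_def
  by (subst AE_distr_iff) (auto simp: AE_restrict_space_iff I_range)

text \<open>The weights have to converge in two different senses: at times off E without a jump
  along arbitrary cells approaching t, but at a jump of z only along bracketing cells. The latter is
  all that continuity along the partitions provides at a jump.\<close>

theorem weighted_increments_tendsto:
  fixes \<psi> :: "nat \<Rightarrow> nat \<Rightarrow> real" and g :: "real \<Rightarrow> real"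
  assumes E: "countable E"
    and bound: "\<forall>\<^sub>F n in sequentially. \<forall>k<length (\<pi> n) - 1. \<pi> n ! k \<le> T \<longrightarrow> \<bar>\<psi> n k\<bar> \<le> B"
    and off: "\<And>t k. 0 < t \<Longrightarrow> t \<le> T \<Longrightarrow> t \<notin> E \<Longrightarrow> jump z t = 0 \<Longrightarrow>
      (\<forall>\<^sub>F n in sequentially. k n < length (\<pi> n) - 1 \<and> \<pi> n ! k n \<le> T) \<Longrightarrow>
      (\<lambda>n. \<pi> n ! k n) \<longlonglongrightarrow> t \<Longrightarrow> (\<lambda>n. \<psi> n (k n)) \<longlonglongrightarrow> g t"
    and atom: "\<And>t k. 0 < t \<Longrightarrow> t \<le> T \<Longrightarrow> jump z t \<noteq> 0 \<Longrightarrow>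
      (\<forall>\<^sub>F n in sequentially. bracket \<pi> t n (k n)) \<Longrightarrow> (\<lambda>n. \<psi> n (k n)) \<longlonglongrightarrow> g t"
    and g: "g \<in> borel_measurable borel"
  shows "integrable qv_measure g" (is ?int)
    and "(\<lambda>n. \<Sum>k\<in>cells n T. \<psi> n k * w n k)
      \<longlonglongrightarrow> (LINT t|qv_measure. g t)" (is ?lim)
proof -
  define K where "K n = cells n T" for n
  define G where "G n u = (\<Sum>k\<in>K n. \<psi> n k * indicator {S n k<..S n (Suc k)} u)" for n u
  define h where "h u = indicator {0<..<A T} u * g (I u)" for u
  have finK: "finite (K n)" for n by (simp add: K_def)
  have G_eq: "G n u = \<psi> n k" if "k \<in> K n" "S n k < u" "u \<le> S n (Suc k)" for n k u
    unfolding G_def K_def using that by (intro sum_interval_indicators) (auto simp: K_def)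
  have G_0: "G n u = 0" if "u \<le> 0 \<or> A_approx n T < u" for n u
    unfolding G_def K_def using that by (intro sum_interval_indicators_0 T)
  define D where "D = {t. jump z t \<noteq> 0}"
  have D: "countable D" unfolding D_def by (rule countable_jumps[OF z])
  \<comment> \<open>Levels to be avoided: values of A on E, both ends of the jump intervals, and the
    final level A T. The values at rational times contain every level that A keeps on a
    nondegenerate interval, so off X the function A exceeds u immediately after reaching it.\<close>
  define X where "X = A ` E \<union> A ` D \<union> left_lim A ` D \<union> A ` \<rat> \<union> {A T}"
  have X: "countable X"
    unfolding X_def using E D countable_rat by auto
  have lim: "(\<lambda>n. G n u) \<longlonglongrightarrow> h u" if u: "u \<notin> X" for u
  proof -
    consider "u \<le> 0" | "A T < u" | "0 < u" "u < A T"
      using u by (fastforce simp: X_def)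
    then show ?thesis
    proof cases
      case 1
      then show ?thesis by (simp add: G_0 h_def)
    next
      case 2
      then have "\<forall>\<^sub>F n in sequentially. A_approx n T < u"
        using A_approx_less[OF tendsto_const T] by simp
      then have "\<forall>\<^sub>F n in sequentially. G n u = 0"
        by eventually_elim (simp add: G_0)
      then show ?thesis
        using 2 by (simp add: h_def tendsto_eventually)
    next
      case 3
      define s where "s = I u"
      have s: "0 < s" "s \<le> T"
        using I_range[OF 3] by (auto simp: s_def)
      have below: "A r < u" if "r < s" for r
        using I_le_iff[OF 3, of r] that s by (auto simp: s_def)
      have above: "u \<le> A s"
        using I_le_iff[OF 3, of s] s by (auto simp: s_def)
      have hu: "h u = g s"
        using 3 by (simp add: h_def s_def)
      show ?thesis
      proof (cases "jump z s = 0")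
        case False
        then have "u \<noteq> A s" "u \<noteq> left_lim A s"
          using u by (auto simp: X_def D_def)
        moreover have "left_lim A s \<le> u"
          using cadlag_left_lim[OF A, of s]
          by (rule tendsto_upperbound)
            (auto simp: eventually_at_left_field intro!: exI[of _ "s - 1"] less_imp_le[OF below])
        ultimately have su: "left_lim A s < u" "u < A s"
          using above by auto
        obtain k where k: "\<forall>\<^sub>F n in sequentially. bracket \<pi> s n (k n)"
          using bracket_ex[OF s(1)] ..
        from k S_bracket_less[OF s(1) k su(1)] S_bracket_Suc_greater[OF s(1) k su(2)]
        have "\<forall>\<^sub>F n in sequentially. \<psi> n (k n) = G n u"
        proof eventually_elim
          case (elim n)
          then show ?case
            using s by (intro G_eq[symmetric]) (auto simp: K_def bracket_def)
        qed
        then show ?thesis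
          using atom[OF s False k] hu by (simp add: Lim_transform_eventually)
      next
        case True
        then have "left_lim A s = A s"
          using jump_A[OF s(1)] by simp
        then have "A s \<le> u"
          using tendsto_upperbound[OF cadlag_left_lim[OF A, of s], of u] less_imp_le[OF below] lt_ex[of s]
          by (auto simp: eventually_at_left_field intro!: exI[of _ "s - 1"])
        then have us: "u = A s" using above by simp
        have sE: "s \<notin> E" using u us by (auto simp: X_def)
        have above': "u < A r" if "s < r" for r
        proof -
          obtain q where q: "q \<in> \<rat>" "s < q" "q < r"
            using Rats_dense_in_real[OF \<open>s < r\<close>] by blast
          then have "A s \<le> A q" "A q \<le> A r" by (auto intro: A_mono)
          moreover have "A q \<noteq> u" using u q by (auto simp: X_def)
          ultimately show ?thesis using us by simp
        qed
        have "u < A T" by fact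
        then have "\<forall>\<^sub>F n in sequentially. u < A_approx n T"
        proof (cases "s < T")
          case True
          then show ?thesis
            using A_approx_greater[of "\<lambda>_. T" T "(s + T) / 2" u] above'[of "(s + T) / 2"] s by auto
        next
          case False
          then show ?thesis using us s \<open>u < A T\<close> by auto
        qed
        then have "\<forall>\<^sub>F n in sequentially. \<exists>k. k < length (\<pi> n) - 1 \<and> \<pi> n ! k \<le> T \<and> S n k < u \<and> u \<le> S n (Suc k)"
        proof eventually_elim
          case (elim n)
          then show ?case using interval_index_ex[OF T 3(1), of n] by simp
        qed
        then obtain k where k: "\<forall>\<^sub>F n in sequentially. k n < length (\<pi> n) - 1 \<and> \<pi> n ! k n \<le> T \<and>
            S n (k n) < u \<and> u \<le> S n (Suc (k n))"
          unfolding eventually_ex by blast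
        \<comment> \<open>A is below u before s and above u after s, strictly, so the accumulated
          mass passes u only in cells that start near s.\<close>
        have "(\<lambda>n. \<pi> n ! k n) \<longlonglongrightarrow> s"
        proof (rule order_tendstoI)
          fix r assume "r < s"
          then obtain c where c: "max r 0 < c" "c < s"
            using dense[of "max r 0" s] s by auto
          from k A_approx_less[OF tendsto_const _ below[OF c(2)]]
          show "\<forall>\<^sub>F n in sequentially. r < \<pi> n ! k n"
          proof (rule eventually_elim2)
            show "0 \<le> c" using c by simp
            fix n assume n: "k n < length (\<pi> n) - 1 \<and> \<pi> n ! k n \<le> T \<and> S n (k n) < u \<and> u \<le> S n (Suc (k n))"
              "A_approx n c < u"
            show "r < \<pi> n ! k n"
            proof (rule ccontr)
              assume "\<not> r < \<pi> n ! k n"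
              then have "S n (Suc (k n)) \<le> A_approx n c"
                using c n by (intro S_le_A_approx) auto
              then show False using n by simp
            qed
          qed
        next
          fix r assume "s < r"
          then obtain c where c: "s < c" "c < r"
            using dense by blast
          obtain d where d: "s < d" "d < c"
            using c dense by blast
          have "\<forall>\<^sub>F n in sequentially. u < A_approx n c"
            using A_approx_greater[OF tendsto_const _ d(2) above'[OF d(1)]] d s by simp
          with k show "\<forall>\<^sub>F n in sequentially. \<pi> n ! k n < r"
          proof eventually_elim
            case (elim n)
            show ?case
            proof (rule ccontr)
              assume "\<not> \<pi> n ! k n < r"
              then have "A_approx n c \<le> S n (k n)"
                using c s elim by (intro A_approx_le_S) auto
              then show False using elim by simp
            qed
          qed
        qed
        moreover have "\<forall>\<^sub>F n in sequentially. k n < length (\<pi> n) - 1 \<and> \<pi> n ! k n \<le> T"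
          using k by eventually_elim auto
        ultimately have "(\<lambda>n. \<psi> n (k n)) \<longlonglongrightarrow> g s"
          using off[OF s sE True] by blast
        moreover have "\<forall>\<^sub>F n in sequentially. \<psi> n (k n) = G n u"
          using k by eventually_elim (auto intro!: G_eq[symmetric] simp: K_def)
        ultimately show ?thesis
          using hu by (simp add: Lim_transform_eventually)
      qed
    qed
  qed
  have "\<forall>\<^sub>F n in sequentially. A_approx n T < A T + 1"
    by (rule A_approx_less[OF tendsto_const T]) simp
  with bound have "\<forall>\<^sub>F n in sequentially. (\<forall>k\<in>K n. \<bar>\<psi> n k\<bar> \<le> B) \<and> A_approx n T < A T + 1"
    by eventually_elim (auto simp: K_def)
  \<comment> \<open>The bounds hold only eventually; the shift by N makes domination valid for every
    member of the sequence.\<close>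
  then obtain N where N: "\<And>n k. n \<ge> N \<Longrightarrow> k \<in> K n \<Longrightarrow> \<bar>\<psi> n k\<bar> \<le> B" "\<And>n. n \<ge> N \<Longrightarrow> A_approx n T < A T + 1"
    unfolding eventually_sequentially by blast
  have AE: "AE u in lborel. (\<lambda>n. G (n + N) u) \<longlonglongrightarrow> h u"
  proof (rule AE_I')
    show "X \<in> null_sets lborel"
      using X by (rule countable_imp_null_set_lborel)
    show "{u \<in> space lborel. \<not> (\<lambda>n. G (n + N) u) \<longlonglongrightarrow> h u} \<subseteq> X"
      using lim LIMSEQ_ignore_initial_segment by blast
  qed
  have hm: "h \<in> borel_measurable lborel"
  proof -
    have "(\<lambda>u. g (I u)) \<in> borel_measurable (restrict_space lborel {0<..<A T})"
      using measurable_compose[OF measurable_I g] .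
    then show ?thesis
      unfolding h_def by (subst (asm) borel_measurable_restrict_space_iff) auto
  qed
  have Gm: "G n \<in> borel_measurable lborel" for n
    unfolding G_def by measurable
  \<comment> \<open>The step function vanishes beyond the total mass, which stays below A T +
    1.\<close>
  have dom: "norm (G (n + N) u) \<le> \<bar>B\<bar> * indicator {0..A T + 1} u" for n u
  proof (cases "u \<le> 0 \<or> A_approx (n + N) T < u")
    case True
    then show ?thesis by (simp add: G_0)
  next
    case False
    then obtain k where k: "k \<in> K (n + N)" "S (n + N) k < u" "u \<le> S (n + N) (Suc k)"
      using interval_index_ex[OF T, of u "n + N"] by (auto simp: K_def)
    then have "norm (G (n + N) u) \<le> B"
      using N(1)[of "n + N" k] by (simp add: G_eq)
    moreover have "u \<in> {0..A T + 1}"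
      using False N(2)[of "n + N"] by auto
    ultimately show ?thesis by simp
  qed
  have domi: "integrable lborel (\<lambda>u. \<bar>B\<bar> * indicator {0..A T + 1} u)"
    using A_T_nonneg by simp
  have "integrable lborel h"
    by (rule integrable_dominated_convergence[OF hm Gm domi AE]) (use dom in simp)
  then show ?int
    by (simp add: integral_qv_measure(1)[OF g] h_def[abs_def])
  have "(\<lambda>n. LINT u|lborel. G (n + N) u) \<longlonglongrightarrow> (LINT u|lborel. h u)"
    by (rule integral_dominated_convergence[OF hm Gm domi AE]) (use dom in simp)
  then have "(\<lambda>n. LINT u|lborel. G n u) \<longlonglongrightarrow> (LINT t|qv_measure. g t)"
    by (simp add: integral_qv_measure(2)[OF g] h_def[abs_def] LIMSEQ_offset)
  moreover have "(LINT u|lborel. G n u) = (\<Sum>k\<in>K n. \<psi> n k * w n k)" for n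
  proof -
    have "(LINT u|lborel. G n u) = (\<Sum>k\<in>K n. LINT u|lborel. \<psi> n k * indicator {S n k<..S n (Suc k)} u)"
      unfolding G_def by (rule Bochner_Integration.integral_sum) (auto simp: S_mono)
    also have "\<dots> = (\<Sum>k\<in>K n. \<psi> n k * w n k)"
      by (intro sum.cong) (auto simp: S_mono S_Suc)
    finally show ?thesis .
  qed
  ultimately show ?lim
    by (simp add: K_def)
qed

end

section \<open>Lebesgue-Stieltjes integrals\<close>

text \<open>Half-lines generate the Borel sets and are stable under intersection. The equation is
  kept between sums of measures, so that no signed measure is involved. The total masses, needed for
  complements, agree by letting t tend to infinity.\<close>

lemma finite_borel_measures_add_eq:
  fixes M1 M2 N1 N2 :: "real measure"
  assumes fin: "finite_borel_measure M1" "finite_borel_measure M2"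
      "finite_borel_measure N1" "finite_borel_measure N2"
    and cdf: "\<And>t. cdf M1 t + cdf M2 t = cdf N1 t + cdf N2 t"
    and B: "B \<in> sets borel"
  shows "measure M1 B + measure M2 B = measure N1 B + measure N2 B"
proof -
  interpret M1: finite_borel_measure M1 by fact
  interpret M2: finite_borel_measure M2 by fact
  interpret N1: finite_borel_measure N1 by fact
  interpret N2: finite_borel_measure N2 by fact
  have total: "measure M1 UNIV + measure M2 UNIV = measure N1 UNIV + measure N2 UNIV"
  proof (rule tendsto_unique)
    show "((\<lambda>t. cdf M1 t + cdf M2 t) \<longlongrightarrow> measure M1 UNIV + measure M2 UNIV) at_top"
      using tendsto_add[OF M1.cdf_lim_at_top M2.cdf_lim_at_top] by (simp add: M1.borel_UNIV M2.borel_UNIV)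
    show "((\<lambda>t. cdf M1 t + cdf M2 t) \<longlongrightarrow> measure N1 UNIV + measure N2 UNIV) at_top"
      using tendsto_add[OF N1.cdf_lim_at_top N2.cdf_lim_at_top]
      by (simp add: cdf N1.borel_UNIV N2.borel_UNIV)
  qed simp
  have sets: "B \<in> sigma_sets UNIV (range (\<lambda>a::real. {..a})) \<Longrightarrow> B \<in> sets borel" for B
    by (simp add: borel_eq_atMost)
  have "Int_stable (range (\<lambda>a::real. {..a}))"
    by (auto simp: Int_stable_def)
  moreover have "range (\<lambda>a::real. {..a}) \<subseteq> Pow UNIV"
    by simp
  moreover have "B \<in> sigma_sets UNIV (range (\<lambda>a::real. {..a}))"
    using B by (simp add: borel_eq_atMost)
  ultimately show ?thesis
  proof (induction rule: sigma_sets_induct_disjoint)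
    case (basic A)
    then show ?case using cdf by (auto simp: cdf_def)
  next
    case empty
    show ?case by simp
  next
    case (compl A)
    note A = sets[OF compl(1)]
    have "measure M1 (UNIV - A) = measure M1 UNIV - measure M1 A"
      "measure M2 (UNIV - A) = measure M2 UNIV - measure M2 A"
      "measure N1 (UNIV - A) = measure N1 UNIV - measure N1 A"
      "measure N2 (UNIV - A) = measure N2 UNIV - measure N2 A"
      using A M1.finite_measure_compl[of A] M2.finite_measure_compl[of A]
        N1.finite_measure_compl[of A] N2.finite_measure_compl[of A]
      by (auto simp: M1.borel_UNIV M2.borel_UNIV N1.borel_UNIV N2.borel_UNIV)
    then show ?case using total compl by simp
  next
    case (union A)
    have A: "range A \<subseteq> sets borel" using union(2) sets by blast
    have "(\<lambda>i. measure M1 (A i) + measure M2 (A i)) sums (measure M1 (\<Union>i. A i) + measure M2 (\<Union>i. A i))"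
      using A union(1) by (intro sums_add M1.finite_measure_UNION M2.finite_measure_UNION)
        (auto simp: M1.M_is_borel M2.M_is_borel)
    moreover have "(\<lambda>i. measure N1 (A i) + measure N2 (A i)) sums (measure N1 (\<Union>i. A i) + measure N2 (\<Union>i. A i))"
      using A union(1) by (intro sums_add N1.finite_measure_UNION N2.finite_measure_UNION)
        (auto simp: N1.M_is_borel N2.M_is_borel)
    ultimately show ?case
      using union(3) sums_unique2 by simp
  qed
qed

lemma nn_integral_finite_borel_measures_add_eq:
  fixes M1 M2 N1 N2 :: "real measure"
  assumes fin: "finite_borel_measure M1" "finite_borel_measure M2"
      "finite_borel_measure N1" "finite_borel_measure N2"
    and cdf: "\<And>t. cdf M1 t + cdf M2 t = cdf N1 t + cdf N2 t"
    and f: "f \<in> borel_measurable borel"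
  shows "(\<integral>\<^sup>+x. f x \<partial>M1) + (\<integral>\<^sup>+x. f x \<partial>M2) = (\<integral>\<^sup>+x. f x \<partial>N1) + (\<integral>\<^sup>+x. f x \<partial>N2)"
proof -
  interpret M1: finite_borel_measure M1 by fact
  interpret M2: finite_borel_measure M2 by fact
  interpret N1: finite_borel_measure N1 by fact
  interpret N2: finite_borel_measure N2 by fact
  note [measurable_cong] = M1.M_is_borel M2.M_is_borel N1.M_is_borel N2.M_is_borel
  show ?thesis
    using f
  proof (induction rule: borel_measurable_induct)
    case (cong f g)
    then show ?case by simp
  next
    case (set B)
    have "ennreal (measure M1 B) + ennreal (measure M2 B) = ennreal (measure N1 B) + ennreal (measure N2 B)"
      using finite_borel_measures_add_eq[OF fin cdf set] by (simp add: ennreal_plus[symmetric] del: ennreal_plus)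
    then show ?case
      using set by (simp add: M1.emeasure_eq_measure M2.emeasure_eq_measure
          N1.emeasure_eq_measure N2.emeasure_eq_measure M1.M_is_borel M2.M_is_borel N1.M_is_borel N2.M_is_borel)
  next
    case (mult u c)
    then have [measurable]: "u \<in> borel_measurable borel" by simp
    show ?case
      using mult by (simp add: nn_integral_cmult distrib_left[symmetric])
  next
    case (add u v)
    then have [measurable]: "u \<in> borel_measurable borel" "v \<in> borel_measurable borel" by simp_all
    have "(\<integral>\<^sup>+x. v x + u x \<partial>M) + (\<integral>\<^sup>+x. v x + u x \<partial>N) =
        ((\<integral>\<^sup>+x. u x \<partial>M) + (\<integral>\<^sup>+x. u x \<partial>N)) + ((\<integral>\<^sup>+x. v x \<partial>M) + (\<integral>\<^sup>+x. v x \<partial>N))"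
      if [measurable_cong]: "sets M = sets borel" "sets N = sets borel" for M N :: "real measure"
      by (simp add: nn_integral_add add_ac)
    then show ?case
      using add.IH M1.M_is_borel M2.M_is_borel N1.M_is_borel N2.M_is_borel
      by simp
  next
    case (seq U)
    then have [measurable]: "\<And>i. U i \<in> borel_measurable borel" by simp
    have *: "(\<integral>\<^sup>+x. (SUP i. U i) x \<partial>M) + (\<integral>\<^sup>+x. (SUP i. U i) x \<partial>N) = (SUP i. (\<integral>\<^sup>+x. U i x \<partial>M) + (\<integral>\<^sup>+x. U i x \<partial>N))"
      if "sets M = sets borel" "sets N = sets borel" for M N :: "real measure"
    proof -
      note [measurable_cong] = that
      have "(\<integral>\<^sup>+x. (SUP i. U i) x \<partial>M) = (SUP i. \<integral>\<^sup>+x. U i x \<partial>M)"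
        if [measurable_cong]: "sets M = sets borel" for M :: "real measure"
        unfolding SUP_apply using seq by (intro nn_integral_monotone_convergence_SUP) auto
      moreover have "incseq (\<lambda>i. \<integral>\<^sup>+x. U i x \<partial>M)" for M :: "real measure"
        using seq by (auto simp: incseq_def le_fun_def intro!: nn_integral_mono)
      ultimately show ?thesis
        using that by (simp add: ennreal_SUP_add)
    qed
    show ?case
      by (simp only: *[OF M1.M_is_borel M2.M_is_borel] *[OF N1.M_is_borel N2.M_is_borel] seq.IH)
  qed
qed

lemma integral_finite_borel_measures_add_eq:
  fixes M1 M2 N1 N2 :: "real measure" and f :: "real \<Rightarrow> real"
  assumes fin: "finite_borel_measure M1" "finite_borel_measure M2"
      "finite_borel_measure N1" "finite_borel_measure N2"
    and cdf: "\<And>t. cdf M1 t + cdf M2 t = cdf N1 t + cdf N2 t"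
    and f: "integrable M1 f" "integrable M2 f" "integrable N1 f" "integrable N2 f"
  shows "(LINT x|M1. f x) + (LINT x|M2. f x) = (LINT x|N1. f x) + (LINT x|N2. f x)"
proof -
  have m[measurable]: "f \<in> borel_measurable borel"
    using borel_measurable_integrable[OF f(1)] finite_borel_measure.M_is_borel[OF fin(1)]
    by (simp cong: measurable_cong_sets)
  have *: "enn2real (\<integral>\<^sup>+x. ennreal (g x) \<partial>M1) + enn2real (\<integral>\<^sup>+x. ennreal (g x) \<partial>M2) =
      enn2real (\<integral>\<^sup>+x. ennreal (g x) \<partial>N1) + enn2real (\<integral>\<^sup>+x. ennreal (g x) \<partial>N2)"
    if "g \<in> borel_measurable borel" "(\<integral>\<^sup>+x. ennreal (g x) \<partial>M1) < top" "(\<integral>\<^sup>+x. ennreal (g x) \<partial>M2) < top"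
      "(\<integral>\<^sup>+x. ennreal (g x) \<partial>N1) < top" "(\<integral>\<^sup>+x. ennreal (g x) \<partial>N2) < top" for g :: "real \<Rightarrow> real"
    using arg_cong[OF nn_integral_finite_borel_measures_add_eq[OF fin cdf, of "\<lambda>x. ennreal (g x)"], of enn2real] that
    by (simp add: enn2real_plus)
  show ?thesis
    using *[of f] *[of "\<lambda>x. - f x"] f m
    by (simp add: real_lebesgue_integral_def real_integrable_def less_top)
qed

text \<open>Outside [0,T] the decomposition g = u - v is uncontrolled, and
  \<open>interval_measure u\<close> may be infinite. The restriction is finite, and its distribution
  function depends only on u over [0,T].\<close>

definition restricted_interval_measure :: "(real \<Rightarrow> real) \<Rightarrow> real \<Rightarrow> real measure" where
  "restricted_interval_measure u T = density (interval_measure u) (\<lambda>s. ennreal (indicator {0<..T} s))"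

lemma restricted_interval_measure:
  fixes u :: "real \<Rightarrow> real"
  assumes u: "mono u" "\<And>s. continuous (at_right s) u" and T: "0 \<le> T"
  shows "finite_borel_measure (restricted_interval_measure u T)"
    and "cdf (restricted_interval_measure u T) t = u (max 0 (min t T)) - u 0"
    and "set_integrable (interval_measure u) {0<..T} f \<Longrightarrow>
      integrable (restricted_interval_measure u T) (\<lambda>s. indicator {0<..T} s *\<^sub>R (f s :: real))"
    and "set_integrable (interval_measure u) {0<..T} f \<Longrightarrow> (LINT s:{0<..T}|interval_measure u. f s) =
      (LINT s|restricted_interval_measure u T. indicator {0<..T} s *\<^sub>R f s)"
proof -
  note mono = monoD[OF u(1)]
  have em: "emeasure (restricted_interval_measure u T) B = emeasure (interval_measure u) ({0<..T} \<inter> B)"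
    if "B \<in> sets borel" for B
    unfolding restricted_interval_measure_def using that
    by (simp add: emeasure_density ennreal_indicator nn_integral_restrict_space[symmetric]
      flip: indicator_inter_arith)
  have Ioc: "emeasure (interval_measure u) {a<..b} = ennreal (u b - u a)" if "a \<le> b" for a b
    using that by (rule emeasure_interval_measure_Ioc) (use mono u in auto)
  have sets: "sets (restricted_interval_measure u T) = sets borel"
    by (simp add: restricted_interval_measure_def)
  have "finite_measure (restricted_interval_measure u T)"
  proof (rule finite_measureI)
    have "space (restricted_interval_measure u T) = UNIV"
      by (simp add: restricted_interval_measure_def)
    then show "emeasure (restricted_interval_measure u T) (space (restricted_interval_measure u T)) \<noteq> \<infinity>"
      using T by (simp add: em Ioc)
  qed
  then show "finite_borel_measure (restricted_interval_measure u T)"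
    using sets by (simp add: finite_borel_measure_def finite_borel_measure_axioms_def)
  have "{0<..T} \<inter> {..t} = {0<..max 0 (min t T)}"
    using T by auto
  then show "cdf (restricted_interval_measure u T) t = u (max 0 (min t T)) - u 0"
    using mono[of 0 "max 0 (min t T)"] by (simp add: cdf_def measure_def em Ioc)
  assume f: "set_integrable (interval_measure u) {0<..T} f"
  then have m: "(\<lambda>s. indicator {0<..T} s *\<^sub>R f s) \<in> borel_measurable (interval_measure u)"
    unfolding set_integrable_def by (rule borel_measurable_integrable)
  have eq: "indicator {0<..T} s *\<^sub>R indicator {0<..T} s *\<^sub>R f s = indicator {0<..T} s *\<^sub>R f s" for s
    by (simp add: indicator_def)
  note [simp del] = real_scaleR_def scaleR_scaleR
  show "integrable (restricted_interval_measure u T) (\<lambda>s. indicator {0<..T} s *\<^sub>R f s)"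
    unfolding restricted_interval_measure_def using f m
    by (subst integrable_density) (auto simp: eq set_integrable_def)
  show "(LINT s:{0<..T}|interval_measure u. f s) =
      (LINT s|restricted_interval_measure u T. indicator {0<..T} s *\<^sub>R f s)"
    unfolding restricted_interval_measure_def using m
    by (subst integral_density) (auto simp: eq set_lebesgue_integral_def)
qed

text \<open>Two decompositions with u - v = u' - v' on [0,T] satisfy u + v' = u' + v up to
  constants, which is an equation between sums of finite measures.\<close>

lemma has_stieltjes_integral_unique:
  assumes T: "0 \<le> T" and "has_stieltjes_integral f g T I" "has_stieltjes_integral f g T J"
  shows "I = J"
proof -
  obtain u v where u: "mono u" "\<And>s. continuous (at_right s) u" and v: "mono v" "\<And>s. continuous (at_right s) v"
    and uv: "\<And>s. s \<in> {0..T} \<Longrightarrow> g s = u s - v s"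
    and fu: "set_integrable (interval_measure u) {0<..T} f" and fv: "set_integrable (interval_measure v) {0<..T} f"
    and I: "I = (LINT s:{0<..T}|interval_measure u. f s) - (LINT s:{0<..T}|interval_measure v. f s)"
    using assms(2) unfolding has_stieltjes_integral_def by blast
  obtain u' v' where u': "mono u'" "\<And>s. continuous (at_right s) u'"
    and v': "mono v'" "\<And>s. continuous (at_right s) v'"
    and uv': "\<And>s. s \<in> {0..T} \<Longrightarrow> g s = u' s - v' s"
    and fu': "set_integrable (interval_measure u') {0<..T} f" and fv': "set_integrable (interval_measure v') {0<..T} f"
    and J: "J = (LINT s:{0<..T}|interval_measure u'. f s) - (LINT s:{0<..T}|interval_measure v'. f s)"
    using assms(3) unfolding has_stieltjes_integral_def by blast
  note ru = restricted_interval_measure[OF u T] and rv = restricted_interval_measure[OF v T]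
    and ru' = restricted_interval_measure[OF u' T] and rv' = restricted_interval_measure[OF v' T]
  have "cdf (restricted_interval_measure u T) t + cdf (restricted_interval_measure v' T) t =
      cdf (restricted_interval_measure u' T) t + cdf (restricted_interval_measure v T) t" for t
  proof -
    have "max 0 (min t T) \<in> {0..T}" "0 \<in> {0..T}"
      using T by auto
    then have "u (max 0 (min t T)) - v (max 0 (min t T)) = u' (max 0 (min t T)) - v' (max 0 (min t T))"
      "u 0 - v 0 = u' 0 - v' 0"
      using uv uv' by metis+
    then show ?thesis
      unfolding ru(2) rv(2) ru'(2) rv'(2) by linarith
  qed
  from integral_finite_borel_measures_add_eq[OF ru(1) rv'(1) ru'(1) rv(1) this ru(3)[OF fu] rv'(3)[OF fv'] ru'(3)[OF fu'] rv(3)[OF fv]]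
  show ?thesis
    unfolding I J ru(4)[OF fu] rv(4)[OF fv] ru'(4)[OF fu'] rv'(4)[OF fv'] by linarith
qed

lemma stieltjes_integral_eqI:
  "0 \<le> T \<Longrightarrow> has_stieltjes_integral f g T I \<Longrightarrow> stieltjes_integral f g T = I"
  unfolding stieltjes_integral_def by (rule the_equality) (auto intro: has_stieltjes_integral_unique)

text \<open>Brings measures built from the quadratic variation into the form that
  \<open>has_stieltjes_integral\<close> asks for.\<close>

lemma (in finite_borel_measure) interval_measure_cdf: "interval_measure (cdf M) = M"
proof (rule cdf_unique')
  show "finite_borel_measure (interval_measure (cdf M))"
    by (rule finite_borel_measure_interval_measure[OF cdf_nondecreasing cdf_is_right_cont cdf_lim_at_bot cdf_lim_at_top])
      simp_all
  show "finite_borel_measure M"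
    by (rule finite_borel_measure_axioms)
  show "cdf (interval_measure (cdf M)) = cdf M"
    by (rule cdf_interval_measure[OF cdf_nondecreasing cdf_is_right_cont cdf_lim_at_bot])
qed

section \<open>The continuous part of the quadratic variation\<close>

context scalar_qv_horizon
begin

text \<open>D will be a countable set containing the jump times of z. Its remaining points carry no
  mass, so the jump times of the vector path can serve as one D for all directions.\<close>

definition cont_measure :: "real set \<Rightarrow> real measure" where
  "cont_measure D = density qv_measure (\<lambda>t. ennreal (indicator (- D) t))"

context
  fixes D :: "real set"
  assumes D: "countable D" and jumps: "{t. jump z t \<noteq> 0} \<subseteq> D"
begin

lemma D_borel [measurable]: "D \<in> sets borel"
  using D by (rule sets.countable[rotated]) auto

lemma sets_qv_measure [simp, measurable_cong]: "sets qv_measure = sets borel"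
  by (simp add: qv_measure_def)

lemma finite_borel_measure_cont_measure: "finite_borel_measure (cont_measure D)"
proof -
  interpret finite_borel_measure qv_measure
    by (rule finite_borel_measure_qv_measure)
  have "emeasure (cont_measure D) UNIV \<le> emeasure qv_measure UNIV"
    unfolding cont_measure_def
    by (auto simp: emeasure_density ennreal_indicator M_is_borel intro!: emeasure_mono)
  then have "finite_measure (cont_measure D)"
    by (intro finite_measureI) (auto simp: cont_measure_def borel_UNIV top_unique)
  then show ?thesis
    by (simp add: finite_borel_measure_def finite_borel_measure_axioms_def cont_measure_def)
qed

lemma AE_cont_measure: "AE t in cont_measure D. t \<in> {0<..T} - D"
proof -
  from AE_qv_measure have "AE t in qv_measure. 0 < ennreal (indicator (- D) t) \<longrightarrow> t \<in> {0<..T} - D"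
    by eventually_elim (auto simp: ennreal_indicator split: split_indicator)
  then show ?thesis
    unfolding cont_measure_def by (subst AE_density) auto
qed

text \<open>Restricted to D the measure is discrete, with the squared jumps as weights. The series
  is the integral over this part, and its summability is a case of integrability.\<close>

lemma integral_qv_measure_split:
  fixes g :: "real \<Rightarrow> real"
  assumes int: "integrable qv_measure g"
  shows "(\<lambda>s. g s * (jump z s)\<^sup>2) summable_on {0..T}"
    and "integrable (cont_measure D) g"
    and "(LINT t|qv_measure. g t) = (LINT t|cont_measure D. g t) + (\<Sum>\<^sub>\<infinity>s\<in>{0..T}. g s * (jump z s)\<^sup>2)"
proof -
  interpret finite_borel_measure qv_measure
    by (rule finite_borel_measure_qv_measure)
  have [measurable]: "g \<in> borel_measurable borel"
    using borel_measurable_integrable[OF int] by (simp cong: measurable_cong_sets)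
  define D' where "D' = D \<inter> {0<..T}"
  have D': "countable D'" and [measurable]: "D' \<in> sets borel"
    using D by (auto simp: D'_def)
  \<comment> \<open>On a countable set a measure is determined by its atoms, which
    \<open>measure_qv_singleton\<close> provides. Time 0 is left out of \<open>D'\<close>; it
    contributes nothing to the series because z does not jump there.\<close>
  have eq: "restrict_space qv_measure D' = density (count_space D') (\<lambda>s. ennreal ((jump z s)\<^sup>2))"
  proof (rule measure_eqI_countable'[OF _ _ _ _ D'])
    fix s assume s: "s \<in> D'"
    then have "emeasure (restrict_space qv_measure D') {s} = emeasure qv_measure {s}"
      by (intro emeasure_restrict_space) (auto simp: borel_UNIV)
    also have "\<dots> = ennreal ((jump z s)\<^sup>2)"
      using s by (simp add: emeasure_eq_measure measure_qv_singleton D'_def)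
    also have "\<dots> = emeasure (density (count_space D') (\<lambda>s. ennreal ((jump z s)\<^sup>2))) {s}"
      using s by (simp add: emeasure_density nn_integral_indicator_singleton)
    finally show "emeasure (restrict_space qv_measure D') {s} =
      emeasure (density (count_space D') (\<lambda>s. ennreal ((jump z s)\<^sup>2))) {s}" .
    show "{s} \<in> sets (restrict_space qv_measure D')"
      using s by (auto simp: sets_restrict_space intro!: image_eqI[of _ _ "{s}"])
  qed (auto simp: space_restrict_space borel_UNIV)
  have i1: "integrable qv_measure (\<lambda>t. indicator D' t *\<^sub>R g t)"
    by (rule integrable_mult_indicator[OF _ int]) simp
  have i2: "integrable qv_measure (\<lambda>t. indicator (- D) t *\<^sub>R g t)"
    by (rule integrable_mult_indicator[OF _ int]) simp
  have "integrable (restrict_space qv_measure D') g"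
    using i1 by (subst integrable_restrict_space) auto
  then have "integrable (count_space D') (\<lambda>s. (jump z s)\<^sup>2 *\<^sub>R g s)"
    unfolding eq by (subst (asm) integrable_density) auto
  then have abs: "Infinite_Set_Sum.abs_summable_on (\<lambda>s. g s * (jump z s)\<^sup>2) D'"
    by (simp add: Infinite_Set_Sum.abs_summable_on_def mult.commute)
  have zero: "g s * (jump z s)\<^sup>2 = 0" if "s \<in> {0..T} - D'" for s
    using that jumps jump_nonpos[OF z, of s] by (cases "s = 0") (auto simp: D'_def)
  have sub: "D' \<subseteq> {0..T}" by (auto simp: D'_def)
  have summ: "(\<lambda>s. g s * (jump z s)\<^sup>2) summable_on D'"
    using abs_summable_equivalent[THEN iffD2, OF abs] by (rule abs_summable_summable)
  have "(\<lambda>s. g s * (jump z s)\<^sup>2) summable_on D' \<longleftrightarrow> (\<lambda>s. g s * (jump z s)\<^sup>2) summable_on {0..T}"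
    using zero sub by (intro summable_on_cong_neutral) auto
  with summ show "(\<lambda>s. g s * (jump z s)\<^sup>2) summable_on {0..T}" by simp
  have "(\<Sum>\<^sub>\<infinity>s\<in>{0..T}. g s * (jump z s)\<^sup>2) = (\<Sum>\<^sub>\<infinity>s\<in>D'. g s * (jump z s)\<^sup>2)"
    using zero sub by (intro infsum_cong_neutral) auto
  also have "\<dots> = infsetsum (\<lambda>s. g s * (jump z s)\<^sup>2) D'"
    using abs by (rule infsetsum_infsum[symmetric])
  also have "\<dots> = (LINT s|restrict_space qv_measure D'. g s)"
    unfolding eq infsetsum_def by (subst integral_density) (auto simp: mult.commute)
  also have "\<dots> = (LINT t|qv_measure. indicator D' t *\<^sub>R g t)"
    by (subst integral_restrict_space) auto
  finally have sum: "(\<Sum>\<^sub>\<infinity>s\<in>{0..T}. g s * (jump z s)\<^sup>2) = (LINT t|qv_measure. indicator D' t *\<^sub>R g t)" .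
  show "integrable (cont_measure D) g"
    unfolding cont_measure_def using i2 by (subst integrable_density) auto
  have "(LINT t|cont_measure D. g t) = (LINT t|qv_measure. indicator (- D) t *\<^sub>R g t)"
    unfolding cont_measure_def by (subst integral_density) auto
  moreover have "(LINT t|qv_measure. g t) =
      (LINT t|qv_measure. indicator (- D) t *\<^sub>R g t + indicator D' t *\<^sub>R g t)"
  proof (rule integral_cong_AE)
    show "AE t in qv_measure. g t = indicator (- D) t *\<^sub>R g t + indicator D' t *\<^sub>R g t"
      using AE_qv_measure by eventually_elim (auto simp: D'_def split: split_indicator)
  qed simp_all
  ultimately show "(LINT t|qv_measure. g t) = (LINT t|cont_measure D. g t) + (\<Sum>\<^sub>\<infinity>s\<in>{0..T}. g s * (jump z s)\<^sup>2)"
    using i1 i2 by (simp add: sum)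
qed

text \<open>The splitting for the indicator of \<open>{..t}\<close>. It identifies the distribution
  function of \<open>cont_measure D\<close> with the continuous part of A.\<close>

lemma cdf_cont_measure:
  assumes t: "0 \<le> t" "t \<le> T"
  shows "(\<lambda>s. (jump z s)\<^sup>2) summable_on {0..t}"
    and "cdf (cont_measure D) t = A t - (\<Sum>\<^sub>\<infinity>s\<in>{0..t}. (jump z s)\<^sup>2)"
proof -
  interpret finite_borel_measure qv_measure
    by (rule finite_borel_measure_qv_measure)
  interpret C: finite_borel_measure "cont_measure D"
    by (rule finite_borel_measure_cont_measure)
  have int: "integrable qv_measure (indicator {..t} :: real \<Rightarrow> real)"
    by (rule integrable_real_indicator) (auto simp: emeasure_eq_measure)
  note split = integral_qv_measure_split[OF int]
  show "(\<lambda>s. (jump z s)\<^sup>2) summable_on {0..t}"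
    using split(1) t by (subst summable_on_cong_neutral[of "{0..T}" "{0..t}" "\<lambda>s. indicator {..t} s * (jump z s)\<^sup>2"]) auto
  have "(\<Sum>\<^sub>\<infinity>s\<in>{0..T}. indicator {..t} s * (jump z s)\<^sup>2) = (\<Sum>\<^sub>\<infinity>s\<in>{0..t}. (jump z s)\<^sup>2)"
    using t by (intro infsum_cong_neutral) auto
  then show "cdf (cont_measure D) t = A t - (\<Sum>\<^sub>\<infinity>s\<in>{0..t}. (jump z s)\<^sup>2)"
    using split(3) cdf_qv_measure[of t] t by (simp add: cdf_def C.borel_UNIV)
qed

end

end

section \<open>Quadratic variation of a vector-valued path\<close>

lemma has_sum_diff:
  fixes f g :: "'a \<Rightarrow> real"
  assumes "(f has_sum a) A" "(g has_sum b) A"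
  shows "((\<lambda>s. f s - g s) has_sum (a - b)) A"
  using has_sum_add[OF assms(1) has_sum_cmult_right[OF assms(2), of "-1"]] by simp

lemma has_sum_sum:
  fixes f :: "'i \<Rightarrow> 'a \<Rightarrow> real"
  assumes "\<And>i. i \<in> I \<Longrightarrow> (f i has_sum a i) A"
  shows "((\<lambda>s. \<Sum>i\<in>I. f i s) has_sum (\<Sum>i\<in>I. a i)) A"
  using assms by (induction I rule: infinite_finite_induct) (auto intro!: has_sum_add)

section \<open>Limits in the Skorokhod topology\<close>

text \<open>The preimages of t under the time changes tend to t, since these are uniformly close to
  the identity; at a continuity point q follows them.\<close>

lemma tendsto_J1_continuity_point:
  assumes J1: "tendsto_J1 X q" and q: "q \<in> cadlag_paths" and t: "0 \<le> t" "jump q t = 0"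
  shows "(\<lambda>n. X n t) \<longlonglongrightarrow> q t"
proof -
  obtain \<rho> where \<rho>: "\<forall>n. strict_mono_on {0..} (\<rho> n) \<and> \<rho> n ` {0..} = {0..}"
    "uniform_limit {0..} \<rho> (\<lambda>s. s) sequentially"
    "\<forall>T\<ge>0. uniform_limit {0..T} (\<lambda>n s. X n (\<rho> n s)) q sequentially"
    using J1 unfolding tendsto_J1_def by blast
  have "\<forall>n. \<exists>s\<ge>0. \<rho> n s = t"
  proof
    fix n
    have "t \<in> \<rho> n ` {0..}" using \<rho>(1) t(1) by simp
    then show "\<exists>s\<ge>0. \<rho> n s = t" by auto
  qed
  then obtain \<sigma> where \<sigma>: "\<And>n. 0 \<le> \<sigma> n" "\<And>n. \<rho> n (\<sigma> n) = t"
    by metis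
  have \<sigma>_lim: "\<sigma> \<longlonglongrightarrow> t"
  proof (rule tendstoI)
    fix e :: real assume "e > 0"
    from uniform_limitD[OF \<rho>(2) this]
    show "\<forall>\<^sub>F n in sequentially. dist (\<sigma> n) t < e"
      by eventually_elim (metis \<sigma> atLeast_iff dist_commute)
  qed
  have "(\<lambda>n. X n t - q (\<sigma> n)) \<longlonglongrightarrow> 0"
  proof (rule tendstoI)
    fix e :: real assume "e > 0"
    have "uniform_limit {0..t + 1} (\<lambda>n s. X n (\<rho> n s)) q sequentially"
      using \<rho>(3) t(1) by simp
    from uniform_limitD[OF this \<open>e > 0\<close>] order_tendstoD(2)[OF \<sigma>_lim, of "t + 1"]
    show "\<forall>\<^sub>F n in sequentially. dist (X n t - q (\<sigma> n)) 0 < e"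
    proof (rule eventually_elim2)
      fix n assume "\<forall>x\<in>{0..t + 1}. dist (X n (\<rho> n x)) (q x) < e" "\<sigma> n < t + 1"
      then have "dist (X n (\<rho> n (\<sigma> n))) (q (\<sigma> n)) < e"
        using \<sigma>(1)[of n] by auto
      then show "dist (X n t - q (\<sigma> n)) 0 < e"
        by (simp add: \<sigma>(2) dist_norm)
    qed simp
  qed
  from tendsto_add[OF this cadlag_seq_cont[OF q \<sigma>_lim t(2)]] show ?thesis
    by simp
qed

text \<open>Two limits agree at their common continuity points, which accumulate from the right at
  every t because jumps are countable; right-continuity does the rest. This gives meaning to the
  definite description in \<open>qv\<close>.\<close>

lemma tendsto_J1_unique:
  assumes "tendsto_J1 X p" "tendsto_J1 X q" and p: "p \<in> cadlag_paths" and q: "q \<in> cadlag_paths"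
  shows "p = q"
proof -
  have eq: "p t = q t" if t: "0 \<le> t" for t
  proof -
    define C where "C = {s. jump p s \<noteq> 0} \<union> {s. jump q s \<noteq> 0}"
    have C: "countable C"
      unfolding C_def using countable_jumps[OF p] countable_jumps[OF q] by simp
    have "\<exists>s. s \<in> {t<..<t + 1 / real (Suc m)} \<and> s \<notin> C" for m
      using open_minus_countable[OF C, of "{t<..<t + 1 / real (Suc m)}"] by auto
    then obtain s where s: "\<And>m. s m \<in> {t<..<t + 1 / real (Suc m)}" "\<And>m. s m \<notin> C"
      by metis
    have "(\<lambda>m. t + 1 / real (Suc m)) \<longlonglongrightarrow> t + 0"
      by (intro tendsto_intros LIMSEQ_Suc[OF lim_1_over_n])
    then have lim: "s \<longlonglongrightarrow> t"
      using s(1) by (intro tendsto_sandwich[OF _ _ tendsto_const[of t], of s])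
        (auto intro!: always_eventually less_imp_le simp del: of_nat_Suc)
    have "p (s m) = q (s m)" for m
    proof (rule LIMSEQ_unique)
      have "0 \<le> s m" using s(1)[of m] t by auto
      then show "(\<lambda>n. X n (s m)) \<longlonglongrightarrow> p (s m)" "(\<lambda>n. X n (s m)) \<longlonglongrightarrow> q (s m)"
        using tendsto_J1_continuity_point[OF assms(1) p] tendsto_J1_continuity_point[OF assms(2) q] s(2)[of m]
        by (auto simp: C_def)
    qed
    moreover have "\<forall>\<^sub>F m in sequentially. t \<le> s m"
      using s(1) by (auto intro!: always_eventually less_imp_le)
    ultimately show ?thesis
      using cadlag_seq_right[OF p lim] cadlag_seq_right[OF q lim] LIMSEQ_unique by auto
  qed
  show ?thesis
  proof
    fix t
    show "p t = q t"
      using eq[of t] eq[of 0] p q by (cases "0 \<le> t") (auto simp: cadlag_paths_def)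
  qed
qed

text \<open>One time change serves all matrix entries at once, so linear combinations of entries
  converge as well. This passes from the matrix [x] to the scalar paths
  \<open>v \<bullet> x\<close>.\<close>

lemma tendsto_J1_bounded_linear:
  assumes "bounded_linear h" "tendsto_J1 X q"
  shows "tendsto_J1 (\<lambda>n t. h (X n t)) (\<lambda>t. h (q t))"
  using assms(2) bounded_linear.uniform_limit[OF assms(1)] unfolding tendsto_J1_def by blast

lemma outer_product_mult:
  fixes d v :: "real^'m"
  shows "v \<bullet> ((\<chi> i j. d $ i * d $ j) *v v) = (v \<bullet> d)\<^sup>2"
proof -
  have "(\<chi> i j. d $ i * d $ j) *v v = (d \<bullet> v) *\<^sub>R d"
    by (simp add: vec_eq_iff matrix_vector_mult_def inner_vec_def sum_distrib_left sum_distrib_right mult_ac)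
  then show ?thesis
    by (simp add: power2_eq_square inner_commute)
qed

lemma bounded_linear_quadratic_form:
  fixes v :: "real^'m"
  shows "bounded_linear (\<lambda>M. v \<bullet> (M *v v))"
proof -
  have "linear (\<lambda>M. v \<bullet> (M *v v))"
    by (intro linearI) (simp_all add: matrix_vector_mult_add_rdistrib inner_add_right scaleR_matrix_vector_assoc[symmetric])
  then show ?thesis
    by (simp add: linear_conv_bounded_linear)
qed

section \<open>Directional measures and polarization\<close>

locale vector_qv = partitions \<pi> for \<pi> :: "nat \<Rightarrow> real list" +
  fixes x :: "real \<Rightarrow> real^'m" and q :: "real \<Rightarrow> real^'m^'m" and T :: real
  assumes x: "x \<in> cadlag_paths" and q: "q \<in> cadlag_paths"
    and J1: "tendsto_J1 (qv_approx \<pi> x) q" and T: "0 \<le> T"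
begin

lemma scalar: "scalar_qv_horizon \<pi> (\<lambda>t. v \<bullet> x t) (\<lambda>t. v \<bullet> (q t *v v)) T"
proof
  show "(\<lambda>t. v \<bullet> x t) \<in> cadlag_paths"
    by (rule cadlag_bounded_linear(1)[OF bounded_linear_inner_right x])
  show "(\<lambda>t. v \<bullet> (q t *v v)) \<in> cadlag_paths"
    by (rule cadlag_bounded_linear(1)[OF bounded_linear_quadratic_form q])
  have "v \<bullet> (qv_approx \<pi> x n t *v v) = (\<Sum>k\<in>cells n (max t 0).
      (v \<bullet> x (\<pi> n ! Suc k) - v \<bullet> x (\<pi> n ! k))\<^sup>2)" for n t
    unfolding qv_approx_def
    by (subst linear_sum[OF bounded_linear.linear[OF bounded_linear_quadratic_form[of v]]])
      (simp only: outer_product_mult inner_diff_right)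
  then show "tendsto_J1 (\<lambda>n t. \<Sum>k\<in>cells n (max t 0).
      (v \<bullet> x (\<pi> n ! Suc k) - v \<bullet> x (\<pi> n ! k))\<^sup>2) (\<lambda>t. v \<bullet> (q t *v v))"
    using tendsto_J1_bounded_linear[OF bounded_linear_quadratic_form J1, of v] by simp
qed (rule T)

lemma qv_eq: "qv \<pi> x = q"
  unfolding qv_def using q J1 by (intro the_equality) (auto intro: tendsto_J1_unique)

lemma q_symmetric: "0 \<le> t \<Longrightarrow> q t $ i $ j = q t $ j $ i"
proof -
  assume t: "0 \<le> t"
  obtain \<rho> where "\<forall>T\<ge>0. uniform_limit {0..T} (\<lambda>n s. qv_approx \<pi> x n (\<rho> n s)) q sequentially"
    using J1 unfolding tendsto_J1_def by blast
  then have "uniform_limit {0..t} (\<lambda>n s. qv_approx \<pi> x n (\<rho> n s)) q sequentially"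
    using t by simp
  then have lim: "(\<lambda>n. qv_approx \<pi> x n (\<rho> n t)) \<longlonglongrightarrow> q t"
    by (rule tendsto_uniform_limitI) (use t in simp)
  have "qv_approx \<pi> x n s $ i $ j = qv_approx \<pi> x n s $ j $ i" for n s
    by (simp add: qv_approx_def mult.commute)
  then have "(\<lambda>n. qv_approx \<pi> x n (\<rho> n t) $ i $ j) \<longlonglongrightarrow> q t $ j $ i"
    using tendsto_vec_nth[OF tendsto_vec_nth[OF lim, of j], of i] by simp
  with tendsto_vec_nth[OF tendsto_vec_nth[OF lim, of i], of j] show ?thesis
    by (rule LIMSEQ_unique)
qed

definition jumps :: "real set" where
  "jumps = {t. jump x t \<noteq> 0}"

lemma countable_jumps: "countable jumps"
  unfolding jumps_def by (rule countable_jumps[OF x])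

lemma jump_inner: "jump (\<lambda>t. v \<bullet> x t) t = v \<bullet> jump x t"
  by (rule cadlag_bounded_linear(3)[OF bounded_linear_inner_right x])

lemma jumps_inner: "{t. jump (\<lambda>t. v \<bullet> x t) t \<noteq> 0} \<subseteq> jumps"
  by (auto simp: jumps_def jump_inner)

definition qv_measure :: "real^'m \<Rightarrow> real measure" where
  "qv_measure v = scalar_qv_horizon.qv_measure (\<lambda>t. v \<bullet> (q t *v v)) T"

definition cont_measure :: "real^'m \<Rightarrow> real measure" where
  "cont_measure v = scalar_qv_horizon.cont_measure (\<lambda>t. v \<bullet> (q t *v v)) T jumps"

lemma finite_borel_measure_cont_measure: "finite_borel_measure (cont_measure v)"
  unfolding cont_measure_def
  by (rule scalar_qv_horizon.finite_borel_measure_cont_measure[OF scalar countable_jumps jumps_inner])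

lemma AE_cont_measure: "AE t in cont_measure v. t \<in> {0<..T} - jumps"
  unfolding cont_measure_def
  by (rule scalar_qv_horizon.AE_cont_measure[OF scalar countable_jumps jumps_inner])

lemma cdf_cont_measure:
  assumes "0 \<le> t" "t \<le> T"
  shows "(\<lambda>s. (v \<bullet> jump x s)\<^sup>2) summable_on {0..t}"
    and "cdf (cont_measure v) t = v \<bullet> (q t *v v) - (\<Sum>\<^sub>\<infinity>s\<in>{0..t}. (v \<bullet> jump x s)\<^sup>2)"
  using scalar_qv_horizon.cdf_cont_measure[OF scalar countable_jumps jumps_inner assms]
  by (simp_all add: cont_measure_def jump_inner)

lemma integral_qv_measure_split:
  fixes g :: "real \<Rightarrow> real"
  assumes "integrable (qv_measure v) g"
  shows "(\<lambda>s. g s * (v \<bullet> jump x s)\<^sup>2) summable_on {0..T}"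
    and "integrable (cont_measure v) g"
    and "(LINT t|qv_measure v. g t) =
      (LINT t|cont_measure v. g t) + (\<Sum>\<^sub>\<infinity>s\<in>{0..T}. g s * (v \<bullet> jump x s)\<^sup>2)"
  using scalar_qv_horizon.integral_qv_measure_split[OF scalar countable_jumps jumps_inner assms[unfolded qv_measure_def]]
  by (simp_all add: cont_measure_def jump_inner qv_measure_def)

lemma polarization:
  fixes d :: "real^'m"
  shows "(((axis a 1 + axis b 1) /\<^sub>R 2) \<bullet> d)\<^sup>2 - (((axis a 1 - axis b 1) /\<^sub>R 2) \<bullet> d)\<^sup>2 = d $ a * d $ b"
  by (simp add: inner_add_left inner_diff_left inner_axis' power2_eq_square field_simps)

text \<open>Quadratic forms see only the symmetric part of a matrix; \<open>q_symmetric\<close>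
  later turns the average into a single entry.\<close>

lemma polarization_matrix:
  fixes M :: "real^'m^'m"
  shows "((axis a 1 + axis b 1) /\<^sub>R 2) \<bullet> (M *v ((axis a 1 + axis b 1) /\<^sub>R 2)) -
    ((axis a 1 - axis b 1) /\<^sub>R 2) \<bullet> (M *v ((axis a 1 - axis b 1) /\<^sub>R 2)) = (M $ a $ b + M $ b $ a) / 2"
proof -
  have "axis i 1 \<bullet> (M *v axis j 1) = M $ i $ j" for i j
    by (simp add: inner_axis' matrix_vector_mul_component inner_axis)
  then show ?thesis
    by (simp add: matrix_vector_mult_scaleR matrix_vector_right_distrib matrix_vector_mult_diff_distrib
      inner_add_left inner_diff_left inner_add_right inner_diff_right field_simps)
qed

text \<open>The distribution functions of the continuous measures in the two polarizing directions
  serve as the nondecreasing u and v of the definition, so bounded variation needs no separate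
  argument.\<close>

lemma has_stieltjes_integral_qv_cont:
  fixes g :: "real \<Rightarrow> real" and a b :: 'm
  defines "v \<equiv> (axis a 1 + axis b 1) /\<^sub>R 2" and "w \<equiv> (axis a 1 - axis b 1) /\<^sub>R 2"
  assumes g: "integrable (cont_measure v) g" "integrable (cont_measure w) g"
  shows "has_stieltjes_integral g (qv_cont \<pi> x a b) T ((LINT t|cont_measure v. g t) - (LINT t|cont_measure w. g t))"
proof -
  interpret V: finite_borel_measure "cont_measure v"
    by (rule finite_borel_measure_cont_measure)
  interpret W: finite_borel_measure "cont_measure w"
    by (rule finite_borel_measure_cont_measure)
  have set: "set_integrable (cont_measure u) {0<..T} g \<and> (LINT t:{0<..T}|cont_measure u. g t) = (LINT t|cont_measure u. g t)"
    if int: "integrable (cont_measure u) g" for u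
  proof -
    interpret U: finite_borel_measure "cont_measure u"
      by (rule finite_borel_measure_cont_measure)
    have [measurable_cong]: "sets (cont_measure u) = sets borel"
      by (rule U.M_is_borel)
    have [measurable]: "g \<in> borel_measurable borel"
      using borel_measurable_integrable[OF int] by (simp cong: measurable_cong_sets)
    have "integrable (cont_measure u) (\<lambda>t. indicator {0<..T} t *\<^sub>R g t)"
      by (rule integrable_mult_indicator[OF _ int]) simp
    moreover have "(LINT t|cont_measure u. indicator {0<..T} t *\<^sub>R g t) = (LINT t|cont_measure u. g t)"
    proof (rule integral_cong_AE)
      show "AE t in cont_measure u. indicator {0<..T} t *\<^sub>R g t = g t"
        using AE_cont_measure by eventually_elim auto
    qed simp_all
    ultimately show ?thesis
      by (simp add: set_integrable_def set_lebesgue_integral_def)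
  qed
  show ?thesis
    unfolding has_stieltjes_integral_def
  proof (intro exI conjI ballI allI)
    show "mono (cdf (cont_measure v))" "mono (cdf (cont_measure w))"
      by (auto intro!: monoI V.cdf_nondecreasing W.cdf_nondecreasing)
    show "continuous (at_right s) (cdf (cont_measure v))" "continuous (at_right s) (cdf (cont_measure w))" for s
      by (rule V.cdf_is_right_cont W.cdf_is_right_cont)+
    show "set_integrable (interval_measure (cdf (cont_measure v))) {0<..T} g"
      "set_integrable (interval_measure (cdf (cont_measure w))) {0<..T} g"
      using set[OF g(1)] set[OF g(2)] by (simp_all add: V.interval_measure_cdf W.interval_measure_cdf)
    show "(LINT t|cont_measure v. g t) - (LINT t|cont_measure w. g t) =
      (LINT s:{0<..T}|interval_measure (cdf (cont_measure v)). g s) -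
      (LINT s:{0<..T}|interval_measure (cdf (cont_measure w)). g s)"
      using set[OF g(1)] set[OF g(2)] by (simp add: V.interval_measure_cdf W.interval_measure_cdf)
    fix s assume s: "s \<in> {0..T}"
    then have "0 \<le> s" "s \<le> T" by auto
    note V = cdf_cont_measure[OF this, of v] and W = cdf_cont_measure[OF this, of w]
    have "(\<Sum>\<^sub>\<infinity>r\<in>{0..s}. (v \<bullet> jump x r)\<^sup>2) - (\<Sum>\<^sub>\<infinity>r\<in>{0..s}. (w \<bullet> jump x r)\<^sup>2) =
        (\<Sum>\<^sub>\<infinity>r\<in>{0..s}. jump x r $ a * jump x r $ b)"
      using infsumI[OF has_sum_diff[OF has_sum_infsum[OF V(1)] has_sum_infsum[OF W(1)]]]
      unfolding v_def w_def polarization by (rule sym)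
    moreover have "v \<bullet> (q s *v v) - w \<bullet> (q s *v w) = q s $ a $ b"
      unfolding v_def w_def polarization_matrix using q_symmetric[OF \<open>0 \<le> s\<close>, of b a] by simp
    ultimately show "qv_cont \<pi> x a b s = cdf (cont_measure v) s - cdf (cont_measure w) s"
      unfolding qv_cont_def qv_eq V(2) W(2) by simp
  qed
qed

context
  fixes \<psi> :: "nat \<Rightarrow> nat \<Rightarrow> real" and g :: "real \<Rightarrow> real" and E :: "real set" and B :: real
  assumes E: "countable E"
    and bound: "\<forall>\<^sub>F n in sequentially. \<forall>k<length (\<pi> n) - 1. \<pi> n ! k \<le> T \<longrightarrow> \<bar>\<psi> n k\<bar> \<le> B"
    and off: "\<And>t k. 0 < t \<Longrightarrow> t \<le> T \<Longrightarrow> t \<notin> E \<Longrightarrow> jump x t = 0 \<Longrightarrow>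
      (\<forall>\<^sub>F n in sequentially. k n < length (\<pi> n) - 1 \<and> \<pi> n ! k n \<le> T) \<Longrightarrow>
      (\<lambda>n. \<pi> n ! k n) \<longlonglongrightarrow> t \<Longrightarrow> (\<lambda>n. \<psi> n (k n)) \<longlonglongrightarrow> g t"
    and atom: "\<And>t k. 0 < t \<Longrightarrow> t \<le> T \<Longrightarrow> jump x t \<noteq> 0 \<Longrightarrow>
      (\<forall>\<^sub>F n in sequentially. bracket \<pi> t n (k n)) \<Longrightarrow> (\<lambda>n. \<psi> n (k n)) \<longlonglongrightarrow> g t"
    and g: "g \<in> borel_measurable borel"
begin

lemma weighted_squares_tendsto:
  shows "integrable (qv_measure v) g"
    and "(\<lambda>n. \<Sum>k\<in>cells n T.
        \<psi> n k * (v \<bullet> (x (\<pi> n ! Suc k) - x (\<pi> n ! k)))\<^sup>2) \<longlonglongrightarrow> (LINT t|qv_measure v. g t)"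
proof -
  interpret S: scalar_qv_horizon \<pi> "\<lambda>t. v \<bullet> x t" "\<lambda>t. v \<bullet> (q t *v v)" T
    by (rule scalar)
  \<comment> \<open>At a time where x jumps but \<open>v \<bullet> x\<close> does not, convergence
    along arbitrary cells is not assumed. Such times are moved into the exceptional set.\<close>
  have E': "countable (E \<union> jumps)"
    using E countable_jumps by simp
  have off': "(\<lambda>n. \<psi> n (k n)) \<longlonglongrightarrow> g t" if "0 < t" "t \<le> T" "t \<notin> E \<union> jumps"
    "\<forall>\<^sub>F n in sequentially. k n < length (\<pi> n) - 1 \<and> \<pi> n ! k n \<le> T" "(\<lambda>n. \<pi> n ! k n) \<longlonglongrightarrow> t" for t k
    using that by (intro off) (auto simp: jumps_def)
  have atom': "(\<lambda>n. \<psi> n (k n)) \<longlonglongrightarrow> g t" if "0 < t" "t \<le> T" "jump (\<lambda>t. v \<bullet> x t) t \<noteq> 0"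
    "\<forall>\<^sub>F n in sequentially. bracket \<pi> t n (k n)" for t k
    using that jumps_inner[of v] by (intro atom) (auto simp: jumps_def)
  have *: "integrable S.qv_measure g" "(\<lambda>n. \<Sum>k\<in>cells n T. \<psi> n k * S.w n k)
      \<longlonglongrightarrow> (LINT t|S.qv_measure. g t)"
    by (rule S.weighted_increments_tendsto[OF E' bound off' atom' g]; assumption)+
  show "integrable (qv_measure v) g"
    using *(1) by (simp add: qv_measure_def)
  show "(\<lambda>n. \<Sum>k\<in>cells n T.
        \<psi> n k * (v \<bullet> (x (\<pi> n ! Suc k) - x (\<pi> n ! k)))\<^sup>2) \<longlonglongrightarrow> (LINT t|qv_measure v. g t)"
    using *(2) by (simp add: qv_measure_def S.w_def inner_diff_right)
qed

lemma weighted_products_tendsto: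
  fixes a b :: 'm
  shows "\<exists>I. has_stieltjes_integral g (qv_cont \<pi> x a b) T I \<and>
      (\<lambda>n. \<Sum>k\<in>cells n T. \<psi> n k *
        ((x (\<pi> n ! Suc k) - x (\<pi> n ! k)) $ a * (x (\<pi> n ! Suc k) - x (\<pi> n ! k)) $ b))
      \<longlonglongrightarrow> I + (\<Sum>\<^sub>\<infinity>s\<in>{0..T}. g s * (jump x s $ a * jump x s $ b))"
    and "(\<lambda>s. g s * (jump x s $ a * jump x s $ b)) summable_on {0..T}"
proof -
  define v w :: "real^'m" where "v = (axis a 1 + axis b 1) /\<^sub>R 2" and "w = (axis a 1 - axis b 1) /\<^sub>R 2"
  have polar: "d $ a * d $ b = (v \<bullet> d)\<^sup>2 - (w \<bullet> d)\<^sup>2" for d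
    unfolding v_def w_def by (rule polarization[symmetric])
  note V = integral_qv_measure_split[OF weighted_squares_tendsto(1)[of v]]
  note W = integral_qv_measure_split[OF weighted_squares_tendsto(1)[of w]]
  define I where "I = (LINT t|cont_measure v. g t) - (LINT t|cont_measure w. g t)"
  have I: "has_stieltjes_integral g (qv_cont \<pi> x a b) T I"
    unfolding I_def using V(2) W(2) unfolding v_def w_def by (rule has_stieltjes_integral_qv_cont)
  have sum: "((\<lambda>s. g s * (jump x s $ a * jump x s $ b)) has_sum
      ((\<Sum>\<^sub>\<infinity>s\<in>{0..T}. g s * (v \<bullet> jump x s)\<^sup>2) - (\<Sum>\<^sub>\<infinity>s\<in>{0..T}. g s * (w \<bullet> jump x s)\<^sup>2))) {0..T}"
    using has_sum_diff[OF has_sum_infsum[OF V(1)] has_sum_infsum[OF W(1)]]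
    by (simp add: polar right_diff_distrib)
  then show "(\<lambda>s. g s * (jump x s $ a * jump x s $ b)) summable_on {0..T}"
    by (rule has_sum_imp_summable)
  note infsumI[OF sum]
  then have eq: "(LINT t|qv_measure v. g t) - (LINT t|qv_measure w. g t) =
      I + (\<Sum>\<^sub>\<infinity>s\<in>{0..T}. g s * (jump x s $ a * jump x s $ b))"
    using V(3) W(3) by (simp add: I_def)
  from tendsto_diff[OF weighted_squares_tendsto(2)[of v] weighted_squares_tendsto(2)[of w]]
  have "(\<lambda>n. \<Sum>k\<in>cells n T. \<psi> n k *
        ((x (\<pi> n ! Suc k) - x (\<pi> n ! k)) $ a * (x (\<pi> n ! Suc k) - x (\<pi> n ! k)) $ b))
      \<longlonglongrightarrow> I + (\<Sum>\<^sub>\<infinity>s\<in>{0..T}. g s * (jump x s $ a * jump x s $ b))"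
    unfolding eq polar by (simp add: sum_subtractf[symmetric] right_diff_distrib)
  then show "\<exists>I. has_stieltjes_integral g (qv_cont \<pi> x a b) T I \<and>
      (\<lambda>n. \<Sum>k\<in>cells n T. \<psi> n k *
        ((x (\<pi> n ! Suc k) - x (\<pi> n ! k)) $ a * (x (\<pi> n ! Suc k) - x (\<pi> n ! k)) $ b))
      \<longlonglongrightarrow> I + (\<Sum>\<^sub>\<infinity>s\<in>{0..T}. g s * (jump x s $ a * jump x s $ b))"
    using I by blast
qed

text \<open>Summing over the coordinate directions. The continuous measures live off the jump times,
  where g vanishes, so only the atomic series survives. This is the form suited to the Taylor
  remainder.\<close>

lemma weighted_norms_tendsto:
  assumes g0: "\<And>t. jump x t = 0 \<Longrightarrow> g t = 0"
  shows "(\<lambda>n. \<Sum>k\<in>cells n T. \<psi> n k * (norm (x (\<pi> n ! Suc k) - x (\<pi> n ! k)))\<^sup>2)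
      \<longlonglongrightarrow> (\<Sum>\<^sub>\<infinity>s\<in>{0..T}. g s * (norm (jump x s))\<^sup>2)"
    and "(\<lambda>s. g s * (norm (jump x s))\<^sup>2) summable_on {0..T}"
proof -
  have norm: "(norm d)\<^sup>2 = (\<Sum>c\<in>UNIV. (axis c 1 \<bullet> d)\<^sup>2)" for d :: "real^'m"
  proof -
    have "(norm d)\<^sup>2 = (\<Sum>c\<in>UNIV. (d $ c)\<^sup>2)"
      unfolding power2_norm_eq_inner inner_vec_def by (simp add: power2_eq_square)
    then show ?thesis by (simp add: inner_axis')
  qed
  note split = integral_qv_measure_split[OF weighted_squares_tendsto(1)]
  have zero: "(LINT t|cont_measure v. g t) = 0" for v
  proof -
    have "AE t in cont_measure v. g t = 0"
      using AE_cont_measure by eventually_elim (simp add: jumps_def g0)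
    then show ?thesis by (rule integral_eq_zero_AE)
  qed
  have sum: "((\<lambda>s. g s * (norm (jump x s))\<^sup>2) has_sum
      (\<Sum>c\<in>UNIV. \<Sum>\<^sub>\<infinity>s\<in>{0..T}. g s * (axis c 1 \<bullet> jump x s)\<^sup>2)) {0..T}"
    unfolding norm sum_distrib_left by (intro has_sum_sum has_sum_infsum split(1))
  then show "(\<lambda>s. g s * (norm (jump x s))\<^sup>2) summable_on {0..T}"
    by (rule has_sum_imp_summable)
  have "(\<Sum>\<^sub>\<infinity>s\<in>{0..T}. g s * (norm (jump x s))\<^sup>2) =
      (\<Sum>c\<in>UNIV. \<Sum>\<^sub>\<infinity>s\<in>{0..T}. g s * (axis c 1 \<bullet> jump x s)\<^sup>2)"
    using sum by (rule infsumI)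
  also have "\<dots> = (\<Sum>c\<in>UNIV. LINT t|qv_measure (axis c 1). g t)"
    by (simp add: split(3) zero)
  finally have eq: "(\<Sum>\<^sub>\<infinity>s\<in>{0..T}. g s * (norm (jump x s))\<^sup>2) = (\<Sum>c\<in>UNIV. LINT t|qv_measure (axis c 1). g t)" .
  have "(\<lambda>n. \<Sum>c\<in>UNIV. \<Sum>k\<in>cells n T.
      \<psi> n k * (axis c 1 \<bullet> (x (\<pi> n ! Suc k) - x (\<pi> n ! k)))\<^sup>2) \<longlonglongrightarrow> (\<Sum>c\<in>UNIV. LINT t|qv_measure (axis c 1). g t)"
    by (intro tendsto_sum weighted_squares_tendsto(2))
  then show "(\<lambda>n. \<Sum>k\<in>cells n T. \<psi> n k * (norm (x (\<pi> n ! Suc k) - x (\<pi> n ! k)))\<^sup>2)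
      \<longlonglongrightarrow> (\<Sum>\<^sub>\<infinity>s\<in>{0..T}. g s * (norm (jump x s))\<^sup>2)"
    unfolding eq unfolding norm sum_distrib_left by (subst sum.swap)
qed

end

end

section \<open>Left-continuous limits along partitions\<close>

text \<open>If the estimate failed at all scales, points violating it could be chosen along a
  subsequence and completed to one admissible sequence tending to t, contradicting the
  limit.\<close>

lemma sequential_limit_uniform:
  fixes \<Psi> :: "nat \<Rightarrow> real \<Rightarrow> 'b::metric_space"
  assumes p: "\<And>n. p n \<in> S n" "p \<longlonglongrightarrow> t"
    and lim: "\<And>\<tau>. (\<And>n. \<tau> n \<in> S n) \<Longrightarrow> \<tau> \<longlonglongrightarrow> t \<Longrightarrow> (\<lambda>n. \<Psi> n (\<tau> n)) \<longlonglongrightarrow> L"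
    and \<epsilon>: "\<epsilon> > 0"
  shows "\<exists>\<eta>>0. \<exists>N. \<forall>n\<ge>N. \<forall>s\<in>S n. dist s t < \<eta> \<longrightarrow> dist (\<Psi> n s) L < \<epsilon>"
proof (rule ccontr)
  assume neg: "\<not> ?thesis"
  have bad: "\<exists>n s. N \<le> n \<and> s \<in> S n \<and> dist s t < \<eta> \<and> \<epsilon> \<le> dist (\<Psi> n s) L" if "\<eta> > 0" for \<eta> N
  proof -
    have "\<not> (\<forall>n\<ge>N. \<forall>s\<in>S n. dist s t < \<eta> \<longrightarrow> dist (\<Psi> n s) L < \<epsilon>)"
      using neg that by blast
    then show ?thesis by (auto simp: not_less)
  qed
  define Q where "Q m ns \<longleftrightarrow> snd ns \<in> S (fst ns) \<and> dist (snd ns) t < 1 / real (Suc m) \<and>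
    \<epsilon> \<le> dist (\<Psi> (fst ns) (snd ns)) L" for m and ns :: "nat \<times> real"
  have ex: "\<exists>ns. Q m ns \<and> N < fst ns" for m N
  proof -
    obtain n s where "Suc N \<le> n" "s \<in> S n" "dist s t < 1 / real (Suc m)" "\<epsilon> \<le> dist (\<Psi> n s) L"
      using bad[of "1 / real (Suc m)" "Suc N"] by auto
    then show ?thesis
      by (intro exI[of _ "(n, s)"]) (simp add: Q_def)
  qed
  have "\<exists>f. \<forall>m. Q m (f m) \<and> fst (f m) < fst (f (Suc m))"
  proof (rule dependent_nat_choice)
    show "\<exists>ns. Q 0 ns" using ex by blast
    show "\<exists>b. Q (Suc m) b \<and> fst a < fst b" for a m using ex .
  qed
  then obtain f where f: "\<And>m. Q m (f m)" "\<And>m. fst (f m) < fst (f (Suc m))"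
    by blast
  define r where "r m = fst (f m)" for m
  have r: "strict_mono r"
    using f(2) by (simp add: strict_mono_Suc_iff r_def)
  \<comment> \<open>The hypothesis speaks of full sequences that satisfy the constraint at every n;
    p fills the indices outside the subsequence.\<close>
  define \<tau> where "\<tau> n = (if n \<in> range r then snd (f (inv r n)) else p n)" for n
  have \<tau>r: "\<tau> (r m) = snd (f m)" for m
    using strict_mono_imp_inj_on[OF r] by (simp add: \<tau>_def)
  have "\<tau> n \<in> S n" for n
  proof (cases "n \<in> range r")
    case True
    then obtain m where "n = r m" by blast
    then show ?thesis using f(1)[of m] \<tau>r[of m] by (simp add: Q_def r_def)
  next
    case False
    then show ?thesis by (simp add: \<tau>_def p)
  qed
  moreover have "\<tau> \<longlonglongrightarrow> t"
  proof (rule tendstoI)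
    fix e :: real assume "e > 0"
    then obtain m0 where m0: "1 / real (Suc m0) < e"
      using reals_Archimedean by (auto simp: inverse_eq_divide simp del: of_nat_Suc)
    have "\<forall>\<^sub>F n in sequentially. dist (p n) t < e"
      using p(2) \<open>e > 0\<close> by (rule tendstoD)
    then show "\<forall>\<^sub>F n in sequentially. dist (\<tau> n) t < e"
      using eventually_ge_at_top[of "r m0"]
    proof eventually_elim
      case (elim n)
      show ?case
      proof (cases "n \<in> range r")
        case True
        then obtain m where m: "n = r m" by blast
        then have "m0 \<le> m" using elim r by (simp add: strict_mono_less_eq)
        then have "1 / real (Suc m) \<le> 1 / real (Suc m0)"
          by (simp add: frac_le)
        then show ?thesis
          using f(1)[of m] \<tau>r[of m] m m0 by (simp add: Q_def)
      next
        case False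
        then show ?thesis using elim by (simp add: \<tau>_def)
      qed
    qed
  qed
  ultimately have "(\<lambda>n. \<Psi> n (\<tau> n)) \<longlonglongrightarrow> L"
    by (rule lim)
  then have "(\<lambda>m. \<Psi> (r m) (\<tau> (r m))) \<longlonglongrightarrow> L"
    using LIMSEQ_subseq_LIMSEQ[OF _ r] by (simp add: o_def)
  from tendstoD[OF this \<epsilon>] have "\<forall>\<^sub>F m in sequentially. False"
  proof eventually_elim
    case (elim m)
    then show ?case using f(1)[of m] \<tau>r[of m] by (simp add: Q_def r_def)
  qed
  then show False by simp
qed

context partitions
begin

text \<open>One-sided control at t already makes \<open>\<Psi> n\<close> uniformly close to L t on a
  left neighbourhood of t. For u inside it this is two-sided control, and L u is itself close to L
  t. So the times that are bad for a given \<epsilon> are isolated from the left.\<close>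

lemma left_limits_imp_limits:
  fixes \<Psi> :: "nat \<Rightarrow> real \<Rightarrow> 'b::metric_space"
  assumes lim: "\<And>t \<tau>. 0 \<le> t \<Longrightarrow> (\<And>n. 0 \<le> \<tau> n \<and> \<tau> n \<le> prev_point \<pi> t n) \<Longrightarrow> \<tau> \<longlonglongrightarrow> t \<Longrightarrow>
    (\<lambda>n. \<Psi> n (\<tau> n)) \<longlonglongrightarrow> L t"
  shows "\<exists>E. countable E \<and> (\<forall>t>0. t \<notin> E \<longrightarrow>
    (\<forall>\<tau>. (\<forall>\<^sub>F n in sequentially. 0 \<le> \<tau> n) \<longrightarrow> \<tau> \<longlonglongrightarrow> t \<longrightarrow> (\<lambda>n. \<Psi> n (\<tau> n)) \<longlonglongrightarrow> L t))"
proof -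
  define good where "good \<epsilon> t \<longleftrightarrow> (\<exists>\<eta>>0. \<exists>N. \<forall>n\<ge>N. \<forall>s\<ge>0. dist s t < \<eta> \<longrightarrow> dist (\<Psi> n s) (L t) < \<epsilon>)" for \<epsilon> t
  define E where "E = (\<Union>m. {t. 0 < t \<and> \<not> good (1 / real (Suc m)) t})"
  have "countable {t. 0 < t \<and> \<not> good \<epsilon> t}" if "\<epsilon> > 0" for \<epsilon>
  proof (rule countable_left_isolated)
    fix t assume "t \<in> {t. 0 < t \<and> \<not> good \<epsilon> t}"
    then have t: "0 < t" by simp
    have "\<exists>\<eta>>0. \<exists>N. \<forall>n\<ge>N. \<forall>s\<in>{0..prev_point \<pi> t n}. dist s t < \<eta> \<longrightarrow> dist (\<Psi> n s) (L t) < \<epsilon> / 2"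
    proof (rule sequential_limit_uniform)
      show "prev_point \<pi> t n \<in> {0..prev_point \<pi> t n}" for n
        by (simp add: prev_point_nonneg)
      show "prev_point \<pi> t \<longlonglongrightarrow> t"
        using t by (intro prev_point_tendsto) simp
    qed (use lim[of t] t \<open>\<epsilon> > 0\<close> in auto)
    then obtain \<eta> N where \<eta>: "\<eta> > 0" and near: "\<forall>n\<ge>N. \<forall>s\<in>{0..prev_point \<pi> t n}.
        dist s t < \<eta> \<longrightarrow> dist (\<Psi> n s) (L t) < \<epsilon> / 2"
      by blast
    have "good \<epsilon> u" if u: "max 0 (t - \<eta>) < u" "u < t" for u
    proof -
      \<comment> \<open>Since t'_n tends to t, times up to c are eventually at most t'_n; hence
        points on both sides of u fall under the one-sided control at t.\<close>
      define c where "c = (u + t) / 2"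
      have c: "u < c" "c < t" using u by (auto simp: c_def)
      have "\<forall>\<^sub>F n in sequentially. c < prev_point \<pi> t n"
        by (rule order_tendstoD(1)[OF prev_point_tendsto]) (use t c in auto)
      then obtain N' where N': "\<And>n. n \<ge> N' \<Longrightarrow> c < prev_point \<pi> t n"
        unfolding eventually_sequentially by blast
      define \<eta>' where "\<eta>' = min (u - (t - \<eta>)) (c - u)"
      have "\<eta>' > 0" using u c by (simp add: \<eta>'_def)
      have near': "dist (\<Psi> n s) (L t) < \<epsilon> / 2" if "n \<ge> max N N'" "0 \<le> s" "dist s u < \<eta>'" for n s
        using that N'[of n] u c by (intro near[rule_format]) (auto simp: \<eta>'_def dist_real_def)
      have "(\<lambda>n. \<Psi> n (prev_point \<pi> u n)) \<longlonglongrightarrow> L u"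
        using u prev_point_nonneg by (intro lim prev_point_tendsto) auto
      then have "(\<lambda>n. dist (\<Psi> n (prev_point \<pi> u n)) (L t)) \<longlonglongrightarrow> dist (L u) (L t)"
        by (intro tendsto_intros)
      moreover have "\<forall>\<^sub>F n in sequentially. dist (\<Psi> n (prev_point \<pi> u n)) (L t) \<le> \<epsilon> / 2"
      proof -
        have "prev_point \<pi> u \<longlonglongrightarrow> u"
          using u by (intro prev_point_tendsto) auto
        from tendstoD[OF this \<open>\<eta>' > 0\<close>] eventually_ge_at_top[of "max N N'"] show ?thesis
          by eventually_elim (rule less_imp_le, rule near', auto intro: prev_point_nonneg)
      qed
      ultimately have Lu: "dist (L u) (L t) \<le> \<epsilon> / 2"
        by (intro tendsto_upperbound[of _ _ sequentially]) auto
      show ?thesis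
        unfolding good_def
      proof (intro exI conjI allI impI)
        fix n s assume "n \<ge> max N N'" "0 \<le> s" "dist s u < \<eta>'"
        then have "dist (\<Psi> n s) (L t) < \<epsilon> / 2" by (rule near')
        then show "dist (\<Psi> n s) (L u) < \<epsilon>"
          using Lu dist_triangle2[of "\<Psi> n s" "L u" "L t"] by linarith
      qed (rule \<open>\<eta>' > 0\<close>)
    qed
    then show "\<exists>\<eta>>0. {t - \<eta><..<t} \<inter> {t. 0 < t \<and> \<not> good \<epsilon> t} = {}"
      using \<eta> by (intro exI[of _ \<eta>]) auto
  qed
  then have E: "countable E"
    unfolding E_def by auto
  have "(\<lambda>n. \<Psi> n (\<tau> n)) \<longlonglongrightarrow> L t"
    if t: "0 < t" "t \<notin> E" and \<tau>: "\<forall>\<^sub>F n in sequentially. 0 \<le> \<tau> n" "\<tau> \<longlonglongrightarrow> t" for t \<tau>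
  proof (rule tendstoI)
    fix e :: real assume "e > 0"
    then obtain m where m: "1 / real (Suc m) < e"
      using reals_Archimedean by (auto simp: inverse_eq_divide simp del: of_nat_Suc)
    have "good (1 / real (Suc m)) t"
      using t by (auto simp: E_def)
    then obtain \<eta> N where \<eta>: "\<eta> > 0"
      "\<And>n s. n \<ge> N \<Longrightarrow> 0 \<le> s \<Longrightarrow> dist s t < \<eta> \<Longrightarrow> dist (\<Psi> n s) (L t) < 1 / real (Suc m)"
      unfolding good_def by blast
    from \<tau>(1) tendstoD[OF \<tau>(2) \<eta>(1)] eventually_ge_at_top[of N]
    show "\<forall>\<^sub>F n in sequentially. dist (\<Psi> n (\<tau> n)) (L t) < e"
      by eventually_elim (rule less_trans[OF \<eta>(2) m])
  qed
  then show ?thesis using E by blast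
qed

section \<open>Piecewise constant approximations\<close>

lemma pc_path_eq:
  assumes k: "k < length (\<pi> n) - 1" "\<pi> n ! k \<le> s" "s < \<pi> n ! Suc k"
  shows "pc_path \<pi> x n s = x (\<pi> n ! Suc k)"
proof -
  have "k < length (\<pi> n)" using k by linarith
  then have "0 \<le> s" using point_nonneg[of k n] k by simp
  have "indicat_real {\<pi> n ! i ..< \<pi> n ! Suc i} s = 0" if i: "i < length (\<pi> n) - 1" "i \<noteq> k" for i
  proof (cases "i < k")
    case True
    then have "\<pi> n ! Suc i \<le> \<pi> n ! k"
      using k by (intro point_le) auto
    then show ?thesis using k by simp
  next
    case False
    then have "\<pi> n ! Suc k \<le> \<pi> n ! i"
      using i by (intro point_le) auto
    then show ?thesis using k by simp
  qed
  then have "pc_path \<pi> x n s = (\<Sum>i<length (\<pi> n) - 1. if i = k then x (\<pi> n ! Suc k) else 0)"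
    unfolding pc_path_def using \<open>0 \<le> s\<close> k by (intro sum.cong) auto
  also have "\<dots> = x (\<pi> n ! Suc k)"
    using k by simp
  finally show ?thesis .
qed

lemma stop_pc_path:
  assumes k: "k < length (\<pi> n) - 1" "\<pi> n ! k \<le> t" "t < \<pi> n ! Suc k"
  shows "stop (pc_path \<pi> x n) t = stop (pc_path \<pi> x n) (\<pi> n ! k)"
proof
  fix r
  show "stop (pc_path \<pi> x n) t r = stop (pc_path \<pi> x n) (\<pi> n ! k) r"
  proof (cases "r \<le> \<pi> n ! k")
    case True
    then show ?thesis using k by (simp add: stop_def)
  next
    case False
    then have "\<pi> n ! k \<le> min r t" "min r t < \<pi> n ! Suc k" "\<pi> n ! k < \<pi> n ! Suc k"
      using k by auto
    then have "pc_path \<pi> x n (min r t) = x (\<pi> n ! Suc k)" "pc_path \<pi> x n (\<pi> n ! k) = x (\<pi> n ! Suc k)"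
      using pc_path_eq[OF k(1), of "min r t" x] pc_path_eq[OF k(1), of "\<pi> n ! k" x] by auto
    then show ?thesis using False by (simp add: stop_def)
  qed
qed

lemma left_lim_pc_path:
  assumes k: "k < length (\<pi> n) - 1" "\<pi> n ! k < t" "t \<le> \<pi> n ! Suc k"
  shows "left_lim (pc_path \<pi> x n) t = x (\<pi> n ! Suc k)"
proof (rule left_lim_eqI, rule tendsto_eventually)
  show "\<forall>\<^sub>F s in at_left t. pc_path \<pi> x n s = x (\<pi> n ! Suc k)"
    using eventually_at_left_real[OF k(2)]
    by eventually_elim (use k in \<open>auto intro!: pc_path_eq\<close>)
qed

lemma stop_left_pc_path:
  assumes k: "k < length (\<pi> n) - 1" "\<pi> n ! k < t" "t \<le> \<pi> n ! Suc k"
  shows "stop_left (pc_path \<pi> x n) t = stop (pc_path \<pi> x n) (\<pi> n ! k)"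
proof
  fix r
  have at: "pc_path \<pi> x n (\<pi> n ! k) = x (\<pi> n ! Suc k)"
    using k by (intro pc_path_eq) auto
  consider "r \<le> \<pi> n ! k" | "\<pi> n ! k < r" "r < t" | "t \<le> r" by linarith
  then show "stop_left (pc_path \<pi> x n) t r = stop (pc_path \<pi> x n) (\<pi> n ! k) r"
  proof cases
    case 1
    then show ?thesis using k by (simp add: stop_left_def stop_def)
  next
    case 2
    then have "pc_path \<pi> x n r = x (\<pi> n ! Suc k)"
      using k by (intro pc_path_eq) auto
    then show ?thesis using k 2 at by (simp add: stop_left_def stop_def)
  next
    case 3
    then show ?thesis using k at left_lim_pc_path[OF k] by (simp add: stop_left_def stop_def)
  qed
qed

lemma point_in_interval:
  assumes "0 \<le> t" "t < \<pi> n ! (length (\<pi> n) - 1)" "1 < length (\<pi> n)"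
  shows "\<exists>k. k < length (\<pi> n) - 1 \<and> \<pi> n ! k \<le> t \<and> t < \<pi> n ! Suc k"
proof -
  have "\<exists>j. t < \<pi> n ! j" using assms(2) by blast
  define j where "j = (LEAST j. t < \<pi> n ! j)"
  have j: "t < \<pi> n ! j"
    unfolding j_def using assms(2) by (rule LeastI)
  have jl: "j \<le> length (\<pi> n) - 1"
    unfolding j_def using assms(2) by (rule Least_le)
  have "j \<noteq> 0"
  proof
    assume "j = 0"
    then show False using j assms(1) by (simp add: point_0)
  qed
  then obtain k where k: "j = Suc k" by (cases j) auto
  have "\<not> t < \<pi> n ! k"
    using not_less_Least[of k "\<lambda>j. t < \<pi> n ! j"] k unfolding j_def by simp
  then show ?thesis
    using j jl k by (intro exI[of _ k]) auto
qed

lemma stop_pc_path_right_constant: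
  assumes "0 \<le> t" "t < \<pi> n ! (length (\<pi> n) - 1)" "1 < length (\<pi> n)"
  shows "\<forall>\<^sub>F s in at_right t. stop (pc_path \<pi> x n) s = stop (pc_path \<pi> x n) t"
proof -
  obtain k where k: "k < length (\<pi> n) - 1" "\<pi> n ! k \<le> t" "t < \<pi> n ! Suc k"
    using point_in_interval[OF assms] by blast
  from eventually_at_right_real[OF k(3)] show ?thesis
  proof eventually_elim
    case (elim s)
    then show ?case
      using stop_pc_path[OF k, of x] stop_pc_path[OF k(1), of s x] k by auto
  qed
qed

lemma stop_left_pc_path_no_point:
  assumes "0 < t" "t < \<pi> n ! (length (\<pi> n) - 1)" "1 < length (\<pi> n)" "t \<notin> set (\<pi> n)"
  shows "stop_left (pc_path \<pi> x n) t = stop (pc_path \<pi> x n) t"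
proof -
  obtain k where k: "k < length (\<pi> n) - 1" "\<pi> n ! k \<le> t" "t < \<pi> n ! Suc k"
    using point_in_interval[OF less_imp_le[OF assms(1)] assms(2,3)] by blast
  then have "\<pi> n ! k \<in> set (\<pi> n)" by (intro nth_mem) linarith
  then have "\<pi> n ! k < t" using assms(4) k by (auto simp: less_le)
  then show ?thesis
    using stop_pc_path[OF k, of x] stop_left_pc_path[OF k(1), of t x] k by simp
qed

text \<open>The approximation looks ahead: on a cell it takes the value of x at the right endpoint.
  Its jump at a left endpoint is therefore the increment of x over the cell that begins
  there.\<close>

lemma bump_pc_path:
  assumes k: "k < length (\<pi> n) - 1" "0 < k"
  shows "jump (pc_path \<pi> x n) (\<pi> n ! k) = x (\<pi> n ! Suc k) - x (\<pi> n ! k)"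
    and "bump (stop_left (pc_path \<pi> x n) (\<pi> n ! k)) (\<pi> n ! k) (x (\<pi> n ! Suc k) - x (\<pi> n ! k)) =
      stop (pc_path \<pi> x n) (\<pi> n ! k)"
proof -
  have less: "\<pi> n ! (k - 1) < \<pi> n ! k" "\<pi> n ! k < \<pi> n ! Suc k" "0 < \<pi> n ! k"
    using k point_less[of "k - 1" k n] point_less[of k "Suc k" n] point_less[of 0 k n] by (auto simp: point_0)
  then have l: "left_lim (pc_path \<pi> x n) (\<pi> n ! k) = x (\<pi> n ! k)"
    using left_lim_pc_path[of "k - 1" n "\<pi> n ! k" x] k less_imp_diff_less[OF k(1), of 1] by simp
  have r: "pc_path \<pi> x n (\<pi> n ! k) = x (\<pi> n ! Suc k)"
    using k less by (intro pc_path_eq) auto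
  show "jump (pc_path \<pi> x n) (\<pi> n ! k) = x (\<pi> n ! Suc k) - x (\<pi> n ! k)"
    by (simp add: jump_def l r)
  show "bump (stop_left (pc_path \<pi> x n) (\<pi> n ! k)) (\<pi> n ! k) (x (\<pi> n ! Suc k) - x (\<pi> n ! k)) =
      stop (pc_path \<pi> x n) (\<pi> n ! k)"
    using less by (auto simp: bump_def stop_left_def stop_def l r min_def max_def)
qed

text \<open>Neither 0 nor the last partition point lies in \<open>{0<..T}\<close>. Index 0 is kept
  with the value 0, so that the index set matches that of the pathwise sums.\<close>

lemma sum_partition_points:
  fixes f :: "real \<Rightarrow> real"
  assumes "T < \<pi> n ! (length (\<pi> n) - 1)"
  shows "(\<Sum>p\<in>set (\<pi> n) \<inter> {0<..T}. f p) = (\<Sum>k\<in>cells n T. if k = 0 then 0 else f (\<pi> n ! k))"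
proof -
  define K where "K = {k. k < length (\<pi> n) - 1 \<and> \<pi> n ! k \<le> T \<and> k \<noteq> 0}"
  have inj: "inj_on (\<lambda>k. \<pi> n ! k) K"
  proof (rule inj_onI)
    fix i j assume ij: "i \<in> K" "j \<in> K" "\<pi> n ! i = \<pi> n ! j"
    then have "i < length (\<pi> n)" "j < length (\<pi> n)" by (auto simp: K_def)
    then show "i = j"
      using point_less[of i j n] point_less[of j i n] ij(3) by (cases i j rule: linorder_cases) auto
  qed
  have img: "set (\<pi> n) \<inter> {0<..T} = (\<lambda>k. \<pi> n ! k) ` K"
  proof safe
    fix p assume p: "p \<in> set (\<pi> n)" "p \<in> {0<..T}"
    then obtain k where k: "k < length (\<pi> n)" "p = \<pi> n ! k"
      by (auto simp: in_set_conv_nth)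
    have "k \<noteq> length (\<pi> n) - 1" using k p assms by auto
    moreover have "k \<noteq> 0" using k p by (metis greaterThanAtMost_iff less_irrefl point_0)
    ultimately show "p \<in> (\<lambda>k. \<pi> n ! k) ` K"
      using k p by (auto simp: K_def)
  next
    fix k assume k: "k \<in> K"
    then have "k < length (\<pi> n)" by (auto simp: K_def)
    then show "\<pi> n ! k \<in> set (\<pi> n)" by simp
    show "\<pi> n ! k \<in> {0<..T}"
      using k point_less[of 0 k n] \<open>k < length (\<pi> n)\<close> by (auto simp: K_def point_0)
  qed
  have "(\<Sum>p\<in>set (\<pi> n) \<inter> {0<..T}. f p) = (\<Sum>k\<in>K. f (\<pi> n ! k))"
    unfolding img using inj by (simp add: sum.reindex)
  also have "\<dots> = (\<Sum>k\<in>K. if k = 0 then 0 else f (\<pi> n ! k))"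
    by (intro sum.cong) (auto simp: K_def)
  also have "\<dots> = (\<Sum>k\<in>cells n T. if k = 0 then 0 else f (\<pi> n ! k))"
    by (intro sum.mono_neutral_left) (auto simp: K_def)
  finally show ?thesis .
qed

end

section \<open>Functionals\<close>

lemma at_left_Ico: "(0::real) < t \<Longrightarrow> at t within {0..<t} = at_left t"
  by (rule at_within_nhd[of t "{0<..}"]) auto

text \<open>The dimension enters because each coordinate of the inner product is bounded
  separately.\<close>

lemma matrix_quadratic_bound:
  fixes M :: "real^'m^'m"
  shows "\<bar>d \<bullet> (M *v d)\<bar> \<le> real CARD('m) * norm M * (norm d)\<^sup>2"
proof -
  have "\<bar>d $ i * (M *v d) $ i\<bar> \<le> norm M * (norm d)\<^sup>2" for i
  proof -
    have "\<bar>(M *v d) $ i\<bar> \<le> norm M * norm d"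
    proof -
      have "(M *v d) $ i = M $ i \<bullet> d"
        by (simp add: matrix_vector_mul_component)
      also have "\<bar>\<dots>\<bar> \<le> norm (M $ i) * norm d"
        by (rule Cauchy_Schwarz_ineq2)
      also have "\<dots> \<le> norm M * norm d"
        by (intro mult_right_mono Finite_Cartesian_Product.norm_nth_le) simp
      finally show ?thesis .
    qed
    then have "\<bar>d $ i\<bar> * \<bar>(M *v d) $ i\<bar> \<le> norm d * (norm M * norm d)"
      by (intro mult_mono component_le_norm_cart) auto
    then show ?thesis
      by (simp add: abs_mult power2_eq_square mult_ac)
  qed
  then have "(\<Sum>i\<in>UNIV. \<bar>d $ i * (M *v d) $ i\<bar>) \<le> (\<Sum>i\<in>(UNIV::'m set). norm M * (norm d)\<^sup>2)"
    by (intro sum_mono)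
  with sum_abs have "\<bar>\<Sum>i\<in>UNIV. d $ i * (M *v d) $ i\<bar> \<le> (\<Sum>i\<in>(UNIV::'m set). norm M * (norm d)\<^sup>2)"
    by (rule order_trans)
  then show ?thesis
    by (simp add: inner_vec_def mult.assoc)
qed

lemma quadratic_form_expand:
  fixes M :: "real^'m^'m"
  shows "d \<bullet> (M *v d) = (\<Sum>a\<in>UNIV. \<Sum>b\<in>UNIV. M $ a $ b * (d $ a * d $ b))"
  by (simp add: inner_vec_def matrix_vector_mult_def sum_distrib_left mult_ac)

locale ito = partitions \<pi> for \<pi> :: "nat \<Rightarrow> real list" +
  fixes \<Omega> :: "(real \<Rightarrow> real^'m) set" and U :: "real \<Rightarrow> (real \<Rightarrow> real^'m) \<Rightarrow> (real^'m) set"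
    and F :: "real \<Rightarrow> (real \<Rightarrow> real^'m) \<Rightarrow> real" and x :: "real \<Rightarrow> real^'m" and T :: real
  assumes generic: "generic \<pi> \<Omega>" and adm: "admissible_nhds \<Omega> U"
    and x\<Omega>: "x \<in> \<Omega>" and xqv: "x \<in> qv_paths \<pi>" and T: "0 \<le> T" and C12: "F \<in> C12 \<pi> \<Omega> U"
begin

abbreviation y :: "nat \<Rightarrow> real \<Rightarrow> real^'m" where
  "y n \<equiv> pc_path \<pi> x n"

abbreviation D :: "nat \<Rightarrow> nat \<Rightarrow> real^'m" where
  "D n k \<equiv> x (\<pi> n ! Suc k) - x (\<pi> n ! k)"

lemma cadlag: "z \<in> \<Omega> \<Longrightarrow> z \<in> cadlag_paths"
  using generic by (auto simp: generic_def)

lemma stop_in: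
  assumes "z \<in> \<Omega>" "0 \<le> t"
  shows "stop z t \<in> \<Omega>"
proof -
  have "\<forall>z\<in>\<Omega>. \<forall>t\<ge>0. \<exists>V. convex V \<and> 0 \<in> interior V \<and> - jump z t \<in> V \<and> (\<forall>e\<in>V. bump (stop z t) t e \<in> \<Omega>)"
    using generic unfolding generic_def by (elim conjE)
  from this[rule_format, OF assms] obtain V where "0 \<in> interior V" "\<forall>e\<in>V. bump (stop z t) t e \<in> \<Omega>"
    by (elim exE conjE)
  then have "bump (stop z t) t 0 \<in> \<Omega>"
    using interior_subset by (meson subsetD)
  then show ?thesis by simp
qed

lemma
  shows left: "left_continuous_functional \<pi> \<Omega> F" and right: "right_continuous_functional \<pi> \<Omega> F"
    and right_DF: "right_continuous_functional \<pi> \<Omega> (horizontal_deriv F)"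
    and bounded_DF: "locally_bounded_functional \<pi> \<Omega> (horizontal_deriv F)"
    and left_grad: "left_continuous_functional \<pi> \<Omega> (minus_functional (vertical_grad F))"
    and left_hess: "left_continuous_functional \<pi> \<Omega> (minus_functional (vertical_hess F))"
    and bounded_hess: "locally_bounded_functional \<pi> \<Omega> (minus_functional (vertical_hess F))"
    and modulus: "vertical_modulus \<pi> \<Omega> U (vertical_hess F)"
  using C12 by (auto simp: C12_def)

lemma differentiable:
  assumes "z \<in> \<Omega>" "0 \<le> t" "stop z t = z"
  shows "horizontal_differentiable F t z" "vertical_differentiable F t z"
    "vertical_twice_differentiable F t z"
proof -
  have "(t, z) \<in> stopped_domain \<Omega>"
    unfolding stopped_domain_def using assms by (metis (mono_tags, lifting) mem_Collect_eq)
  then show "horizontal_differentiable F t z" "vertical_differentiable F t z"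
    "vertical_twice_differentiable F t z"
    using C12 unfolding C12_def by blast+
qed

lemma horizontal_deriv_tendsto:
  assumes "z \<in> \<Omega>" "0 \<le> t" "stop z t = z"
  shows "((\<lambda>h. (F (t + h) z - F t z) / h) \<longlongrightarrow> horizontal_deriv F t z) (at_right 0)"
  using differentiable(1)[OF assms] unfolding horizontal_differentiable_def horizontal_deriv_def
  by (auto simp: tendsto_Lim)

section \<open>Vertical derivatives and Taylor expansion\<close>

lemma vertical_grad_derivative:
  assumes "z \<in> \<Omega>" "0 \<le> t" "stop z t = z"
  shows "((\<lambda>e. F t (bump z t e)) has_derivative (\<lambda>h. h \<bullet> vertical_grad F t z)) (at 0)"
proof -
  obtain g where g: "GDERIV (\<lambda>e. F t (bump z t e)) 0 :> g"
    using differentiable(2)[OF assms] unfolding vertical_differentiable_def by blast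
  have "vertical_grad F t z = g"
    unfolding vertical_grad_def
  proof (rule the_equality, rule g)
    fix g' assume "GDERIV (\<lambda>e. F t (bump z t e)) 0 :> g'"
    then have "(\<lambda>h. h \<bullet> g') = (\<lambda>h. h \<bullet> g)"
      using g unfolding gderiv_def by (rule has_derivative_unique)
    then show "g' = g"
      by (simp add: fun_eq_iff vector_eq_ldot)
  qed
  then show ?thesis using g by (simp add: gderiv_def)
qed

lemma vertical_hess_derivative:
  assumes "z \<in> \<Omega>" "0 \<le> t" "stop z t = z"
  shows "((\<lambda>e. vertical_grad F t (bump z t e)) has_derivative (\<lambda>h. vertical_hess F t z *v h)) (at 0)"
proof -
  obtain H where H: "((\<lambda>e. vertical_grad F t (bump z t e)) has_derivative (\<lambda>e. H *v e)) (at 0)"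
    using differentiable(3)[OF assms] unfolding vertical_twice_differentiable_def by blast
  have "vertical_hess F t z = H"
    unfolding vertical_hess_def
  proof (rule the_equality, rule H)
    fix H' assume "((\<lambda>e. vertical_grad F t (bump z t e)) has_derivative (\<lambda>e. H' *v e)) (at 0)"
    then have "(\<lambda>e. H' *v e) = (\<lambda>e. H *v e)"
      using H by (rule has_derivative_unique)
    then show "H' = H"
      by (simp add: matrix_eq fun_eq_iff)
  qed
  then show ?thesis using H by simp
qed

text \<open>Taylor expansion of a real function along the segment of bumps. The remainder is a
  difference of Hessians, the quantity that the modulus of vertical continuity controls.\<close>

lemma vertical_taylor:
  assumes t: "0 \<le> t"
    and seg: "\<And>s. s \<in> {0..1} \<Longrightarrow> bump z t (s *\<^sub>R d) \<in> \<Omega>"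
      "\<And>s. stop (bump z t (s *\<^sub>R d)) t = bump z t (s *\<^sub>R d)"
  shows "\<exists>\<theta>. 0 < \<theta> \<and> \<theta> < 1 \<and> F t (bump z t d) - F t z - vertical_grad F t z \<bullet> d
      - 1/2 * (d \<bullet> (vertical_hess F t z *v d)) =
    1/2 * (d \<bullet> ((vertical_hess F t (bump z t (\<theta> *\<^sub>R d)) - vertical_hess F t z) *v d))"
proof -
  define \<zeta> where "\<zeta> s = bump z t (s *\<^sub>R d)" for s
  define diff where "diff m s = (if m = 0 then F t (\<zeta> s) else if m = 1 then vertical_grad F t (\<zeta> s) \<bullet> d
    else d \<bullet> (vertical_hess F t (\<zeta> s) *v d))" for m :: nat and s
  \<comment> \<open>Vertical derivatives are taken at bump size 0; since bumps add up, recentring at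
    \<open>\<zeta> s\<close> turns them into derivatives along the segment at s.\<close>
  have shift: "bump (\<zeta> s) t ((r - s) *\<^sub>R d) = \<zeta> r" for r s
    by (simp add: \<zeta>_def bump_bump scaleR_add_left[symmetric])
  have inner: "((\<lambda>r. (r - s) *\<^sub>R d) has_derivative (\<lambda>h. h *\<^sub>R d)) (at s)" for s :: real
    by (auto intro!: derivative_eq_intros)
  have zero: "(s - s) *\<^sub>R d = 0" for s :: real by simp
  have d0: "(diff 0 has_real_derivative diff 1 s) (at s)" if "s \<in> {0..1}" for s
  proof -
    have "((\<lambda>e. F t (bump (\<zeta> s) t e)) has_derivative (\<lambda>h. h \<bullet> vertical_grad F t (\<zeta> s))) (at ((s - s) *\<^sub>R d))"
      unfolding zero by (rule vertical_grad_derivative) (use seg that t in \<open>auto simp: \<zeta>_def\<close>)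
    from has_derivative_compose[OF inner this]
    have "((\<lambda>r. F t (\<zeta> r)) has_derivative (\<lambda>h. h * (vertical_grad F t (\<zeta> s) \<bullet> d))) (at s)"
      by (simp add: shift inner_commute)
    then show ?thesis
      by (simp add: has_field_derivative_def diff_def[abs_def] mult.commute[of "vertical_grad F t (\<zeta> s) \<bullet> d"] mult_commute_abs)
  qed
  have d1: "(diff 1 has_real_derivative diff 2 s) (at s)" if "s \<in> {0..1}" for s
  proof -
    have "((\<lambda>e. vertical_grad F t (bump (\<zeta> s) t e)) has_derivative (\<lambda>h. vertical_hess F t (\<zeta> s) *v h)) (at ((s - s) *\<^sub>R d))"
      unfolding zero by (rule vertical_hess_derivative) (use seg that t in \<open>auto simp: \<zeta>_def\<close>)
    from has_derivative_compose[OF inner this]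
    have "((\<lambda>r. vertical_grad F t (\<zeta> r)) has_derivative (\<lambda>h. vertical_hess F t (\<zeta> s) *v (h *\<^sub>R d))) (at s)"
      by (simp add: shift)
    from has_derivative_inner_left[OF this, of d]
    have "((\<lambda>r. vertical_grad F t (\<zeta> r) \<bullet> d) has_derivative (\<lambda>h. h * (d \<bullet> (vertical_hess F t (\<zeta> s) *v d)))) (at s)"
      by (simp add: matrix_vector_mult_scaleR inner_commute)
    then show ?thesis
      by (simp add: has_field_derivative_def diff_def[abs_def] mult_commute_abs)
  qed
  have "\<exists>\<theta>::real. 0 < \<theta> \<and> \<theta> < 1 \<and>
    (\<lambda>s. F t (\<zeta> s)) 1 = (\<Sum>m<2. diff m 0 / fact m * 1 ^ m) + diff 2 \<theta> / fact 2 * 1 ^ 2"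
  proof (rule Maclaurin)
    show "\<forall>m s. m < 2 \<and> 0 \<le> s \<and> s \<le> 1 \<longrightarrow> (diff m has_real_derivative diff (Suc m) s) (at s)"
    proof (intro allI impI)
      fix m :: nat and s :: real assume "m < 2 \<and> 0 \<le> s \<and> s \<le> 1"
      then consider "m = 0" "s \<in> {0..1}" | "m = 1" "s \<in> {0..1}" by fastforce
      then show "(diff m has_real_derivative diff (Suc m) s) (at s)"
        using d0 d1 by cases (auto simp: numeral_2_eq_2)
    qed
  qed (auto simp: diff_def)
  then obtain \<theta> where \<theta>: "0 < \<theta>" "\<theta> < 1"
    "F t (\<zeta> 1) = diff 0 0 + diff 1 0 + diff 2 \<theta> / 2"
    by (auto simp: numeral_2_eq_2)
  then show ?thesis
    by (intro exI[of _ \<theta>]) (simp add: diff_def \<zeta>_def matrix_vector_mult_diff_rdistrib inner_diff_right)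
qed

subsection \<open>Limits along the approximations\<close>

lemma limit_right:
  fixes G :: "('m, 'b::real_normed_vector) functional"
  assumes "right_continuous_functional \<pi> \<Omega> G" "0 \<le> t" "\<And>n. 0 \<le> \<tau> n" "\<And>n. prev_point \<pi> t n \<le> \<tau> n" "\<tau> \<longlonglongrightarrow> t"
  shows "(\<lambda>n. G (\<tau> n) (stop (y n) (\<tau> n))) \<longlonglongrightarrow> G t (stop x t)"
proof -
  have "\<forall>\<tau>. (\<forall>n. 0 \<le> \<tau> n \<and> prev_point \<pi> t n \<le> \<tau> n) \<and> \<tau> \<longlonglongrightarrow> t \<longrightarrow>
      (\<lambda>n. G (\<tau> n) (stop (y n) (\<tau> n))) \<longlonglongrightarrow> G t (stop x t)"
    using bspec[OF assms(1)[unfolded right_continuous_functional_def] x\<Omega>, THEN spec, THEN mp, OF assms(2)]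
    by (elim conjE)
  then show ?thesis using assms(3-5) by simp
qed

lemma limit_left:
  fixes G :: "('m, 'b::real_normed_vector) functional"
  assumes "left_continuous_functional \<pi> \<Omega> G" "0 \<le> t" "\<And>n. 0 \<le> \<tau> n" "\<And>n. \<tau> n \<le> prev_point \<pi> t n" "\<tau> \<longlonglongrightarrow> t"
  shows "(\<lambda>n. G (\<tau> n) (stop_left (y n) (\<tau> n))) \<longlonglongrightarrow> G t (stop_left x t)"
proof -
  have "\<forall>\<tau>. (\<forall>n. 0 \<le> \<tau> n \<and> \<tau> n \<le> prev_point \<pi> t n) \<and> \<tau> \<longlonglongrightarrow> t \<longrightarrow>
      (\<lambda>n. G (\<tau> n) (stop_left (y n) (\<tau> n))) \<longlonglongrightarrow> G t (stop_left x t)"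
    using bspec[OF assms(1)[unfolded left_continuous_functional_def] x\<Omega>, THEN spec, THEN mp, OF assms(2)]
    by (elim conjE)
  then show ?thesis using assms(3-5) by simp
qed

lemma right_continuous_at:
  fixes G :: "('m, 'b::real_normed_vector) functional"
  assumes "right_continuous_functional \<pi> \<Omega> G" "z \<in> \<Omega>" "0 \<le> t"
  shows "((\<lambda>s. G s (stop z s)) \<longlongrightarrow> G t (stop z t)) (at_right t)"
  using bspec[OF assms(1)[unfolded right_continuous_functional_def at_within_Ici_at_right] assms(2),
      THEN spec, THEN mp, OF assms(3)]
  by (elim conjE)

lemma left_limit_at:
  fixes G :: "('m, 'b::real_normed_vector) functional"
  assumes "left_continuous_functional \<pi> \<Omega> G" "z \<in> \<Omega>" "0 < t"
  shows "((\<lambda>s. G s (stop z s)) \<longlongrightarrow> G t (stop_left z t)) (at_left t)"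
  using bspec[OF assms(1)[unfolded left_continuous_functional_def] assms(2),
      THEN spec, THEN mp, OF less_imp_le[OF assms(3)]]
  unfolding at_left_Ico[OF assms(3)] by (elim conjE)

lemma left_continuous_at:
  fixes G :: "('m, 'b::real_normed_vector) functional"
  assumes "left_continuous_functional \<pi> \<Omega> G" "z \<in> \<Omega>" "0 < t"
  shows "((\<lambda>s. G s (stop_left z s)) \<longlongrightarrow> G t (stop_left z t)) (at_left t)"
proof -
  have "((\<lambda>s. G s (stop_left z s)) \<longlongrightarrow> G t (stop_left z t)) (at t within {0..t})"
    using bspec[OF assms(1)[unfolded left_continuous_functional_def] assms(2),
        THEN spec, THEN mp, OF less_imp_le[OF assms(3)]]
    by (elim conjE)
  then show ?thesis
    using assms(3) by (simp add: at_within_Icc_at_left)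
qed

lemma minus_at [simp]: "minus_functional G t (stop_left z t) = G t (stop_left z t)"
  by (simp add: minus_functional_def)

lemma minus_stop [simp]: "minus_functional G t (stop z t) = G t (stop_left z t)"
  by (simp add: minus_functional_def stop_left_stop)

subsection \<open>The horizontal increments\<close>

text \<open>The horizon is T + 1 because generic sets provide stopped approximations for positive
  horizons, while T = 0 is allowed.\<close>

definition regular :: "nat \<Rightarrow> bool" where
  "regular n \<longleftrightarrow> stop (y n) (T + 1) \<in> \<Omega> \<and> 1 < length (\<pi> n) \<and> T + 1 < \<pi> n ! (length (\<pi> n) - 1)"

lemma eventually_regular: "\<forall>\<^sub>F n in sequentially. regular n"
proof -
  have "T + 1 > 0" using T by simp
  moreover have "\<forall>x\<in>\<Omega>. \<forall>T>0. \<exists>N. \<forall>n\<ge>N. stop (pc_path \<pi> x n) T \<in> \<Omega>"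
    using generic unfolding generic_def by (elim conjE)
  ultimately have "\<exists>N. \<forall>n\<ge>N. stop (y n) (T + 1) \<in> \<Omega>"
    using x\<Omega> by simp
  then have "\<forall>\<^sub>F n in sequentially. stop (y n) (T + 1) \<in> \<Omega>"
    by (simp add: eventually_sequentially)
  with last_point[of "T + 1"] show ?thesis
    by eventually_elim (auto simp: regular_def)
qed

lemma regular_stop: "regular n \<Longrightarrow> 0 \<le> t \<Longrightarrow> t \<le> T + 1 \<Longrightarrow> stop (y n) t \<in> \<Omega>"
  using stop_in[of "stop (y n) (T + 1)" t] by (simp add: regular_def stop_stop)

lemma measurable_DF:
  assumes "z \<in> \<Omega>"
  shows "(\<lambda>t. indicator {0..S} t * horizontal_deriv F t (stop z t)) \<in> borel_measurable borel"
proof -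
  have "(\<lambda>t. indicator {0..} t * horizontal_deriv F t (stop z t)) \<in> borel_measurable borel"
    using right_continuous_at[OF right_DF assms] by (rule borel_measurable_right_continuous)
  then have "(\<lambda>t. indicator {..S} t * (indicator {0..} t * horizontal_deriv F t (stop z t))) \<in> borel_measurable borel"
    by measurable
  also have "(\<lambda>t. indicator {..S} t * (indicator {0..} t * horizontal_deriv F t (stop z t))) =
      (\<lambda>t. indicator {0..S} t * horizontal_deriv F t (stop z t))"
    by (auto simp: indicator_def)
  finally show ?thesis .
qed

lemma DF_bound: "\<exists>B. \<forall>\<^sub>F n in sequentially. \<forall>t\<in>{0..T}. \<bar>horizontal_deriv F t (stop (y n) t)\<bar> \<le> B"
  using bspec[OF bounded_DF[unfolded locally_bounded_functional_def] x\<Omega>, THEN spec, THEN mp, OF T]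
  unfolding eventually_sequentially real_norm_def by (elim exE conjE) (intro exI)

lemma hess_bound: "\<exists>B. \<forall>\<^sub>F n in sequentially. \<forall>t\<in>{0..T}. norm (vertical_hess F t (stop_left (y n) t)) \<le> B"
  using bspec[OF bounded_hess[unfolded locally_bounded_functional_def] x\<Omega>, THEN spec, THEN mp, OF T]
  unfolding eventually_sequentially minus_stop by (elim exE conjE) (intro exI)

lemma measurable_DF_approx:
  assumes "regular n"
  shows "(\<lambda>t. indicator {0..T} t * horizontal_deriv F t (stop (y n) t)) \<in> borel_measurable borel"
proof -
  have "stop (y n) (T + 1) \<in> \<Omega>" using assms by (simp add: regular_def)
  from measurable_DF[OF this, of T]
  show ?thesis
    by (rule measurable_cong[THEN iffD1, rotated]) (auto simp: stop_stop indicator_def)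
qed

lemma DF_integral_limit:
  shows "set_integrable lborel {0..T} (\<lambda>t. horizontal_deriv F t (stop x t))"
    and "(\<lambda>n. LINT t:{0..T}|lborel. horizontal_deriv F t (stop (y n) t)) \<longlonglongrightarrow>
      (LINT t:{0..T}|lborel. horizontal_deriv F t (stop x t))"
proof -
  obtain B where "\<forall>\<^sub>F n in sequentially. \<forall>t\<in>{0..T}. \<bar>horizontal_deriv F t (stop (y n) t)\<bar> \<le> B"
    using DF_bound by blast
  with eventually_regular have "\<forall>\<^sub>F n in sequentially. regular n \<and> (\<forall>t\<in>{0..T}. \<bar>horizontal_deriv F t (stop (y n) t)\<bar> \<le> B)"
    by eventually_elim auto
  then obtain N where N: "\<And>n. n \<ge> N \<Longrightarrow> regular n"
      "\<And>n t. n \<ge> N \<Longrightarrow> t \<in> {0..T} \<Longrightarrow> \<bar>horizontal_deriv F t (stop (y n) t)\<bar> \<le> B"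
    unfolding eventually_sequentially by blast
  define g where "g n t = indicator {0..T} t * horizontal_deriv F t (stop (y n) t)" for n t
  define h where "h t = indicator {0..T} t * horizontal_deriv F t (stop x t)" for t
  have lim: "(\<lambda>n. g n t) \<longlonglongrightarrow> h t" for t
  proof (cases "t \<in> {0..T}")
    case True
    \<comment> \<open>The constant sequence t is admissible for right-continuity, because t'_n is at
      most t.\<close>
    then have "(\<lambda>n. horizontal_deriv F t (stop (y n) t)) \<longlonglongrightarrow> horizontal_deriv F t (stop x t)"
      by (intro limit_right[OF right_DF, of t "\<lambda>_. t"]) (auto intro: prev_point_le)
    then show ?thesis
      unfolding g_def h_def by (intro tendsto_intros)
  qed (simp add: g_def h_def)
  have hm: "h \<in> borel_measurable lborel"
    using measurable_DF[OF x\<Omega>, of T] by (simp add: h_def[abs_def])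
  have gm: "g (n + N) \<in> borel_measurable lborel" for n
    using measurable_DF_approx[OF N(1), of "n + N"] by (simp add: g_def[abs_def])
  have dom: "AE t in lborel. norm (g (n + N) t) \<le> \<bar>B\<bar> * indicator {0..T} t" for n
    using N(2)[of "n + N"] by (auto simp: g_def indicator_def intro!: AE_I2 order_trans[OF _ abs_ge_self])
  have domi: "integrable lborel (\<lambda>t. \<bar>B\<bar> * indicator {0..T} t)"
    using T by simp
  have AE: "AE t in lborel. (\<lambda>n. g (n + N) t) \<longlonglongrightarrow> h t"
    using lim by (intro AE_I2 LIMSEQ_ignore_initial_segment)
  show "set_integrable lborel {0..T} (\<lambda>t. horizontal_deriv F t (stop x t))"
    using integrable_dominated_convergence[OF hm gm domi AE dom] by (simp add: set_integrable_def h_def[abs_def])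
  have "(\<lambda>n. LINT t|lborel. g (n + N) t) \<longlonglongrightarrow> (LINT t|lborel. h t)"
    by (rule integral_dominated_convergence[OF hm gm domi AE dom])
  then have "(\<lambda>n. LINT t|lborel. g n t) \<longlonglongrightarrow> (LINT t|lborel. h t)"
    by (rule LIMSEQ_offset)
  then show "(\<lambda>n. LINT t:{0..T}|lborel. horizontal_deriv F t (stop (y n) t)) \<longlonglongrightarrow>
      (LINT t:{0..T}|lborel. horizontal_deriv F t (stop x t))"
    by (simp add: set_lebesgue_integral_def g_def h_def)
qed

lemma telescope:
  "\<forall>\<^sub>F n in sequentially. F T (stop (y n) T) - F 0 (stop (y n) 0) =
    (LINT t:{0..T}|lborel. horizontal_deriv F t (stop (y n) t)) +
    (\<Sum>k\<in>cells n T. if k = 0 then 0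
      else F (\<pi> n ! k) (stop (y n) (\<pi> n ! k)) - F (\<pi> n ! k) (stop_left (y n) (\<pi> n ! k)))"
proof -
  obtain B where "\<forall>\<^sub>F n in sequentially. \<forall>t\<in>{0..T}. \<bar>horizontal_deriv F t (stop (y n) t)\<bar> \<le> B"
    using DF_bound by blast
  with eventually_regular show ?thesis
  proof eventually_elim
    case (elim n)
    \<comment> \<open>The path \<open>y n\<close> itself need not lie in \<Omega>, but its stopped
      version does and agrees with it on all times up to T.\<close>
    define Y where "Y = stop (y n) (T + 1)"
    have Y: "Y \<in> \<Omega>" using elim by (simp add: regular_def Y_def)
    have len: "1 < length (\<pi> n)" "T < \<pi> n ! (length (\<pi> n) - 1)"
      using elim by (auto simp: regular_def)
    have stop: "stop Y t = stop (y n) t" "stop_left Y t = stop_left (y n) t" if "t \<le> T" for t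
      using that by (auto simp: Y_def stop_stop stop_left_stop)
    have "F T (stop Y T) - F 0 (stop Y 0) = (LINT t:{0..T}|lborel. horizontal_deriv F t (stop Y t)) +
      (\<Sum>p\<in>set (\<pi> n) \<inter> {0<..T}. F p (stop Y p) - F p (stop_left Y p))"
    proof (rule ftc_right_derivative_jumps[OF T])
      fix t assume t: "0 \<le> t" "t < T"
      show "((\<lambda>t. F t (stop Y t)) \<longlongrightarrow> F t (stop Y t)) (at_right t)"
        using right_continuous_at[OF right Y t(1)] .
      show "((\<lambda>t. horizontal_deriv F t (stop Y t)) \<longlongrightarrow> horizontal_deriv F t (stop Y t)) (at_right t)"
        using right_continuous_at[OF right_DF Y t(1)] .
      have "\<forall>\<^sub>F s in at_right t. stop (y n) s = stop (y n) t"
        using t len by (intro stop_pc_path_right_constant) auto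
      moreover have "\<forall>\<^sub>F s in at_right t. s \<in> {t<..<T}"
        using t(2) by (rule eventually_at_right_real)
      ultimately have "\<forall>\<^sub>F s in at_right t. stop Y s = stop Y t"
        by eventually_elim (use t in \<open>simp add: stop\<close>)
      then have "\<forall>\<^sub>F h in at_right 0. stop Y (t + h) = stop Y t"
        unfolding at_right_to_0[of t] eventually_filtermap by (simp add: add.commute)
      then have ev: "\<forall>\<^sub>F h in at_right 0. (F (t + h) (stop Y t) - F t (stop Y t)) / h =
          (F (t + h) (stop Y (t + h)) - F t (stop Y t)) / h"
        by eventually_elim simp
      have lim: "((\<lambda>h. (F (t + h) (stop Y t) - F t (stop Y t)) / h) \<longlongrightarrow> horizontal_deriv F t (stop Y t)) (at_right 0)"
        by (rule horizontal_deriv_tendsto[OF stop_in[OF Y t(1)] t(1)]) (simp add: stop_stop)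
      show "((\<lambda>h. (F (t + h) (stop Y (t + h)) - F t (stop Y t)) / h) \<longlongrightarrow> horizontal_deriv F t (stop Y t)) (at_right 0)"
        by (rule Lim_transform_eventually[OF lim ev])
    next
      fix t assume t: "0 < t" "t \<le> T"
      show "((\<lambda>t. F t (stop Y t)) \<longlongrightarrow> F t (stop_left Y t)) (at_left t)"
        using left_limit_at[OF left Y t(1)] .
      assume "t \<notin> set (\<pi> n)"
      then have "stop_left (y n) t = stop (y n) t"
        using t len by (intro stop_left_pc_path_no_point) auto
      then show "F t (stop_left Y t) = F t (stop Y t)"
        using t by (simp add: stop)
    next
      have "integrable lborel (\<lambda>t. indicator {0..T} t *\<^sub>R horizontal_deriv F t (stop Y t))"
      proof (rule Bochner_Integration.integrable_bound)
        show "integrable lborel (\<lambda>t. \<bar>B\<bar> * indicator {0..T} t)"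
          using T by simp
        show "(\<lambda>t. indicator {0..T} t *\<^sub>R horizontal_deriv F t (stop Y t)) \<in> borel_measurable lborel"
          using measurable_DF[OF Y, of T] by simp
        show "AE t in lborel. norm (indicator {0..T} t *\<^sub>R horizontal_deriv F t (stop Y t)) \<le> norm (\<bar>B\<bar> * indicator {0..T} t)"
          using elim by (auto simp: indicator_def stop intro!: AE_I2 order_trans[OF _ abs_ge_self])
      qed
      then show "set_integrable lborel {0..T} (\<lambda>t. horizontal_deriv F t (stop Y t))"
        by (simp add: set_integrable_def)
    qed simp
    moreover have "(LINT t:{0..T}|lborel. horizontal_deriv F t (stop Y t)) =
        (LINT t:{0..T}|lborel. horizontal_deriv F t (stop (y n) t))"
      by (intro set_lebesgue_integral_cong) (auto simp: stop)
    moreover have "(\<Sum>p\<in>set (\<pi> n) \<inter> {0<..T}. F p (stop Y p) - F p (stop_left Y p)) =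
        (\<Sum>p\<in>set (\<pi> n) \<inter> {0<..T}. F p (stop (y n) p) - F p (stop_left (y n) p))"
      by (intro sum.cong) (auto simp: stop)
    ultimately show ?case
      using T by (simp only: stop sum_partition_points[OF len(2)] stop[OF order_refl])
  qed
qed

end

text \<open>The integral ignores time 0, so an integrand may be altered there to make it
  measurable.\<close>

lemma has_stieltjes_integral_cong:
  assumes "\<And>t. t \<in> {0<..T} \<Longrightarrow> f t = f' t" "has_stieltjes_integral f g T I"
  shows "has_stieltjes_integral f' g T I"
proof -
  have "(\<lambda>t. indicator {0<..T} t *\<^sub>R f' t) = (\<lambda>t. indicator {0<..T} t *\<^sub>R f t)"
    using assms(1) by (auto simp: indicator_def)
  then show ?thesis
    using assms(2) unfolding has_stieltjes_integral_def set_integrable_def set_lebesgue_integral_def by simp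
qed

context ito
begin

abbreviation grad_left :: "nat \<Rightarrow> nat \<Rightarrow> real^'m" where
  "grad_left n k \<equiv> vertical_grad F (\<pi> n ! k) (stop_left (y n) (\<pi> n ! k))"

abbreviation hess_left :: "nat \<Rightarrow> nat \<Rightarrow> real^'m^'m" where
  "hess_left n k \<equiv> vertical_hess F (\<pi> n ! k) (stop_left (y n) (\<pi> n ! k))"

abbreviation hess_limit :: "real \<Rightarrow> real^'m^'m" where
  "hess_limit t \<equiv> vertical_hess F t (stop_left x t)"

text \<open>The time t'_n satisfies both the constraint for left-stopped paths in left-continuity
  and the one for stopped paths in right-continuity. Together with
  \<open>bracket_limit_right\<close> this makes the increment of F at the bracketing cell converge
  to the jump of F at t.\<close>

lemma bracket_limit_left:
  fixes G :: "('m, 'b::real_normed_vector) functional"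
  assumes G: "left_continuous_functional \<pi> \<Omega> G" and t: "0 < t"
    and k: "\<forall>\<^sub>F n in sequentially. bracket \<pi> t n (k n)"
  shows "(\<lambda>n. G (\<pi> n ! k n) (stop_left (y n) (\<pi> n ! k n))) \<longlonglongrightarrow> G t (stop_left x t)"
proof (rule Lim_transform_eventually)
  show "(\<lambda>n. G (prev_point \<pi> t n) (stop_left (y n) (prev_point \<pi> t n))) \<longlonglongrightarrow> G t (stop_left x t)"
    using t by (intro limit_left[OF G]) (auto intro: prev_point_nonneg prev_point_tendsto)
  show "\<forall>\<^sub>F n in sequentially. G (prev_point \<pi> t n) (stop_left (y n) (prev_point \<pi> t n)) =
      G (\<pi> n ! k n) (stop_left (y n) (\<pi> n ! k n))"
    using k by eventually_elim (simp add: bracket_prev)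
qed

lemma bracket_limit_right:
  fixes G :: "('m, 'b::real_normed_vector) functional"
  assumes G: "right_continuous_functional \<pi> \<Omega> G" and t: "0 < t"
    and k: "\<forall>\<^sub>F n in sequentially. bracket \<pi> t n (k n)"
  shows "(\<lambda>n. G (\<pi> n ! k n) (stop (y n) (\<pi> n ! k n))) \<longlonglongrightarrow> G t (stop x t)"
proof (rule Lim_transform_eventually)
  show "(\<lambda>n. G (prev_point \<pi> t n) (stop (y n) (prev_point \<pi> t n))) \<longlonglongrightarrow> G t (stop x t)"
    using t by (intro limit_right[OF G]) (auto intro: prev_point_nonneg prev_point_tendsto)
  show "\<forall>\<^sub>F n in sequentially. G (prev_point \<pi> t n) (stop (y n) (prev_point \<pi> t n)) =
      G (\<pi> n ! k n) (stop (y n) (\<pi> n ! k n))"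
    using k by eventually_elim (simp add: bracket_prev)
qed

lemma hess_limits:
  "\<exists>E. countable E \<and> (\<forall>t>0. t \<notin> E \<longrightarrow> (\<forall>\<tau>. (\<forall>\<^sub>F n in sequentially. 0 \<le> \<tau> n) \<longrightarrow> \<tau> \<longlonglongrightarrow> t \<longrightarrow>
    (\<lambda>n. vertical_hess F (\<tau> n) (stop_left (y n) (\<tau> n))) \<longlonglongrightarrow> hess_limit t))"
proof (rule left_limits_imp_limits)
  fix t and \<tau> :: "nat \<Rightarrow> real"
  assume *: "0 \<le> t" "\<And>n. 0 \<le> \<tau> n \<and> \<tau> n \<le> prev_point \<pi> t n" "\<tau> \<longlonglongrightarrow> t"
  have "(\<lambda>n. minus_functional (vertical_hess F) (\<tau> n) (stop_left (y n) (\<tau> n))) \<longlonglongrightarrow>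
      minus_functional (vertical_hess F) t (stop_left x t)"
    by (rule limit_left[OF left_hess]) (use * in auto)
  then show "(\<lambda>n. vertical_hess F (\<tau> n) (stop_left (y n) (\<tau> n))) \<longlonglongrightarrow> hess_limit t"
    by simp
qed

lemma measurable_hess:
  "(\<lambda>t. indicator {0<..} t * hess_limit t $ a $ b) \<in> borel_measurable borel"
proof (rule borel_measurable_left_continuous)
  fix t :: real assume "0 < t"
  from left_continuous_at[OF left_hess x\<Omega> this]
  have "((\<lambda>s. hess_limit s) \<longlongrightarrow> hess_limit t) (at_left t)"
    by simp
  then show "((\<lambda>s. hess_limit s $ a $ b) \<longlongrightarrow> hess_limit t $ a $ b) (at_left t)"
    by (intro tendsto_vec_nth)
qed

lemma x_cadlag: "x \<in> cadlag_paths"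
  using cadlag[OF x\<Omega>] .

lemma vector_qv_ex: "\<exists>q. vector_qv \<pi> x q T"
proof -
  obtain q where "q \<in> cadlag_paths" "tendsto_J1 (qv_approx \<pi> x) q"
    using xqv by (auto simp: qv_paths_def)
  then have "vector_qv \<pi> x q T"
    using x_cadlag T by unfold_locales
  then show ?thesis by (rule exI[of _ q])
qed

subsection \<open>The second-order term\<close>

lemma hess_sums_tendsto:
  fixes a b :: 'm
  shows "\<exists>I. has_stieltjes_integral (\<lambda>t. hess_limit t $ a $ b) (qv_cont \<pi> x a b) T I \<and>
      (\<lambda>n. \<Sum>k\<in>cells n T. hess_left n k $ a $ b * (D n k $ a * D n k $ b))
      \<longlonglongrightarrow> I + (\<Sum>\<^sub>\<infinity>s\<in>{0..T}. hess_limit s $ a $ b * (jump x s $ a * jump x s $ b))"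
    and "(\<lambda>s. hess_limit s $ a $ b * (jump x s $ a * jump x s $ b)) summable_on {0..T}"
proof -
  obtain q where "vector_qv \<pi> x q T" using vector_qv_ex ..
  then interpret Q: vector_qv \<pi> x q T .
  obtain E where E: "countable E" and E': "\<And>t \<tau>. 0 < t \<Longrightarrow> t \<notin> E \<Longrightarrow> \<forall>\<^sub>F n in sequentially. 0 \<le> \<tau> n \<Longrightarrow>
      \<tau> \<longlonglongrightarrow> t \<Longrightarrow> (\<lambda>n. vertical_hess F (\<tau> n) (stop_left (y n) (\<tau> n))) \<longlonglongrightarrow> hess_limit t"
    using hess_limits by blast
  obtain B where B: "\<forall>\<^sub>F n in sequentially. \<forall>t\<in>{0..T}. norm (vertical_hess F t (stop_left (y n) t)) \<le> B"
    using hess_bound ..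
  \<comment> \<open>Left-continuity yields measurability on positive times only. Cutting off time 0
    changes neither the integral over (0,T] nor the series, as x has no jump at 0.\<close>
  define g where "g t = indicator {0<..} t * hess_limit t $ a $ b" for t :: real
  have gm: "g \<in> borel_measurable borel"
    using measurable_hess[of a b] by (simp add: g_def[abs_def])
  have bound: "\<forall>\<^sub>F n in sequentially. \<forall>k<length (\<pi> n) - 1. \<pi> n ! k \<le> T \<longrightarrow> \<bar>hess_left n k $ a $ b\<bar> \<le> B"
    using B
  proof eventually_elim
    case (elim n)
    show ?case
    proof (intro allI impI)
      fix k assume k: "k < length (\<pi> n) - 1" "\<pi> n ! k \<le> T"
      then have "k < length (\<pi> n)" by linarith
      then have "norm (hess_left n k) \<le> B"
        using elim k point_nonneg[of k n] by auto
      moreover have "\<bar>hess_left n k $ a $ b\<bar> \<le> norm (hess_left n k)"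
        by (metis component_le_norm_cart Finite_Cartesian_Product.norm_nth_le order_trans)
      ultimately show "\<bar>hess_left n k $ a $ b\<bar> \<le> B" by simp
    qed
  qed
  have off: "(\<lambda>n. hess_left n (k n) $ a $ b) \<longlonglongrightarrow> g t"
    if "0 < t" "t \<le> T" "t \<notin> E" "jump x t = 0"
      "\<forall>\<^sub>F n in sequentially. k n < length (\<pi> n) - 1 \<and> \<pi> n ! k n \<le> T" "(\<lambda>n. \<pi> n ! k n) \<longlonglongrightarrow> t" for t k
  proof -
    have "\<forall>\<^sub>F n in sequentially. 0 \<le> \<pi> n ! k n"
      using that(5) by eventually_elim (auto intro!: point_nonneg)
    from E'[OF that(1,3) this that(6)] show ?thesis
      using that(1) by (simp add: g_def tendsto_vec_nth)
  qed
  have atom: "(\<lambda>n. hess_left n (k n) $ a $ b) \<longlonglongrightarrow> g t"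
    if "0 < t" "t \<le> T" "jump x t \<noteq> 0" "\<forall>\<^sub>F n in sequentially. bracket \<pi> t n (k n)" for t k
    using bracket_limit_left[OF left_hess that(1,4)] that(1) by (simp add: g_def tendsto_vec_nth)
  have g_jump: "g s * (jump x s $ a * jump x s $ b) = hess_limit s $ a $ b * (jump x s $ a * jump x s $ b)"
    if "s \<in> {0..T}" for s
    using that jump_nonpos[OF x_cadlag, of s] by (cases "s = 0") (auto simp: g_def)
  have sum: "(\<Sum>\<^sub>\<infinity>s\<in>{0..T}. g s * (jump x s $ a * jump x s $ b)) =
      (\<Sum>\<^sub>\<infinity>s\<in>{0..T}. hess_limit s $ a $ b * (jump x s $ a * jump x s $ b))"
    by (rule infsum_cong) (rule g_jump)
  obtain I where I: "has_stieltjes_integral g (qv_cont \<pi> x a b) T I"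
    "(\<lambda>n. \<Sum>k\<in>cells n T. hess_left n k $ a $ b * (D n k $ a * D n k $ b))
      \<longlonglongrightarrow> I + (\<Sum>\<^sub>\<infinity>s\<in>{0..T}. g s * (jump x s $ a * jump x s $ b))"
    using Q.weighted_products_tendsto(1)[of E "\<lambda>n k. hess_left n k $ a $ b", OF E bound off atom gm]
    by blast
  have "has_stieltjes_integral (\<lambda>t. hess_limit t $ a $ b) (qv_cont \<pi> x a b) T I"
    using I(1) by (rule has_stieltjes_integral_cong[rotated]) (simp add: g_def)
  then show "\<exists>I. has_stieltjes_integral (\<lambda>t. hess_limit t $ a $ b) (qv_cont \<pi> x a b) T I \<and>
      (\<lambda>n. \<Sum>k\<in>cells n T. hess_left n k $ a $ b * (D n k $ a * D n k $ b))
      \<longlonglongrightarrow> I + (\<Sum>\<^sub>\<infinity>s\<in>{0..T}. hess_limit s $ a $ b * (jump x s $ a * jump x s $ b))"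
    using I(2) unfolding sum by blast
  have "(\<lambda>s. g s * (jump x s $ a * jump x s $ b)) summable_on {0..T}"
    by (rule Q.weighted_products_tendsto(2)[of E "\<lambda>n k. hess_left n k $ a $ b", OF E bound off atom gm])
  then show "(\<lambda>s. hess_limit s $ a $ b * (jump x s $ a * jump x s $ b)) summable_on {0..T}"
    using summable_on_cong[of "{0..T}", OF g_jump] by simp
qed

subsection \<open>The remainder\<close>

text \<open>\<open>x\<^sup>n\<close> does not jump at 0, because \<open>x\<^sup>n(0-) = x\<^sup>n(0)\<close>. The summand \<open>k = 0\<close> of the pathwise sums
  is therefore not matched by an increment of \<open>F\<close>, and is treated as a boundary term.\<close>

definition R :: "nat \<Rightarrow> nat \<Rightarrow> real" where
  "R n k = (if k = 0 then 0 else
     F (\<pi> n ! k) (stop (y n) (\<pi> n ! k)) - F (\<pi> n ! k) (stop_left (y n) (\<pi> n ! k))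
     - grad_left n k \<bullet> D n k - 1/2 * (D n k \<bullet> (hess_left n k *v D n k)))"

definition R_limit :: "real \<Rightarrow> real" where
  "R_limit t = F t (stop x t) - F t (stop_left x t) - vertical_grad F t (stop_left x t) \<bullet> jump x t
     - 1/2 * (jump x t \<bullet> (hess_limit t *v jump x t))"

lemma increment_bound:
  "\<exists>r>0. \<forall>\<^sub>F n in sequentially. \<forall>k<length (\<pi> n) - 1. \<pi> n ! k \<le> T \<longrightarrow> norm (D n k) \<le> r"
proof -
  obtain B where B: "\<And>s. s \<le> T + 1 \<Longrightarrow> norm (x s) \<le> B"
    using cadlag_bounded[OF x_cadlag, of "T + 1"] by blast
  have "0 \<le> B" using B[of 0] T order_trans[OF norm_ge_zero] by fastforce
  \<comment> \<open>Mesh below 1 keeps right endpoints before T + 1, where B applies. The summand 1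
    in the bound makes the radius positive even if B = 0.\<close>
  have "\<forall>\<^sub>F n in sequentially. \<forall>k<length (\<pi> n) - 1. \<pi> n ! k \<le> T \<longrightarrow> norm (D n k) \<le> 2 * B + 1"
    using mesh[of 1 T, OF zero_less_one]
  proof eventually_elim
    case (elim n)
    show ?case
    proof (intro allI impI)
      fix k assume k: "k < length (\<pi> n) - 1" "\<pi> n ! k \<le> T"
      then have "norm (x (\<pi> n ! Suc k)) \<le> B" "norm (x (\<pi> n ! k)) \<le> B"
        using elim by (force intro: B)+
      then show "norm (D n k) \<le> 2 * B + 1"
        using norm_triangle_ineq4[of "x (\<pi> n ! Suc k)" "x (\<pi> n ! k)"] by linarith
    qed
  qed
  then show ?thesis
    using \<open>0 \<le> B\<close> by (intro exI[of _ "2 * B + 1"]) auto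
qed

text \<open>The admissible neighbourhood is convex and contains 0 and the jump of the approximation,
  so the whole segment stays in \<Omega>. The intermediate point is shorter than the increment, and
  monotonicity of \<omega> removes it from the bound.\<close>

lemma R_taylor:
  assumes n: "regular n" and k: "k < length (\<pi> n) - 1" "\<pi> n ! k \<le> T" "k \<noteq> 0"
    and r: "norm (D n k) \<le> r"
    and \<omega>: "mono_on {0..} \<omega>"
    and mod: "\<And>a b. a \<in> U (\<pi> n ! k) (stop (y n) (\<pi> n ! k)) \<inter> cball 0 r \<Longrightarrow>
      b \<in> U (\<pi> n ! k) (stop (y n) (\<pi> n ! k)) \<inter> cball 0 r \<Longrightarrow>
      norm (vertical_hess F (\<pi> n ! k) (bump (stop_left (y n) (\<pi> n ! k)) (\<pi> n ! k) a) -
        vertical_hess F (\<pi> n ! k) (bump (stop_left (y n) (\<pi> n ! k)) (\<pi> n ! k) b)) \<le> \<omega> (norm (a - b))"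
  shows "\<bar>R n k\<bar> \<le> real CARD('m) * \<omega> (norm (D n k)) * (norm (D n k))\<^sup>2"
proof -
  define t where "t = \<pi> n ! k"
  define z where "z = stop_left (y n) t"
  define V where "V = U t (stop (y n) t)"
  have "k < length (\<pi> n)" using k by linarith
  then have t: "0 \<le> t" "t \<le> T + 1"
    using k point_nonneg[of k n] by (auto simp: t_def)
  have S: "stop (y n) t \<in> \<Omega>"
    using n t by (rule regular_stop)
  \<comment> \<open>The neighbourhood is attached to the stopped path; its jump and left limit at t
    are those of \<open>y n\<close>.\<close>
  have "left_lim (stop (y n) t) t = left_lim (y n) t"
    by (rule left_lim_cong) (simp add: stop_def)
  then have "jump (stop (y n) t) t = D n k"
    using bump_pc_path(1)[of k n x] k by (simp add: jump_def stop_def t_def)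
  moreover have "stop_left (stop (y n) t) t = z"
    by (simp add: stop_left_stop z_def)
  ultimately have V: "convex V" "0 \<in> V" "D n k \<in> V" "\<And>e. e \<in> V \<Longrightarrow> bump z t e \<in> \<Omega>"
    using bspec[OF adm[unfolded admissible_nhds_def] S, THEN spec, THEN mp, OF t(1)] interior_subset
    unfolding V_def by auto
  have seg: "s *\<^sub>R D n k \<in> V" if "s \<in> {0..1}" for s
    using convexD[OF V(1) V(2) V(3), of "1 - s" s] that by simp
  obtain \<theta> where \<theta>: "0 < \<theta>" "\<theta> < 1"
    "F t (bump z t (D n k)) - F t z - vertical_grad F t z \<bullet> D n k
      - 1/2 * (D n k \<bullet> (vertical_hess F t z *v D n k)) =
     1/2 * (D n k \<bullet> ((vertical_hess F t (bump z t (\<theta> *\<^sub>R D n k)) - vertical_hess F t z) *v D n k))"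
    using vertical_taylor[OF t(1), of z "D n k"] V(4)[OF seg] stop_bump_stop_left[OF t(1), of "y n"]
    unfolding z_def by blast
  define M where "M = vertical_hess F t (bump z t (\<theta> *\<^sub>R D n k)) - vertical_hess F t z"
  have "bump z t (D n k) = stop (y n) t"
    unfolding z_def t_def using bump_pc_path(2)[of k n x] k by simp
  then have R: "R n k = 1/2 * (D n k \<bullet> (M *v D n k))"
    using \<theta>(3) k by (simp add: R_def M_def t_def z_def)
  have le: "norm (\<theta> *\<^sub>R D n k) \<le> norm (D n k)"
    using \<theta> by (simp add: mult_left_le_one_le)
  then have "\<theta> *\<^sub>R D n k \<in> V \<inter> cball 0 r" "0 \<in> V \<inter> cball 0 r"
    using \<theta> r seg[of \<theta>] V(2) norm_ge_zero[of "D n k"] by (auto simp del: norm_scaleR norm_ge_zero)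
  from mod[folded t_def, folded z_def V_def, OF this]
  have "norm M \<le> \<omega> (norm (\<theta> *\<^sub>R D n k))"
    by (simp add: M_def)
  also have "\<dots> \<le> \<omega> (norm (D n k))"
    using \<omega> le by (auto intro: mono_onD simp del: norm_scaleR)
  finally have M: "norm M \<le> \<omega> (norm (D n k))" .
  have "\<bar>R n k\<bar> \<le> \<bar>D n k \<bullet> (M *v D n k)\<bar>"
    unfolding R by simp
  also have "\<dots> \<le> real CARD('m) * norm M * (norm (D n k))\<^sup>2"
    by (rule matrix_quadratic_bound)
  also have "\<dots> \<le> real CARD('m) * \<omega> (norm (D n k)) * (norm (D n k))\<^sup>2"
    using M by (intro mult_right_mono mult_left_mono) auto
  finally show ?thesis .
qed

lemma R_bound:
  "\<exists>\<omega> r. 0 < r \<and> mono_on {0..} \<omega> \<and> (\<forall>u\<ge>0. 0 \<le> \<omega> u) \<and> (\<omega> \<longlongrightarrow> 0) (at_right 0) \<and>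
    (\<forall>\<^sub>F n in sequentially. \<forall>k<length (\<pi> n) - 1. \<pi> n ! k \<le> T \<longrightarrow> norm (D n k) \<le> r \<and>
      \<bar>R n k\<bar> \<le> real CARD('m) * \<omega> (norm (D n k)) * (norm (D n k))\<^sup>2)"
proof -
  obtain r where r: "0 < r" "\<forall>\<^sub>F n in sequentially. \<forall>k<length (\<pi> n) - 1. \<pi> n ! k \<le> T \<longrightarrow> norm (D n k) \<le> r"
    using increment_bound by blast
  from bspec[OF modulus[unfolded vertical_modulus_def] x\<Omega>, THEN spec, THEN mp, OF T, THEN spec, THEN mp, OF r(1)]
  obtain \<omega> :: "real \<Rightarrow> real" where \<omega>: "mono_on {0..} \<omega>" "\<forall>u\<ge>0. 0 \<le> \<omega> u" "(\<omega> \<longlongrightarrow> 0) (at_right 0)"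
    "\<forall>\<^sub>F n in sequentially. \<forall>t\<in>{0..T}. \<forall>a \<in> U t (stop (y n) t) \<inter> cball 0 r. \<forall>b \<in> U t (stop (y n) t) \<inter> cball 0 r.
      norm (vertical_hess F t (bump (stop_left (y n) t) t a) -
        vertical_hess F t (bump (stop_left (y n) t) t b)) \<le> \<omega> (norm (a - b))"
    by (elim exE conjE)
  from eventually_regular r(2) \<omega>(4)
  have "\<forall>\<^sub>F n in sequentially. \<forall>k<length (\<pi> n) - 1. \<pi> n ! k \<le> T \<longrightarrow> norm (D n k) \<le> r \<and>
      \<bar>R n k\<bar> \<le> real CARD('m) * \<omega> (norm (D n k)) * (norm (D n k))\<^sup>2"
  proof eventually_elim
    case (elim n)
    show ?case
    proof (intro allI impI conjI)
      fix k assume k: "k < length (\<pi> n) - 1" "\<pi> n ! k \<le> T"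
      show rk: "norm (D n k) \<le> r" using elim k by blast
      have "k < length (\<pi> n)" using k by linarith
      then have "\<pi> n ! k \<in> {0..T}" using k point_nonneg[of k n] by simp
      note mod = bspec[OF bspec[OF bspec[OF elim(3) this]]]
      show "\<bar>R n k\<bar> \<le> real CARD('m) * \<omega> (norm (D n k)) * (norm (D n k))\<^sup>2"
      proof (cases "k = 0")
        case True
        then show ?thesis using \<omega>(2) by (simp add: R_def)
      next
        case False
        show ?thesis
          by (rule R_taylor[OF elim(1) k False rk \<omega>(1)]) (rule mod)
      qed
    qed
  qed
  then show ?thesis
    using r(1) \<omega>(1-3) by blast
qed

lemma remainder_sums_tendsto:
  shows "(\<lambda>n. \<Sum>k\<in>cells n T. R n k) \<longlonglongrightarrow> (\<Sum>\<^sub>\<infinity>s\<in>{0..T}. R_limit s)"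
    and "R_limit summable_on {0..T}"
proof -
  obtain q where "vector_qv \<pi> x q T" using vector_qv_ex ..
  then interpret Q: vector_qv \<pi> x q T .
  obtain \<omega> r where r: "0 < r" and \<omega>: "mono_on {0..} \<omega>" "\<forall>u\<ge>0. 0 \<le> \<omega> u" "(\<omega> \<longlongrightarrow> 0) (at_right 0)"
    and bound: "\<forall>\<^sub>F n in sequentially. \<forall>k<length (\<pi> n) - 1. \<pi> n ! k \<le> T \<longrightarrow> norm (D n k) \<le> r \<and>
      \<bar>R n k\<bar> \<le> real CARD('m) * \<omega> (norm (D n k)) * (norm (D n k))\<^sup>2"
    using R_bound by blast
  define C where "C = real CARD('m)"
  have C: "0 < C" by (simp add: C_def)
  \<comment> \<open>For a vanishing increment the quotient is 0 by the convention for division, and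
    R is 0 as well by its bound, so multiplying by the square recovers R in all cases.\<close>
  define \<psi> where "\<psi> n k = R n k / (norm (D n k))\<^sup>2" for n k
  define g where "g t = (if jump x t = 0 then 0 else R_limit t / (norm (jump x t))\<^sup>2)" for t
  have \<psi>_bound: "\<bar>\<psi> n k\<bar> \<le> (if D n k = 0 then 0 else C * \<omega> (norm (D n k)))"
    if "\<bar>R n k\<bar> \<le> real CARD('m) * \<omega> (norm (D n k)) * (norm (D n k))\<^sup>2" for n k
    using that by (auto simp: \<psi>_def C_def divide_le_eq)
  have bound': "\<forall>\<^sub>F n in sequentially. \<forall>k<length (\<pi> n) - 1. \<pi> n ! k \<le> T \<longrightarrow> \<bar>\<psi> n k\<bar> \<le> C * \<omega> r"
    using bound
  proof eventually_elim
    case (elim n)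
    show ?case
    proof (intro allI impI)
      fix k assume k: "k < length (\<pi> n) - 1" "\<pi> n ! k \<le> T"
      then have "norm (D n k) \<le> r" "\<bar>\<psi> n k\<bar> \<le> (if D n k = 0 then 0 else C * \<omega> (norm (D n k)))"
        using elim \<psi>_bound by auto
      moreover have "\<omega> (norm (D n k)) \<le> \<omega> r"
        using \<omega>(1) calculation(1) r by (auto intro: mono_onD)
      moreover have "0 \<le> \<omega> r" using \<omega>(2) r by simp
      ultimately show "\<bar>\<psi> n k\<bar> \<le> C * \<omega> r"
        using C by (auto split: if_splits intro: order_trans mult_left_mono)
    qed
  qed
  \<comment> \<open>The exceptional set is empty: away from jumps the increments tend to 0, and the
    modulus alone forces the limit 0.\<close>
  have off: "(\<lambda>n. \<psi> n (k n)) \<longlonglongrightarrow> g t"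
    if t: "0 < t" "t \<le> T" "t \<notin> {}" "jump x t = 0"
      and k: "\<forall>\<^sub>F n in sequentially. k n < length (\<pi> n) - 1 \<and> \<pi> n ! k n \<le> T"
      and lim: "(\<lambda>n. \<pi> n ! k n) \<longlonglongrightarrow> t" for t k
  proof -
    have "\<forall>\<^sub>F n in sequentially. k n < length (\<pi> n) - 1"
      using k by eventually_elim simp
    then have D0: "(\<lambda>n. D n (k n)) \<longlonglongrightarrow> 0"
      by (rule increment_tendsto_0[OF x_cadlag _ lim t(4)])
    have "(\<lambda>n. \<psi> n (k n)) \<longlonglongrightarrow> 0"
    proof (rule tendstoI)
      fix e :: real assume "e > 0"
      then have "e / C > 0" using C by simp
      have "\<forall>\<^sub>F u in at_right 0. \<omega> u < e / C"
        using \<omega>(3) \<open>e / C > 0\<close> by (rule order_tendstoD)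
      then obtain b where b: "0 < b" "\<And>u. 0 < u \<Longrightarrow> u < b \<Longrightarrow> \<omega> u < e / C"
        unfolding eventually_at_right_field by blast
      have "\<forall>\<^sub>F n in sequentially. norm (D n (k n)) < b"
        using tendstoD[OF D0 b(1)] by (simp add: dist_norm)
      with bound k show "\<forall>\<^sub>F n in sequentially. dist (\<psi> n (k n)) 0 < e"
      proof eventually_elim
        case (elim n)
        then have "\<bar>\<psi> n (k n)\<bar> \<le> (if D n (k n) = 0 then 0 else C * \<omega> (norm (D n (k n))))"
          by (intro \<psi>_bound) blast
        \<comment> \<open>Smallness of \<omega> near 0 is known for positive arguments; for a zero
          increment the bound on \<open>\<psi>\<close> is 0 anyway.\<close>
        moreover have "C * \<omega> (norm (D n (k n))) < e" if "D n (k n) \<noteq> 0"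
          using b(2)[of "norm (D n (k n))"] that elim C by (simp add: field_simps)
        ultimately show ?case
          using \<open>e > 0\<close> by (auto split: if_splits)
      qed
    qed
    then show ?thesis using t(4) by (simp add: g_def)
  qed
  have atom: "(\<lambda>n. \<psi> n (k n)) \<longlonglongrightarrow> g t"
    if t: "0 < t" "t \<le> T" "jump x t \<noteq> 0" and k: "\<forall>\<^sub>F n in sequentially. bracket \<pi> t n (k n)" for t k
  proof -
    have D: "(\<lambda>n. D n (k n)) \<longlonglongrightarrow> jump x t"
      by (rule bracket_increment[OF x_cadlag k])
    have grad: "(\<lambda>n. grad_left n (k n)) \<longlonglongrightarrow> vertical_grad F t (stop_left x t)"
      using bracket_limit_left[OF left_grad t(1) k] by simp
    have hess: "(\<lambda>n. hess_left n (k n)) \<longlonglongrightarrow> hess_limit t"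
      using bracket_limit_left[OF left_hess t(1) k] by simp
    have quad: "(\<lambda>n. D n (k n) \<bullet> (hess_left n (k n) *v D n (k n))) \<longlonglongrightarrow> jump x t \<bullet> (hess_limit t *v jump x t)"
      unfolding quadratic_form_expand by (intro tendsto_intros hess D)
    have "(\<lambda>n. F (\<pi> n ! k n) (stop (y n) (\<pi> n ! k n)) - F (\<pi> n ! k n) (stop_left (y n) (\<pi> n ! k n))
        - grad_left n (k n) \<bullet> D n (k n) - 1/2 * (D n (k n) \<bullet> (hess_left n (k n) *v D n (k n)))) \<longlonglongrightarrow> R_limit t"
      unfolding R_limit_def
      by (intro tendsto_intros quad grad D bracket_limit_right[OF right t(1) k] bracket_limit_left[OF left t(1) k])
    \<comment> \<open>R is set to 0 at index 0. The bracketing index is eventually positive, because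
      its left endpoint tends to t > 0.\<close>
    moreover have "\<forall>\<^sub>F n in sequentially. 0 < \<pi> n ! k n"
      using bracket_tendsto[OF k] t(1) by (rule order_tendstoD)
    then have "\<forall>\<^sub>F n in sequentially. F (\<pi> n ! k n) (stop (y n) (\<pi> n ! k n)) - F (\<pi> n ! k n) (stop_left (y n) (\<pi> n ! k n))
        - grad_left n (k n) \<bullet> D n (k n) - 1/2 * (D n (k n) \<bullet> (hess_left n (k n) *v D n (k n))) = R n (k n)"
    proof eventually_elim
      case (elim n)
      then have "k n \<noteq> 0" by (metis less_irrefl point_0)
      then show ?case by (simp add: R_def)
    qed
    ultimately have "(\<lambda>n. R n (k n)) \<longlonglongrightarrow> R_limit t"
      by (rule Lim_transform_eventually)
    then have "(\<lambda>n. \<psi> n (k n)) \<longlonglongrightarrow> R_limit t / (norm (jump x t))\<^sup>2"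
      unfolding \<psi>_def using t(3) by (intro tendsto_intros D) auto
    then show ?thesis using t(3) by (simp add: g_def)
  qed
  \<comment> \<open>g vanishes outside a countable set, so no regularity of \<open>R_limit\<close>
    has to be established.\<close>
  have gm: "g \<in> borel_measurable borel"
  proof (rule borel_measurable_continuous_countable_exceptions[OF Q.countable_jumps])
    have "continuous_on (- Q.jumps) (\<lambda>_. 0 :: real)" by (rule continuous_on_const)
    then show "continuous_on (- Q.jumps) g"
      by (rule continuous_on_cong[THEN iffD1, rotated -1]) (auto simp: g_def Q.jumps_def)
  qed
  have R_0: "R_limit t = 0" if "jump x t = 0" for t
    using that by (simp add: R_limit_def stop_left_eq_stop)
  have g_jump: "g t * (norm (jump x t))\<^sup>2 = R_limit t" for t
    by (simp add: g_def R_0)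
  note lim = Q.weighted_norms_tendsto[of "{}" \<psi> "C * \<omega> r" g, OF _ bound' off atom gm]
  have sum: "(\<lambda>n. \<Sum>k\<in>cells n T. \<psi> n k * (norm (D n k))\<^sup>2) \<longlonglongrightarrow>
      (\<Sum>\<^sub>\<infinity>s\<in>{0..T}. g s * (norm (jump x s))\<^sup>2)"
    by (rule lim(1)) (auto simp: g_def)
  have "\<forall>\<^sub>F n in sequentially. (\<Sum>k\<in>cells n T. \<psi> n k * (norm (D n k))\<^sup>2) =
      (\<Sum>k\<in>cells n T. R n k)"
    using bound
  proof eventually_elim
    case (elim n)
    show ?case
    proof (rule sum.cong[OF refl], safe)
      fix k assume "k < length (\<pi> n) - 1" "\<pi> n ! k \<le> T"
      then have "\<bar>R n k\<bar> \<le> real CARD('m) * \<omega> (norm (D n k)) * (norm (D n k))\<^sup>2"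
        using elim by blast
      then show "\<psi> n k * (norm (D n k))\<^sup>2 = R n k"
        by (cases "D n k = 0") (auto simp: \<psi>_def)
    qed
  qed
  with sum show "(\<lambda>n. \<Sum>k\<in>cells n T. R n k) \<longlonglongrightarrow> (\<Sum>\<^sub>\<infinity>s\<in>{0..T}. R_limit s)"
    unfolding g_jump by (rule Lim_transform_eventually)
  have "(\<lambda>s. g s * (norm (jump x s))\<^sup>2) summable_on {0..T}"
    by (rule lim(2)) (auto simp: g_def)
  then show "R_limit summable_on {0..T}"
    unfolding g_jump .
qed

subsection \<open>The change of variable formula\<close>

definition jump_term :: "real \<Rightarrow> real" where
  "jump_term t = F t (stop x t) - F t (stop_left x t) - vertical_grad F t (stop_left x t) \<bullet> jump x t"

text \<open>By the definition of \<open>R_limit\<close> the jump term is the quadratic Hessian term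
  plus the limit of the remainders, both already known to be summable. The quadratic part will
  cancel the atoms in the limit of the Hessian sums, leaving only [x]^c in the formula.\<close>

lemma jump_term_has_sum:
  "(jump_term has_sum (1/2 * (\<Sum>a\<in>UNIV. \<Sum>b\<in>UNIV. \<Sum>\<^sub>\<infinity>s\<in>{0..T}. hess_limit s $ a $ b * (jump x s $ a * jump x s $ b)) +
    (\<Sum>\<^sub>\<infinity>s\<in>{0..T}. R_limit s))) {0..T}"
proof -
  have eq: "jump_term = (\<lambda>s. 1/2 * (\<Sum>a\<in>UNIV. \<Sum>b\<in>UNIV. hess_limit s $ a $ b * (jump x s $ a * jump x s $ b)) + R_limit s)"
    by (rule ext) (simp add: jump_term_def R_limit_def quadratic_form_expand)
  show ?thesis
    unfolding eq
    by (intro has_sum_add has_sum_cmult_right has_sum_sum has_sum_infsum hess_sums_tendsto(2) remainder_sums_tendsto(2))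
qed

text \<open>The first increment vanishes in the limit by right-continuity of x at 0. Gradient and
  Hessian converge there, since the constant sequence 0 meets the constraint of left-continuity at
  time 0.\<close>

lemma boundary_term_tendsto:
  "(\<lambda>n. grad_left n 0 \<bullet> D n 0 + 1/2 * (D n 0 \<bullet> (hess_left n 0 *v D n 0))) \<longlonglongrightarrow> 0"
proof -
  have len: "\<forall>\<^sub>F n in sequentially. 0 < length (\<pi> n) - 1"
    using last_point[of 0] by eventually_elim auto
  have D: "(\<lambda>n. D n 0) \<longlonglongrightarrow> 0"
    by (rule increment_tendsto_0[OF x_cadlag len, of 0]) (simp_all add: point_0 jump_nonpos[OF x_cadlag])
  have grad: "(\<lambda>n. grad_left n 0) \<longlonglongrightarrow> vertical_grad F 0 (stop_left x 0)"
    using limit_left[OF left_grad, of 0 "\<lambda>_. 0"] by (simp add: point_0 prev_point_nonneg)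
  have hess: "(\<lambda>n. hess_left n 0) \<longlonglongrightarrow> hess_limit 0"
    using limit_left[OF left_hess, of 0 "\<lambda>_. 0"] by (simp add: point_0 prev_point_nonneg)
  have "(\<lambda>n. grad_left n 0 \<bullet> D n 0 + 1/2 * (D n 0 \<bullet> (hess_left n 0 *v D n 0))) \<longlonglongrightarrow>
      vertical_grad F 0 (stop_left x 0) \<bullet> 0 + 1/2 * (0 \<bullet> (hess_limit 0 *v 0))"
    unfolding quadratic_form_expand by (intro tendsto_intros grad hess D)
  then show ?thesis by simp
qed

text \<open>The telescoped identity solved for the pathwise sums. Every term on the right has a
  known limit, so the existence of the pathwise integral is a by-product.\<close>

lemma pathwise_sums_eq:
  "\<forall>\<^sub>F n in sequentially. pathwise_sums \<pi> F x T n =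
    F T (stop (y n) T) - F 0 (stop (y n) 0) - (LINT t:{0..T}|lborel. horizontal_deriv F t (stop (y n) t))
    + (grad_left n 0 \<bullet> D n 0 + 1/2 * (D n 0 \<bullet> (hess_left n 0 *v D n 0)))
    - 1/2 * (\<Sum>a\<in>UNIV. \<Sum>b\<in>UNIV. \<Sum>k\<in>cells n T. hess_left n k $ a $ b * (D n k $ a * D n k $ b))
    - (\<Sum>k\<in>cells n T. R n k)"
  using telescope eventually_regular
proof eventually_elim
  case (elim n)
  define K where "K = cells n T"
  have K: "finite K" "0 \<in> K"
    using elim(2) T by (auto simp: K_def regular_def point_0)
  define b where "b = grad_left n 0 \<bullet> D n 0 + 1/2 * (D n 0 \<bullet> (hess_left n 0 *v D n 0))"
  have decomp: "(if k = 0 then 0 else F (\<pi> n ! k) (stop (y n) (\<pi> n ! k)) - F (\<pi> n ! k) (stop_left (y n) (\<pi> n ! k))) =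
      grad_left n k \<bullet> D n k + 1/2 * (D n k \<bullet> (hess_left n k *v D n k)) + R n k - (if k = 0 then b else 0)" for k
    by (simp add: R_def b_def)
  have "(\<Sum>k\<in>K. if k = 0 then 0 else F (\<pi> n ! k) (stop (y n) (\<pi> n ! k)) - F (\<pi> n ! k) (stop_left (y n) (\<pi> n ! k))) =
      (\<Sum>k\<in>K. grad_left n k \<bullet> D n k) + 1/2 * (\<Sum>k\<in>K. D n k \<bullet> (hess_left n k *v D n k)) + (\<Sum>k\<in>K. R n k) - b"
    unfolding decomp using K by (simp add: sum.distrib sum_subtractf sum_distrib_left)
  moreover have "(\<Sum>k\<in>K. D n k \<bullet> (hess_left n k *v D n k)) =
      (\<Sum>a\<in>UNIV. \<Sum>b\<in>UNIV. \<Sum>k\<in>K. hess_left n k $ a $ b * (D n k $ a * D n k $ b))"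
    unfolding quadratic_form_expand by (subst sum.swap, intro sum.cong refl sum.swap)
  ultimately show ?case
    using elim(1) unfolding pathwise_sums_def K_def[symmetric] b_def[symmetric] by simp
qed

theorem change_of_variable:
  "convergent (pathwise_sums \<pi> F x T)
    \<and> (\<lambda>t. \<bar>jump_term t\<bar>) summable_on {0..T}
    \<and> set_integrable lborel {0..T} (\<lambda>t. horizontal_deriv F t (stop x t))
    \<and> (\<forall>i j. stieltjes_integrable (\<lambda>t. hess_limit t $ i $ j) (qv_cont \<pi> x i j) T)
    \<and> F T (stop x T) = F 0 (stop x 0)
        + (LINT t:{0..T}|lborel. horizontal_deriv F t (stop x t))
        + pathwise_integral \<pi> F x T
        + 1/2 * (\<Sum>i\<in>UNIV. \<Sum>j\<in>UNIV. stieltjes_integral (\<lambda>t. hess_limit t $ i $ j) (qv_cont \<pi> x i j) T)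
        + (\<Sum>\<^sub>\<infinity>t\<in>{0..T}. jump_term t)"
proof -
  define I where "I a b = stieltjes_integral (\<lambda>t. hess_limit t $ a $ b) (qv_cont \<pi> x a b) T" for a b
  define J where "J a b = (\<Sum>\<^sub>\<infinity>s\<in>{0..T}. hess_limit s $ a $ b * (jump x s $ a * jump x s $ b))" for a b
  have hess: "stieltjes_integrable (\<lambda>t. hess_limit t $ a $ b) (qv_cont \<pi> x a b) T \<and>
    (\<lambda>n. \<Sum>k\<in>cells n T. hess_left n k $ a $ b * (D n k $ a * D n k $ b)) \<longlonglongrightarrow> I a b + J a b"
    for a b
  proof -
    obtain i where i: "has_stieltjes_integral (\<lambda>t. hess_limit t $ a $ b) (qv_cont \<pi> x a b) T i"
      "(\<lambda>n. \<Sum>k\<in>cells n T. hess_left n k $ a $ b * (D n k $ a * D n k $ b)) \<longlonglongrightarrow> i + J a b"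
      using hess_sums_tendsto(1)[of a b] unfolding J_def by blast
    moreover have "I a b = i"
      unfolding I_def using T i(1) by (rule stieltjes_integral_eqI)
    ultimately show ?thesis
      by (auto simp: stieltjes_integrable_def)
  qed
  have FT: "(\<lambda>n. F T (stop (y n) T)) \<longlonglongrightarrow> F T (stop x T)"
    by (rule limit_right[OF right T]) (use T in \<open>auto intro: prev_point_le\<close>)
  have F0: "(\<lambda>n. F 0 (stop (y n) 0)) \<longlonglongrightarrow> F 0 (stop x 0)"
    by (rule limit_right[OF right]) (auto intro: prev_point_le)
  \<comment> \<open>The summand 0 is the limit of the boundary term, and J collects the atoms of the
    Hessian sums.\<close>
  define L where "L = F T (stop x T) - F 0 (stop x 0) - (LINT t:{0..T}|lborel. horizontal_deriv F t (stop x t))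
    + 0 - 1/2 * (\<Sum>a\<in>UNIV. \<Sum>b\<in>UNIV. I a b + J a b) - (\<Sum>\<^sub>\<infinity>s\<in>{0..T}. R_limit s)"
  have "(\<lambda>n. F T (stop (y n) T) - F 0 (stop (y n) 0) - (LINT t:{0..T}|lborel. horizontal_deriv F t (stop (y n) t))
    + (grad_left n 0 \<bullet> D n 0 + 1/2 * (D n 0 \<bullet> (hess_left n 0 *v D n 0)))
    - 1/2 * (\<Sum>a\<in>UNIV. \<Sum>b\<in>UNIV. \<Sum>k\<in>cells n T. hess_left n k $ a $ b * (D n k $ a * D n k $ b))
    - (\<Sum>k\<in>cells n T. R n k)) \<longlonglongrightarrow> L"
    unfolding L_def
    using hess by (intro tendsto_diff tendsto_add tendsto_mult tendsto_const tendsto_sum FT F0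
        DF_integral_limit(2) boundary_term_tendsto remainder_sums_tendsto(1)) auto
  moreover have "\<forall>\<^sub>F n in sequentially. F T (stop (y n) T) - F 0 (stop (y n) 0)
    - (LINT t:{0..T}|lborel. horizontal_deriv F t (stop (y n) t))
    + (grad_left n 0 \<bullet> D n 0 + 1/2 * (D n 0 \<bullet> (hess_left n 0 *v D n 0)))
    - 1/2 * (\<Sum>a\<in>UNIV. \<Sum>b\<in>UNIV. \<Sum>k\<in>cells n T. hess_left n k $ a $ b * (D n k $ a * D n k $ b))
    - (\<Sum>k\<in>cells n T. R n k) = pathwise_sums \<pi> F x T n"
    using pathwise_sums_eq by eventually_elim (rule sym)
  ultimately have lim: "pathwise_sums \<pi> F x T \<longlonglongrightarrow> L"
    by (rule Lim_transform_eventually)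
  then have "pathwise_integral \<pi> F x T = L"
    unfolding pathwise_integral_def by (rule limI)
  moreover have "(\<Sum>\<^sub>\<infinity>t\<in>{0..T}. jump_term t) = 1/2 * (\<Sum>a\<in>UNIV. \<Sum>b\<in>UNIV. J a b) + (\<Sum>\<^sub>\<infinity>s\<in>{0..T}. R_limit s)"
    unfolding J_def using jump_term_has_sum by (rule infsumI)
  ultimately have "F T (stop x T) = F 0 (stop x 0) + (LINT t:{0..T}|lborel. horizontal_deriv F t (stop x t))
        + pathwise_integral \<pi> F x T + 1/2 * (\<Sum>i\<in>UNIV. \<Sum>j\<in>UNIV. I i j) + (\<Sum>\<^sub>\<infinity>t\<in>{0..T}. jump_term t)"
    by (simp add: L_def sum.distrib)
  \<comment> \<open>Unordered summability of real families is absolute summability.\<close>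
  moreover have "(\<lambda>t. \<bar>jump_term t\<bar>) summable_on {0..T}"
    using has_sum_imp_summable[OF jump_term_has_sum]
    by (subst (asm) summable_on_iff_abs_summable_on_real) simp
  ultimately show ?thesis
    using convergentI[OF lim] DF_integral_limit(1) hess by (simp add: I_def)
qed

end

theorem theorem5p14:
  fixes \<pi> :: "nat \<Rightarrow> real list"
    and \<Omega> :: "(real \<Rightarrow> real^'m) set"
    and U :: "real \<Rightarrow> (real \<Rightarrow> real^'m) \<Rightarrow> (real^'m) set"
    and F :: "real \<Rightarrow> (real \<Rightarrow> real^'m) \<Rightarrow> real"
    and x :: "real \<Rightarrow> real^'m"
    and T :: real
  assumes "partition_seq \<pi>"
    and "generic \<pi> \<Omega>"
    and "admissible_nhds \<Omega> U"
    and "x \<in> \<Omega> \<inter> qv_paths \<pi>"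
    and "T \<ge> 0"
    and "F \<in> C12 \<pi> \<Omega> U"
  shows "convergent (pathwise_sums \<pi> F x T)
    \<and> (\<lambda>t. \<bar>F t (stop x t) - F t (stop_left x t)
             - vertical_grad F t (stop_left x t) \<bullet> jump x t\<bar>) summable_on {0..T}
    \<and> set_integrable lborel {0..T} (\<lambda>t. horizontal_deriv F t (stop x t))
    \<and> (\<forall>i j. stieltjes_integrable
               (\<lambda>t. vertical_hess F t (stop_left x t) $ i $ j) (qv_cont \<pi> x i j) T)
    \<and> F T (stop x T) = F 0 (stop x 0)
        + (LINT t:{0..T}|lborel. horizontal_deriv F t (stop x t))
        + pathwise_integral \<pi> F x T
        + 1/2 * (\<Sum>i\<in>UNIV. \<Sum>j\<in>UNIV. stieltjes_integral
                   (\<lambda>t. vertical_hess F t (stop_left x t) $ i $ j) (qv_cont \<pi> x i j) T)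
        + (\<Sum>\<^sub>\<infinity>t\<in>{0..T}. F t (stop x t) - F t (stop_left x t)
                        - vertical_grad F t (stop_left x t) \<bullet> jump x t)"
proof -
  interpret ito \<pi> \<Omega> U F x T
    using assms by unfold_locales auto
  show ?thesis
    using change_of_variable unfolding jump_term_def .
qed

end
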